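(* If $1<p,q<\infty$, $p\neq q$ and neither $p$ nor $q$ is equal to $2$, then the Banach algebra $\mathcal{F}(\ell_p\oplus\ell_q)$ is not amenable.
   Context: For a Banach space $Z$, $\mathcal{F}(Z)$ is the Banach algebra of approximable operators on $Z$: the operator-norm closure in $\mathcal{B}(Z)$ of the finite rank operators. Scalars are complex. A Banach algebra $\mathcal{A}$ is amenable if for every Banach $\mathcal{A}$-bimodule $Z$, every continuous derivation $D:\mathcal{A}\to Z^*$ is inner, i.e. of the form $a\mapsto a\cdot z^*-z^*\cdot a$ for some $z^*\in Z^*$. Here $Z^*$ carries the dual module actions $\langle a\cdot z^*,z\rangle=\langle z^*,z\cdot a\rangle$, $\langle z^*\cdot a,z\rangle=\langle z^*,a\cdot z\rangle$, and a derivation is a linear map with $D(ab)=a\cdot D(b)+D(a)\cdot b$. *)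

theory Defs
  imports "HOL-Analysis.Analysis" "HOL-Algebra.Module"
begin

section \<open>Complex Banach spaces on explicit carriers\<close>

text \<open>
  The exponents of the sequence spaces are terms, so these spaces and their operator algebras
  are not types. Complex vector spaces are therefore modules, in the sense of HOL-Algebra, over
  the field of complex numbers, and the record of a module is extended by a norm. The ring
  fields \<open>mult\<close> and \<open>one\<close> of this record are irrelevant for a vector
  space. For an algebra \<open>mult\<close> is the product, whereas \<open>one\<close> is
  still irrelevant: algebras are not assumed to be unital.
\<close>

definition complex_ring :: "complex ring" where
  "complex_ring = \<lparr>carrier = UNIV, mult = (*), one = 1, zero = 0, add = (+)\<rparr>"

record 'a nspace = "(complex, 'a) module" +
  vnorm :: "'a \<Rightarrow> real"

locale normed_cspace = Module.module complex_ring V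
  for V :: "('a, 'm) nspace_scheme" (structure) +
  assumes vnorm_eq_0_iff: "x \<in> carrier V \<Longrightarrow> vnorm V x = 0 \<longleftrightarrow> x = \<zero>"
    and vnorm_triangle: "\<lbrakk>x \<in> carrier V; y \<in> carrier V\<rbrakk> \<Longrightarrow> vnorm V (x \<oplus> y) \<le> vnorm V x + vnorm V y"
    and vnorm_smult: "x \<in> carrier V \<Longrightarrow> vnorm V (c \<odot> x) = cmod c * vnorm V x"

text \<open>\<open>Metric_space\<close> asks for non-negativity and symmetry also outside the carrier.\<close>

definition vdist :: "('a, 'm) nspace_scheme \<Rightarrow> 'a \<Rightarrow> 'a \<Rightarrow> real" where
  "vdist V x y = (if x \<in> carrier V \<and> y \<in> carrier V then vnorm V (x \<ominus>\<^bsub>V\<^esub> y) else 0)"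

definition norm_topology :: "('a, 'm) nspace_scheme \<Rightarrow> 'a topology" where
  "norm_topology V = Metric_space.mtopology (carrier V) (vdist V)"

locale banach_cspace = normed_cspace +
  assumes complete: "Metric_space.mcomplete (carrier V) (vdist V)"

definition complex_line :: "complex nspace" where
  "complex_line =
    \<lparr>carrier = UNIV, mult = (*), one = 1, zero = 0, add = (+), smult = (*), vnorm = cmod\<rparr>"

section \<open>Bounded operators\<close>

definition clinear_map ::
  "('a, 'm) nspace_scheme \<Rightarrow> ('b, 'n) nspace_scheme \<Rightarrow> ('a \<Rightarrow> 'b) \<Rightarrow> bool" where
  "clinear_map V W f \<longleftrightarrow>
    f \<in> carrier V \<rightarrow> carrier W \<and>
    (\<forall>x\<in>carrier V. \<forall>y\<in>carrier V. f (x \<oplus>\<^bsub>V\<^esub> y) = f x \<oplus>\<^bsub>W\<^esub> f y) \<and>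
    (\<forall>c. \<forall>x\<in>carrier V. f (c \<odot>\<^bsub>V\<^esub> x) = c \<odot>\<^bsub>W\<^esub> f x)"

definition bounded_clinear_map ::
  "('a, 'm) nspace_scheme \<Rightarrow> ('b, 'n) nspace_scheme \<Rightarrow> ('a \<Rightarrow> 'b) \<Rightarrow> bool" where
  "bounded_clinear_map V W f \<longleftrightarrow>
    clinear_map V W f \<and> (\<exists>K. \<forall>x\<in>carrier V. vnorm W (f x) \<le> K * vnorm V x)"

text \<open>
  Operators are functions that are \<open>extensional\<close> on the carrier of the domain, so that
  equality of operators is equality of functions. The norm is the operator norm.
\<close>

definition operator_space ::
  "('a, 'm) nspace_scheme \<Rightarrow> ('b, 'n) nspace_scheme \<Rightarrow> ('a \<Rightarrow> 'b) nspace" where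
  "operator_space V W =
    \<lparr>carrier = {f \<in> extensional (carrier V). bounded_clinear_map V W f},
     mult = undefined,
     one = undefined,
     zero = (\<lambda>x\<in>carrier V. \<zero>\<^bsub>W\<^esub>),
     add = (\<lambda>f g. \<lambda>x\<in>carrier V. f x \<oplus>\<^bsub>W\<^esub> g x),
     smult = (\<lambda>c f. \<lambda>x\<in>carrier V. c \<odot>\<^bsub>W\<^esub> f x),
     vnorm = (\<lambda>f. SUP x\<in>{x \<in> carrier V. vnorm V x \<le> 1}. vnorm W (f x))\<rparr>"

abbreviation dual_space :: "('a, 'm) nspace_scheme \<Rightarrow> ('a \<Rightarrow> complex) nspace" where
  "dual_space V \<equiv> operator_space V complex_line"

definition operator_algebra :: "('a, 'm) nspace_scheme \<Rightarrow> ('a \<Rightarrow> 'a) nspace" where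
  "operator_algebra V =
    (operator_space V V)\<lparr>mult := compose (carrier V), one := (\<lambda>x\<in>carrier V. x)\<rparr>"

definition finite_rank :: "('a, 'm) nspace_scheme \<Rightarrow> ('a \<Rightarrow> 'a) \<Rightarrow> bool" where
  "finite_rank V f \<longleftrightarrow>
    (\<exists>B. finite B \<and> B \<subseteq> carrier V \<and>
      (\<forall>x\<in>carrier V. \<exists>c. f x = (\<Oplus>\<^bsub>V\<^esub>b\<in>B. c b \<odot>\<^bsub>V\<^esub> b)))"

definition approximable_algebra :: "('a, 'm) nspace_scheme \<Rightarrow> ('a \<Rightarrow> 'a) nspace" where
  "approximable_algebra V =
    (operator_algebra V)\<lparr>carrier :=
      norm_topology (operator_algebra V) closure_of
        {f \<in> carrier (operator_algebra V). finite_rank V f}\<rparr>"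

section \<open>Amenable Banach algebras\<close>

locale banach_calgebra = banach_cspace A for A :: "('a, 'm) nspace_scheme" (structure) +
  assumes mult_closed: "\<lbrakk>a \<in> carrier A; b \<in> carrier A\<rbrakk> \<Longrightarrow> a \<otimes> b \<in> carrier A"
    and mult_assoc: "\<lbrakk>a \<in> carrier A; b \<in> carrier A; c \<in> carrier A\<rbrakk> \<Longrightarrow>
      (a \<otimes> b) \<otimes> c = a \<otimes> (b \<otimes> c)"
    and mult_linear_left: "b \<in> carrier A \<Longrightarrow> clinear_map A A (\<lambda>a. a \<otimes> b)"
    and mult_linear_right: "a \<in> carrier A \<Longrightarrow> clinear_map A A (\<lambda>b. a \<otimes> b)"
    and vnorm_mult: "\<lbrakk>a \<in> carrier A; b \<in> carrier A\<rbrakk> \<Longrightarrow> vnorm A (a \<otimes> b) \<le> vnorm A a * vnorm A b"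

locale banach_bimodule = A: banach_calgebra A + Z: banach_cspace Z
  for A :: "('a, 'm) nspace_scheme" and Z :: "('z, 'n) nspace_scheme"
    and lact :: "'a \<Rightarrow> 'z \<Rightarrow> 'z" and ract :: "'z \<Rightarrow> 'a \<Rightarrow> 'z" +
  assumes lact_linear_alg: "z \<in> carrier Z \<Longrightarrow> clinear_map A Z (\<lambda>a. lact a z)"
    and lact_linear_vec: "a \<in> carrier A \<Longrightarrow> clinear_map Z Z (\<lambda>z. lact a z)"
    and ract_linear_alg: "z \<in> carrier Z \<Longrightarrow> clinear_map A Z (\<lambda>a. ract z a)"
    and ract_linear_vec: "a \<in> carrier A \<Longrightarrow> clinear_map Z Z (\<lambda>z. ract z a)"
    and lact_mult: "\<lbrakk>a \<in> carrier A; b \<in> carrier A; z \<in> carrier Z\<rbrakk> \<Longrightarrow>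
      lact (a \<otimes>\<^bsub>A\<^esub> b) z = lact a (lact b z)"
    and ract_mult: "\<lbrakk>a \<in> carrier A; b \<in> carrier A; z \<in> carrier Z\<rbrakk> \<Longrightarrow>
      ract z (a \<otimes>\<^bsub>A\<^esub> b) = ract (ract z a) b"
    and lact_ract: "\<lbrakk>a \<in> carrier A; b \<in> carrier A; z \<in> carrier Z\<rbrakk> \<Longrightarrow>
      ract (lact a z) b = lact a (ract z b)"
    and lact_bounded: "\<exists>K. \<forall>a\<in>carrier A. \<forall>z\<in>carrier Z.
      vnorm Z (lact a z) \<le> K * vnorm A a * vnorm Z z"
    and ract_bounded: "\<exists>K. \<forall>a\<in>carrier A. \<forall>z\<in>carrier Z.
      vnorm Z (ract z a) \<le> K * vnorm A a * vnorm Z z"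

text \<open>Note the exchange of sides: the left action on the dual comes from the right action.\<close>

definition dual_lact ::
  "('z, 'n) nspace_scheme \<Rightarrow> ('z \<Rightarrow> 'a \<Rightarrow> 'z) \<Rightarrow> 'a \<Rightarrow> ('z \<Rightarrow> complex) \<Rightarrow> ('z \<Rightarrow> complex)" where
  "dual_lact Z ract a \<phi> = (\<lambda>z\<in>carrier Z. \<phi> (ract z a))"

definition dual_ract ::
  "('z, 'n) nspace_scheme \<Rightarrow> ('a \<Rightarrow> 'z \<Rightarrow> 'z) \<Rightarrow> ('z \<Rightarrow> complex) \<Rightarrow> 'a \<Rightarrow> ('z \<Rightarrow> complex)" where
  "dual_ract Z lact \<phi> a = (\<lambda>z\<in>carrier Z. \<phi> (lact a z))"

definition derivation ::
  "('a, 'm) nspace_scheme \<Rightarrow> ('z, 'n) nspace_scheme \<Rightarrow>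
    ('a \<Rightarrow> 'z \<Rightarrow> 'z) \<Rightarrow> ('z \<Rightarrow> 'a \<Rightarrow> 'z) \<Rightarrow> ('a \<Rightarrow> 'z) \<Rightarrow> bool" where
  "derivation A M lact ract D \<longleftrightarrow>
    clinear_map A M D \<and>
    (\<forall>a\<in>carrier A. \<forall>b\<in>carrier A. D (a \<otimes>\<^bsub>A\<^esub> b) = lact a (D b) \<oplus>\<^bsub>M\<^esub> ract (D a) b)"

definition inner_derivation ::
  "('a, 'm) nspace_scheme \<Rightarrow> ('z, 'n) nspace_scheme \<Rightarrow>
    ('a \<Rightarrow> 'z \<Rightarrow> 'z) \<Rightarrow> ('z \<Rightarrow> 'a \<Rightarrow> 'z) \<Rightarrow> ('a \<Rightarrow> 'z) \<Rightarrow> bool" where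
  "inner_derivation A M lact ract D \<longleftrightarrow>
    (\<exists>m\<in>carrier M. \<forall>a\<in>carrier A. D a = lact a m \<ominus>\<^bsub>M\<^esub> ract m a)"

text \<open>
  A definition in HOL cannot quantify over types, so the bimodules \<open>Z\<close> below have their
  carriers in the type of the elements of \<open>A\<close>. The carrier may be any subset and the
  operations are arbitrary. This loses no generality. If \<open>A \<noteq> 0\<close>, then every
  closed submodule that is generated by a countable set has at most as many elements as
  \<open>A\<close>, so that it has an isometric copy inside this type. Suppose that the restriction of
  \<open>D\<close> to each such submodule \<open>Y\<close> is inner, that is, \<open>D\<close> followed by
  \<open>Z\<^sup>* \<rightarrow> Y\<^sup>*\<close>. The norms of suitable implementing functionals are then
  bounded uniformly in \<open>Y\<close>, because countably many \<open>Y\<close> lie in a single one.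
  By the Hahn-Banach theorem and weak-star compactness of balls in \<open>Z\<^sup>*\<close>, the
  derivation \<open>D\<close> itself is inner. If \<open>A = 0\<close>, all derivations are zero.
\<close>

definition amenable :: "'a nspace \<Rightarrow> bool" where
  "amenable A \<longleftrightarrow>
    (\<forall>(Z :: 'a nspace) lact ract D.
      banach_bimodule A Z lact ract \<longrightarrow>
      derivation A (dual_space Z) (dual_lact Z ract) (dual_ract Z lact) D \<longrightarrow>
      continuous_map (norm_topology A) (norm_topology (dual_space Z)) D \<longrightarrow>
      inner_derivation A (dual_space Z) (dual_lact Z ract) (dual_ract Z lact) D)"

section \<open>Sequence spaces and direct sums\<close>

definition ell :: "real \<Rightarrow> (nat \<Rightarrow> complex) nspace" where
  "ell p =
    \<lparr>carrier = {x. summable (\<lambda>n. cmod (x n) powr p)},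
     mult = undefined,
     one = undefined,
     zero = (\<lambda>n. 0),
     add = (\<lambda>x y n. x n + y n),
     smult = (\<lambda>c x n. c * x n),
     vnorm = (\<lambda>x. (\<Sum>n. cmod (x n) powr p) powr (1 / p))\<rparr>"

text \<open>
  All the usual norms on a direct sum of two Banach spaces are equivalent, and \<open>amenable\<close>
  and \<open>approximable_algebra\<close> are unaffected, up to isomorphism, by passing to an
  equivalent norm.
\<close>

definition direct_sum ::
  "('a, 'm) nspace_scheme \<Rightarrow> ('b, 'n) nspace_scheme \<Rightarrow> ('a \<times> 'b) nspace" where
  "direct_sum V W =
    \<lparr>carrier = carrier V \<times> carrier W,
     mult = undefined,
     one = undefined,
     zero = (\<zero>\<^bsub>V\<^esub>, \<zero>\<^bsub>W\<^esub>),
     add = (\<lambda>(x, y) (x', y'). (x \<oplus>\<^bsub>V\<^esub> x', y \<oplus>\<^bsub>W\<^esub> y')),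
     smult = (\<lambda>c (x, y). (c \<odot>\<^bsub>V\<^esub> x, c \<odot>\<^bsub>W\<^esub> y)),
     vnorm = (\<lambda>(x, y). vnorm V x + vnorm W y)\<rparr>"

end

theory Submission
  imports Defs
begin

text \<open>
  Let \<open>E\<close> be the direct sum of \<open>ell p\<close> and \<open>ell q\<close>, let \<open>P\<close> be the
  projection of \<open>E\<close> onto the first summand, and let \<open>A\<close> be the algebra of approximable
  operators on \<open>E\<close>. The obstruction to amenability is the derivation \<open>a \<mapsto> a P - P a\<close>.
  The commutator \<open>a P - P a\<close> is the sum of an operator from the first summand to the second and
  an operator in the opposite direction, so it factors through both summands. Suppose that the
  derivation were implemented by some \<open>m\<close> that is a limit of operators whose norms of
  factorization through both summands stay bounded. Then \<open>P - m\<close> commutes with \<open>A\<close> and is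
  therefore a scalar \<open>\<lambda>\<close>. Since \<open>1 - \<lambda>\<close> and \<open>- \<lambda>\<close> do not both vanish,
  the identity of the \<open>n\<close>-dimensional coordinate subspace of \<open>ell p\<close> would factor through
  \<open>ell q\<close> with bounds independent of \<open>n\<close>, or conversely, at least as far as normalized
  traces can tell. For exponents that are distinct and different from 2 this is impossible.

  In terms of dual bimodules, let \<open>Z\<close> consist of the bounded operators \<open>z\<close> for which the
  traces of \<open>w z\<close> are bounded when \<open>w\<close> ranges over the products of contractions that pass
  through both summands. The functional \<open>D a\<close> sends \<open>z\<close> to the trace of
  \<open>(a P - P a) z\<close>, defined as a limit of truncated traces. The limit exists because
  approximable operators are norm limits of their coordinate truncations (\<open>carrier_A\<close>). If
  \<open>m\<close> in the dual of \<open>Z\<close> implements \<open>D\<close>, then evaluation at matrix units gives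
  \<open>m e\<^sub>i\<^sub>i - m e\<^sub>j\<^sub>j = 1\<close> for \<open>i\<close> in the first summand and \<open>j\<close> in
  the second. Adding \<open>n\<close> such equations shows that \<open>n\<close> is at most the norm of
  \<open>m\<close> times the sum of the norms in \<open>Z\<close> of two coordinate projections of rank
  \<open>n\<close>. So amenability fails as soon as these norms are \<open>o(n)\<close> (\<open>not_amenable\<close>).

  This is what \<open>ell_trace_estimate\<close> provides: if \<open>T\<close> maps \<open>ell a\<close> to
  \<open>ell b\<close> and \<open>S\<close> maps \<open>ell b\<close> to \<open>ell a\<close>, both contractively, then the
  sum of the first \<open>n\<close> diagonal entries of \<open>S T\<close> is \<open>O(n\<^sup>1\<^sup>-\<^sup>\<delta>)\<close>. By
  transposition one may assume \<open>a < 2\<close>. Khintchine's inequality bounds the square function of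
  the vectors that represent \<open>S\<close>. If \<open>2 < b\<close> or \<open>a < b < 2\<close>, the trivial estimate for
  the square function of the vectors that represent \<open>T\<close> is already better than what Hoelder's
  inequality needs to give \<open>O(n)\<close>. If \<open>b < a < 2\<close>, the coordinate vectors of \<open>ell a\<close>
  may be mapped to something like independent stable variables in \<open>ell b\<close>, and both square
  functions can have the critical size. Here random multipliers with heavy tails bound
  \<open>u\<close>-functions for some \<open>u\<close> between \<open>a\<close> and 2, which together with a splitting of the
  entries of \<open>S\<close> by size gains a power of \<open>n\<close>.
\<close>

section \<open>Hoelder's inequality, averages and Khintchine's inequality\<close>

lemma Holder_sum:
  fixes a b :: "'i \<Rightarrow> real"
  assumes p: "p > 1" and s: "s > 1" and ps: "1/p + 1/s = 1"
    and a: "\<And>i. i \<in> I \<Longrightarrow> a i \<ge> 0" and b: "\<And>i. i \<in> I \<Longrightarrow> b i \<ge> 0"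
  shows "(\<Sum>i\<in>I. a i * b i) \<le> (\<Sum>i\<in>I. a i powr p) powr (1/p) * (\<Sum>i\<in>I. b i powr s) powr (1/s)"
proof (cases "finite I \<and> (\<Sum>i\<in>I. a i powr p) \<noteq> 0 \<and> (\<Sum>i\<in>I. b i powr s) \<noteq> 0")
  case True
  define A where "A = (\<Sum>i\<in>I. a i powr p)"
  define B where "B = (\<Sum>i\<in>I. b i powr s)"
  have A: "A > 0" and B: "B > 0"
    using True unfolding A_def B_def by (auto simp: order_less_le intro!: sum_nonneg)
  define \<alpha> where "\<alpha> = A powr (1/p)"
  define \<beta> where "\<beta> = B powr (1/s)"
  have \<alpha>: "\<alpha> > 0" "\<alpha> powr p = A" and \<beta>: "\<beta> > 0" "\<beta> powr s = B"
    using A B p s by (auto simp: \<alpha>_def \<beta>_def powr_powr)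
  have "(\<Sum>i\<in>I. (a i / \<alpha>) * (b i / \<beta>)) \<le> (\<Sum>i\<in>I. (a i / \<alpha>) powr p / p + (b i / \<beta>) powr s / s)"
    using \<alpha> \<beta> a b by (intro sum_mono Youngs_inequality p s ps) auto
  also have "\<dots> = (\<Sum>i\<in>I. a i powr p / A / p + b i powr s / B / s)"
    using \<alpha> \<beta> a b by (intro sum.cong refl) (auto simp: powr_divide)
  also have "\<dots> = 1/p + 1/s"
    using A B by (simp add: sum.distrib A_def B_def flip: sum_divide_distrib)
  finally have "(\<Sum>i\<in>I. a i * b i) / (\<alpha> * \<beta>) \<le> 1"
    using ps by (simp add: sum_divide_distrib)
  then show ?thesis
    using \<alpha> \<beta> by (simp add: A_def B_def \<alpha>_def \<beta>_def divide_le_eq)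
next
  case False
  then consider "infinite I" | "finite I" "(\<Sum>i\<in>I. a i powr p) = 0" | "finite I" "(\<Sum>i\<in>I. b i powr s) = 0" by auto
  then show ?thesis
  proof cases
    case 2
    then have "\<forall>i\<in>I. a i = 0" by (subst (asm) sum_nonneg_eq_0_iff) auto
    then show ?thesis by simp
  next
    case 3
    then have "\<forall>i\<in>I. b i = 0" by (subst (asm) sum_nonneg_eq_0_iff) auto
    then show ?thesis by simp
  qed simp
qed

lemma Holder_sum_le:
  fixes a b :: "'i \<Rightarrow> real"
  assumes p: "p > 1" and s: "s > 1" and ps: "1/p + 1/s = 1"
    and a: "\<And>i. i \<in> I \<Longrightarrow> a i \<ge> 0" and b: "\<And>i. i \<in> I \<Longrightarrow> b i \<ge> 0"
    and A: "(\<Sum>i\<in>I. a i powr p) \<le> A" and B: "(\<Sum>i\<in>I. b i powr s) \<le> B"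
  shows "(\<Sum>i\<in>I. a i * b i) \<le> A powr (1/p) * B powr (1/s)"
proof -
  have "(\<Sum>i\<in>I. a i * b i) \<le> (\<Sum>i\<in>I. a i powr p) powr (1/p) * (\<Sum>i\<in>I. b i powr s) powr (1/s)"
    by (rule Holder_sum[OF p s ps]) (use a b in auto)
  also have "\<dots> \<le> A powr (1/p) * B powr (1/s)"
    using p s by (intro mult_mono powr_mono2 A B sum_nonneg) auto
  finally show ?thesis .
qed

text \<open>
  The expectation of a function of \<open>n\<close> independent variables that are uniformly distributed on
  \<open>V\<close>. The recursion on the last variable replaces a product probability space. The function is
  meant to depend only on the first \<open>n\<close> values of its argument.
\<close>

primrec average :: "'a set \<Rightarrow> nat \<Rightarrow> ((nat \<Rightarrow> 'a) \<Rightarrow> real) \<Rightarrow> real" where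
  "average V 0 F = F (\<lambda>_. undefined)"
| "average V (Suc n) F = (\<Sum>v\<in>V. average V n (\<lambda>b. F (b(n := v)))) / real (card V)"

lemma average_mono:
  "(\<And>b. (\<And>i. i < n \<Longrightarrow> b i \<in> V) \<Longrightarrow> F b \<le> G b) \<Longrightarrow> average V n F \<le> average V n G"
proof (induction n arbitrary: F G)
  case (Suc n)
  have "average V n (\<lambda>b. F (b(n := v))) \<le> average V n (\<lambda>b. G (b(n := v)))" if "v \<in> V" for v
    using that by (intro Suc.IH Suc.prems) (auto simp: less_Suc_eq)
  then show ?case by (auto intro!: divide_right_mono sum_mono)
qed auto

lemma average_cong:
  "(\<And>b. (\<And>i. i < n \<Longrightarrow> b i \<in> V) \<Longrightarrow> F b = G b) \<Longrightarrow> average V n F = average V n G"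
  by (intro antisym average_mono) auto

lemma average_const [simp]: "finite V \<Longrightarrow> V \<noteq> {} \<Longrightarrow> average V n (\<lambda>b. c) = c"
  by (induction n) auto

lemma average_cmult: "average V n (\<lambda>b. c * F b) = c * average V n F"
  by (induction n arbitrary: F) (auto simp: sum_distrib_left)

lemma average_add: "average V n (\<lambda>b. F b + G b) = average V n F + average V n G"
  by (induction n arbitrary: F G) (auto simp: sum.distrib add_divide_distrib)

lemma average_sum: "average V n (\<lambda>b. \<Sum>j<(N::nat). F j b) = (\<Sum>j<N. average V n (F j))"
proof (induction N)
  case 0
  have "average V n (\<lambda>b. 0 * 0) = 0" by (subst average_cmult) simp
  then show ?case by simp
qed (simp add: average_add)

lemma average_nonneg: "(\<And>b. 0 \<le> F b) \<Longrightarrow> 0 \<le> average V n F"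
  by (induction n arbitrary: F) (auto intro!: divide_nonneg_nonneg sum_nonneg)

lemma average_prod: "average V n (\<lambda>b. \<Prod>i<n. h i (b i)) = (\<Prod>i<n. (\<Sum>v\<in>V. h i v) / real (card V))"
proof (induction n)
  case (Suc n)
  have "average V n (\<lambda>b. \<Prod>i<Suc n. h i ((b(n := v)) i)) = h n v * average V n (\<lambda>b. \<Prod>i<n. h i (b i))" for v
    by (subst average_cmult[symmetric], rule average_cong) (simp add: mult.commute)
  then show ?case by (simp add: Suc.IH sum_distrib_right[symmetric] mult.commute)
qed simp

lemma average_mean:
  assumes "finite V" "V \<noteq> {}"
  shows "average V n (\<lambda>b. \<Sum>i<n. h (b i)) = real n * ((\<Sum>v\<in>V. h v) / real (card V))"
proof (induction n)
  case (Suc n)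
  have "average V n (\<lambda>b. \<Sum>i<Suc n. h ((b(n := v)) i)) = average V n (\<lambda>b. \<Sum>i<n. h (b i)) + h v" for v
  proof -
    have "average V n (\<lambda>b. \<Sum>i<Suc n. h ((b(n := v)) i)) = average V n (\<lambda>b. (\<Sum>i<n. h (b i)) + h v)"
      by (rule average_cong) simp
    then show ?thesis using assms by (simp add: average_add)
  qed
  then show ?case using assms
    by (simp add: Suc.IH sum.distrib add_divide_distrib distrib_right)
qed simp

abbreviation signs :: "complex set" where "signs \<equiv> {1, -1}"

lemma average_signs_Suc:
  "average signs (Suc n) (\<lambda>e. h (\<Sum>i<Suc n. e i * a i)) =
     average signs n (\<lambda>e. (h ((\<Sum>i<n. e i * a i) + a n) + h ((\<Sum>i<n. e i * a i) - a n)) / 2)"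
proof -
  have "average signs n (\<lambda>e. h (\<Sum>i<Suc n. (e(n := v)) i * a i)) = average signs n (\<lambda>e. h ((\<Sum>i<n. e i * a i) + v * a n))" for v
    by (rule average_cong) simp
  moreover have "(\<lambda>e. (h ((\<Sum>i<n. e i * a i) + a n) + h ((\<Sum>i<n. e i * a i) - a n)) / 2) =
     (\<lambda>e. (1/2) * (h ((\<Sum>i<n. e i * a i) + a n)) + (1/2) * h ((\<Sum>i<n. e i * a i) - a n))"
    by (simp add: add_divide_distrib)
  ultimately show ?thesis
    by (simp only: average.simps average_add average_cmult) simp
qed

lemma cmod_sq_add_diff: "(cmod (X + a))\<^sup>2 + (cmod (X - a))\<^sup>2 = 2 * (cmod X)\<^sup>2 + 2 * (cmod a)\<^sup>2"
  by (simp add: cmod_power2) (simp add: power2_eq_square algebra_simps)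

lemma cmod_fourth_add_diff:
  "cmod (X + a) ^ 4 + cmod (X - a) ^ 4 \<le> 2 * cmod X ^ 4 + 12 * ((cmod X)\<^sup>2 * (cmod a)\<^sup>2) + 2 * cmod a ^ 4"
proof -
  define s t d where "s = (cmod X)\<^sup>2" and "t = (cmod a)\<^sup>2" and "d = 2 * (Re X * Re a + Im X * Im a)"
  have 1: "(cmod (X + a))\<^sup>2 = s + t + d" "(cmod (X - a))\<^sup>2 = s + t - d"
    by (simp_all add: s_def t_def d_def cmod_power2) (simp_all add: power2_eq_square algebra_simps)
  have "d\<^sup>2 + 4 * (Re X * Im a - Im X * Re a)\<^sup>2 = 4 * (s * t)"
    by (simp add: d_def s_def t_def cmod_power2) (simp add: power2_eq_square algebra_simps)
  then have d: "d\<^sup>2 \<le> 4 * (s * t)" by (smt (verit) zero_le_power2)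
  have 4: "z ^ 4 = (z\<^sup>2)\<^sup>2" for z :: real by simp
  have "(s + t + d)\<^sup>2 + (s + t - d)\<^sup>2 = 2 * s\<^sup>2 + 4 * (s * t) + 2 * t\<^sup>2 + 2 * d\<^sup>2"
    by (simp add: power2_eq_square algebra_simps)
  then show ?thesis unfolding 4 1 using d by (simp add: s_def t_def)
qed

lemma average_signs_square: "average signs n (\<lambda>e. (cmod (\<Sum>i<n. e i * a i))\<^sup>2) = (\<Sum>i<n. (cmod (a i))\<^sup>2)"
proof (induction n)
  case (Suc n)
  show ?case
    unfolding average_signs_Suc[where h = "\<lambda>z. (cmod z)\<^sup>2"] cmod_sq_add_diff
    using Suc by (simp add: add_divide_distrib average_add)
qed simp

lemma average_signs_fourth: "average signs n (\<lambda>e. cmod (\<Sum>i<n. e i * a i) ^ 4) \<le> 3 * (\<Sum>i<n. (cmod (a i))\<^sup>2)\<^sup>2"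
proof (induction n)
  case (Suc n)
  let ?X = "\<lambda>e. \<Sum>i<n. e i * a i" and ?S = "\<Sum>i<n. (cmod (a i))\<^sup>2" and ?t = "(cmod (a n))\<^sup>2"
  have "average signs (Suc n) (\<lambda>e. cmod (\<Sum>i<Suc n. e i * a i) ^ 4)
      = average signs n (\<lambda>e. (cmod (?X e + a n) ^ 4 + cmod (?X e - a n) ^ 4) / 2)"
    by (rule average_signs_Suc[where h = "\<lambda>z. cmod z ^ 4"])
  also have "\<dots> \<le> average signs n (\<lambda>e. cmod (?X e) ^ 4 + (6 * ?t * (cmod (?X e))\<^sup>2 + ?t\<^sup>2))"
    by (intro average_mono) (use cmod_fourth_add_diff in \<open>force simp: algebra_simps\<close>)
  also have "\<dots> = average signs n (\<lambda>e. cmod (?X e) ^ 4) + 6 * ?t * ?S + ?t\<^sup>2"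
    by (simp add: average_add average_cmult average_signs_square)
  also have "\<dots> \<le> 3 * ?S\<^sup>2 + 6 * ?t * ?S + ?t\<^sup>2" using Suc by simp
  also have "\<dots> \<le> 3 * (?S + ?t)\<^sup>2"
    by (simp add: power2_eq_square algebra_simps)
  finally show ?case by simp
qed simp

text \<open>
  A minorant of \<open>t powr s\<close> by a polynomial in the even powers 2 and 4, whose averages over signs
  are under control. Only the range where the quartic is positive matters, and there
  \<open>t\<^sup>2 \<ge> 1/2\<close>. The minorant works for all \<open>s\<close>, so that no distinction between
  exponents below and above 2 is needed.
\<close>

lemma powr_lower_quartic:
  fixes t s :: real
  assumes "t \<ge> 0" "s > 0"
  shows "2 powr (-s/2) / 3 * (t\<^sup>2 - t^4 / 12 - 1/2) \<le> t powr s"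
proof -
  consider "t\<^sup>2 - t^4 / 12 - 1/2 \<le> 0" | "t\<^sup>2 \<ge> 1/2"
    by (smt (verit) zero_le_even_power even_numeral divide_nonneg_nonneg)
  then show ?thesis
  proof cases
    case 1
    then have "2 powr (-s/2) / 3 * (t\<^sup>2 - t^4 / 12 - 1/2) \<le> 0"
      by (intro mult_nonneg_nonpos) auto
    then show ?thesis using powr_ge_zero[of t s] by linarith
  next
    case 2
    have "t > 0" using 2 assms by (cases "t = 0") auto
    have "2 powr (-s/2) = (1/2) powr (s/2)" by (simp add: powr_minus_divide powr_divide)
    also have "\<dots> \<le> (t\<^sup>2) powr (s/2)" using 2 assms by (intro powr_mono2) auto
    also have "\<dots> = t powr s" using \<open>t > 0\<close> by (simp add: powr_powr flip: powr_numeral)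
    finally have A: "2 powr (-s/2) \<le> t powr s" .
    have "(t\<^sup>2 - 6)\<^sup>2 \<ge> 0" by simp
    then have "t\<^sup>2 - t^4 / 12 - 1/2 \<le> 3" by (simp add: power2_eq_square power4_eq_xxxx algebra_simps)
    then have "2 powr (-s/2) / 3 * (t\<^sup>2 - t^4 / 12 - 1/2) \<le> 2 powr (-s/2) / 3 * 3"
      by (intro mult_left_mono) auto
    also have "\<dots> = 2 powr (-s/2)" by simp
    finally show ?thesis using A by linarith
  qed
qed

definition khintchine_const :: "real \<Rightarrow> real" where "khintchine_const s = 2 powr (-s/2) / 12"

lemma khintchine_const_pos: "khintchine_const s > 0" by (simp add: khintchine_const_def)

text \<open>
  The lower bound in Khintchine's inequality. For a sum \<open>X\<close> with square function \<open>\<sigma>\<close>, the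
  second moment is \<open>\<sigma>\<^sup>2\<close> and the fourth moment is at most \<open>3 \<sigma>\<^sup>4\<close>. Averaging the
  quartic minorant at \<open>\<bar>X\<bar> / \<sigma>\<close> leaves at least \<open>1 - 3/12 - 1/2 = 1/4\<close>.
\<close>

lemma khintchine:
  assumes s: "s > 0"
  shows "khintchine_const s * (\<Sum>i<n. (cmod (a i))\<^sup>2) powr (s/2) \<le> average signs n (\<lambda>e. cmod (\<Sum>i<n. e i * a i) powr s)"
proof (cases "(\<Sum>i<n. (cmod (a i))\<^sup>2) = 0")
  case True
  have "0 \<le> average signs n (\<lambda>e. cmod (\<Sum>i<n. e i * a i) powr s)" by (intro average_nonneg) auto
  then show ?thesis unfolding True by simp
next
  case False
  define S where "S = (\<Sum>i<n. (cmod (a i))\<^sup>2)"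
  have S: "S > 0" using False unfolding S_def by (simp add: order_less_le sum_nonneg)
  define \<sigma> where "\<sigma> = sqrt S"
  have \<sigma>: "\<sigma> > 0" "\<sigma>\<^sup>2 = S" using S by (auto simp: \<sigma>_def)
  let ?X = "\<lambda>e. cmod (\<Sum>i<n. e i * a i)"
  define c where "c = 2 powr (-s/2) / 3"
  have "S powr (s/2) = \<sigma> powr s" using \<sigma> by (simp add: powr_powr flip: \<sigma>(2) powr_numeral)
  have fourth: "average signs n (\<lambda>e. ?X e ^ 4) / S\<^sup>2 \<le> 3"
    using average_signs_fourth[of n a] S by (simp add: S_def divide_le_eq)
  have "khintchine_const s * S powr (s/2) = \<sigma> powr s * (c * (1/4))"
    by (simp add: khintchine_const_def c_def \<open>S powr (s/2) = \<sigma> powr s\<close>)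
  also have "\<dots> \<le> \<sigma> powr s * (c * (1 - (average signs n (\<lambda>e. ?X e ^ 4) / S\<^sup>2) / 12 - 1/2))"
    using fourth by (intro mult_left_mono) (auto simp: c_def)
  also have "\<dots> = average signs n (\<lambda>e. (\<sigma> powr s * c / S) * (?X e)\<^sup>2 + ((- (\<sigma> powr s * c / (12 * S\<^sup>2))) * ?X e ^ 4 + (- (\<sigma> powr s * c / 2))))"
    unfolding average_add average_cmult average_signs_square S_def[symmetric] using S by (simp add: field_simps)
  also have "\<dots> = average signs n (\<lambda>e. \<sigma> powr s * (c * ((?X e / \<sigma>)\<^sup>2 - (?X e / \<sigma>)^4 / 12 - 1/2)))"
  proof -
    have 4: "\<sigma>^4 = S\<^sup>2" using \<sigma> by (metis power2_eq_square power4_eq_xxxx mult.assoc)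
    show ?thesis by (intro average_cong) (simp add: 4 \<sigma> power_divide right_diff_distrib)
  qed
  also have "\<dots> \<le> average signs n (\<lambda>e. \<sigma> powr s * (?X e / \<sigma>) powr s)"
    unfolding c_def using \<sigma> s by (intro average_mono mult_left_mono powr_lower_quartic) auto
  also have "\<dots> = average signs n (\<lambda>e. ?X e powr s)"
    using \<sigma> by (intro average_cong) (simp add: powr_divide)
  finally show ?thesis by (simp add: S_def)
qed

section \<open>Contractive matrices and heavy-tailed multipliers\<close>

text \<open>
  The rows of \<open>x\<close> are the images of the coordinate vectors under a linear map from the
  \<open>n\<close>-dimensional \<open>\<ell>\<^sub>q\<close> space to the \<open>N\<close>-dimensional \<open>\<ell>\<^sub>p\<close> space, and the
  condition says that this map is a contraction. Roots are avoided by raising norms to the power \<open>p\<close>.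
\<close>

definition contractive :: "real \<Rightarrow> real \<Rightarrow> nat \<Rightarrow> nat \<Rightarrow> (nat \<Rightarrow> nat \<Rightarrow> complex) \<Rightarrow> bool" where
  "contractive p q n N x \<longleftrightarrow>
     (\<forall>b. (\<Sum>j<N. cmod (\<Sum>i<n. b i * x i j) powr p) \<le> (\<Sum>i<n. cmod (b i) powr q) powr (p/q))"

lemma contractive_column:
  assumes "contractive p q n N x" "i < n"
  shows "(\<Sum>j<N. cmod (x i j) powr p) \<le> 1"
proof -
  have *: "(\<Sum>k<n. (if k = i then 1 else 0) * x k j) = x i j" for j
    using assms(2) by (simp add: if_distrib[where f = "\<lambda>c. c * _"] cong: if_cong)
  have "(\<Sum>k<n. cmod (if k = i then 1 else 0) powr q) = (\<Sum>k<n. if k = i then 1 else 0)"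
    by (intro sum.cong) auto
  also have "\<dots> = 1" using assms(2) by simp
  finally show ?thesis
    using assms(1)[unfolded contractive_def, rule_format, of "\<lambda>k. if k = i then 1 else 0"]
    unfolding * by simp
qed

lemma contractive_entries:
  assumes "contractive p q n N x"
  shows "(\<Sum>j<N. \<Sum>i<n. cmod (x i j) powr p) \<le> real n"
proof -
  have "(\<Sum>j<N. \<Sum>i<n. cmod (x i j) powr p) = (\<Sum>i<n. \<Sum>j<N. cmod (x i j) powr p)"
    by (rule sum.swap)
  also have "\<dots> \<le> (\<Sum>i<n. 1)" by (intro sum_mono contractive_column[OF assms]) auto
  finally show ?thesis by simp
qed

text \<open>
  Khintchine's inequality in every coordinate \<open>j\<close>, summed over \<open>j\<close>: the square function is
  dominated by the average norm of the images of sign vectors, which have norm \<open>n powr (1/q)\<close>.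
\<close>

lemma contractive_square:
  assumes x: "contractive p q n N x" and p: "p > 0"
  shows "(\<Sum>j<N. (\<Sum>i<n. (cmod (x i j))\<^sup>2) powr (p/2)) \<le> real n powr (p/q) / khintchine_const p"
proof -
  have "khintchine_const p * (\<Sum>j<N. (\<Sum>i<n. (cmod (x i j))\<^sup>2) powr (p/2))
     \<le> (\<Sum>j<N. average signs n (\<lambda>e. cmod (\<Sum>i<n. e i * x i j) powr p))"
    unfolding sum_distrib_left by (intro sum_mono khintchine p)
  also have "\<dots> = average signs n (\<lambda>e. \<Sum>j<N. cmod (\<Sum>i<n. e i * x i j) powr p)"
    by (rule average_sum[symmetric])
  also have "\<dots> \<le> average signs n (\<lambda>e. real n powr (p/q))"
  proof (rule average_mono)
    fix e :: "nat \<Rightarrow> complex" assume e: "\<And>i. i < n \<Longrightarrow> e i \<in> signs"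
    have "(\<Sum>i<n. cmod (e i) powr q) = (\<Sum>i<n. 1)"
      using e by (intro sum.cong) force+
    then show "(\<Sum>j<N. cmod (\<Sum>i<n. e i * x i j) powr p) \<le> real n powr (p/q)"
      using x[unfolded contractive_def, rule_format, of e] by simp
  qed
  also have "\<dots> = real n powr (p/q)" by simp
  finally show ?thesis using khintchine_const_pos[of p] by (simp add: field_simps)
qed

text \<open>
  The multipliers \<open>n/k\<close> have a bounded mean after raising to a power \<open>a < 1\<close>; this is the
  comparison of the sum of \<open>k powr -a\<close> with an integral, done by induction.
\<close>

lemma sum_powr_neg_le:
  fixes a :: real
  assumes "0 < a" "a < 1"
  shows "(\<Sum>k=1..n. (real n / real k) powr a) \<le> real n / (1 - a)"
proof -
  have step: "(1 - a) * real (Suc n) powr (-a) \<le> real (Suc n) powr (1 - a) - real n powr (1 - a)" for n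
  proof (cases "n = 0")
    case False
    define t where "t = real n / real (Suc n)"
    have t: "0 < t" "t < 1" "real n = t * real (Suc n)" using False by (auto simp: t_def)
    have "t powr (1 - a) * 1 powr a \<le> (1 - a) * t + a * 1"
      using assms t by (intro Youngs_inequality_0) auto
    moreover have "(1 - a) * (1 - t) * real (Suc n) = 1 - a"
      by (simp add: t_def field_simps)
    moreover have "real (Suc n) powr (1 - a) = real (Suc n) * real (Suc n) powr (-a)"
      by (simp add: powr_diff powr_minus field_simps)
    moreover have "real n powr (1 - a) = t powr (1 - a) * real (Suc n) powr (1 - a)"
      by (subst t(3)) (rule powr_mult)
    ultimately have e: "t powr (1 - a) \<le> (1 - a) * t + a" "(1 - a) * (1 - t) * real (Suc n) = 1 - a"
      "real (Suc n) powr (1 - a) = real (Suc n) * real (Suc n) powr (-a)"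
      "real n powr (1 - a) = t powr (1 - a) * real (Suc n) powr (1 - a)" by auto
    define w where "w = real (Suc n) powr (-a)"
    have "(1 - a) * w = ((1 - a) * (1 - t)) * (real (Suc n) * w)" by (subst e(2)[symmetric]) (simp only: mult.assoc)
    also have "\<dots> \<le> (1 - t powr (1 - a)) * (real (Suc n) * w)"
      using e(1) by (intro mult_right_mono) (auto simp: w_def algebra_simps)
    finally show ?thesis unfolding e(4) e(3) w_def[symmetric] by (simp add: left_diff_distrib mult.assoc)
  qed (use assms in auto)
  have "(1 - a) * (\<Sum>k=1..n. real k powr (-a)) \<le> real n powr (1 - a)"
  proof (induction n)
    case (Suc n)
    have "(1 - a) * (\<Sum>k=1..Suc n. real k powr (-a)) = (1 - a) * (\<Sum>k=1..n. real k powr (-a)) + (1 - a) * real (Suc n) powr (-a)"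
      by (simp add: algebra_simps)
    then show ?case using step[of n] Suc by simp
  qed simp
  then have "real n powr a * ((1 - a) * (\<Sum>k=1..n. real k powr (-a))) \<le> real n powr a * real n powr (1 - a)"
    by (intro mult_left_mono) auto
  also have "\<dots> = real n" by (simp flip: powr_add)
  finally have "(1 - a) * (real n powr a * (\<Sum>k=1..n. real k powr (-a))) \<le> real n" by (simp add: algebra_simps)
  moreover have "(\<Sum>k=1..n. (real n / real k) powr a) = real n powr a * (\<Sum>k=1..n. real k powr (-a))"
    unfolding sum_distrib_left
  proof (intro sum.cong refl)
    fix k
    have "(real n / real k) powr a = real n powr a / real k powr a" by (rule powr_divide)
    also have "\<dots> = real n powr a * real k powr (-a)" by (rule divide_powr_uminus)
    finally show "(real n / real k) powr a = real n powr a * real k powr (-a)" .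
  qed
  ultimately show ?thesis using assms by (simp add: field_simps)
qed

text \<open>
  If \<open>k\<close> is uniform on \<open>{1..n}\<close>, then \<open>(n/k) powr (1/u)\<close> exceeds \<open>s \<ge> 1\<close> with
  probability about \<open>s powr -u\<close>. With independent multipliers of this kind, the largest of the
  products with the numbers \<open>f i\<close> is therefore comparable to the \<open>\<ell>\<^sub>u\<close> norm of \<open>f\<close>
  with a probability that is bounded below: the events that the \<open>i\<close>-th product is large are
  independent and their probabilities add up to at least 1/2.
\<close>

lemma average_heavy_max:
  fixes f :: "nat \<Rightarrow> real" and G :: "(nat \<Rightarrow> nat) \<Rightarrow> real"
  assumes u: "u > 0" and p: "p > 0" and f: "\<And>i. i < n \<Longrightarrow> f i \<ge> 0"
    and G: "\<And>k i. (\<And>i. i < n \<Longrightarrow> k i \<in> {1..n}) \<Longrightarrow> i < n \<Longrightarrow> ((real n / real (k i)) powr (1/u) * f i) powr p \<le> G k"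
    and G0: "\<And>k. G k \<ge> 0"
  shows "(\<Sum>i<n. f i powr u) powr (p/u) \<le> 3 * 2 powr (p/u) * average {1..n} n G"
proof (cases "(\<Sum>i<n. f i powr u) = 0")
  case True
  then show ?thesis using average_nonneg[of G "{1..n}" n] G0 by simp
next
  case False
  define S where "S = (\<Sum>i<n. f i powr u)"
  have S: "S > 0" using False unfolding S_def by (simp add: order_less_le sum_nonneg)
  have n: "n > 0" using S by (cases n) (auto simp: S_def)
  define y where "y i = 2 * f i powr u / S" for i
  have y0: "0 \<le> y i" for i using S by (simp add: y_def)
  have y2: "y i \<le> 2" if "i < n" for i
  proof -
    have "f i powr u \<le> S" unfolding S_def using that
      by (intro member_le_sum[of i "{..<n}" "\<lambda>i. f i powr u"]) simp_all
    then show ?thesis using S by (simp add: y_def divide_le_eq)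
  qed
  note y = y0 y2
  have sum_y: "(\<Sum>i<n. y i) = 2" using S by (simp add: y_def S_def flip: sum_divide_distrib sum_distrib_left)
  \<comment> \<open>\<open>h i k\<close> indicates that the multiplier \<open>n/k\<close> leaves the \<open>u\<close>-th power of the \<open>i\<close>-th product below half of the sum\<close>
  define h where "h i k = (if real n * y i < real k then 1 else 0 :: real)" for i k :: nat
  have h: "(\<Sum>k\<in>{1..n}. h i k) / real n \<le> 1 - (y i - 1 / real n) / 2" if "i < n" for i
  proof -
    define m where "m = min n (nat \<lfloor>real n * y i\<rfloor>)"
    have "(\<Sum>k\<in>{1..n}. h i k) = (\<Sum>k\<in>{m<..n}. 1)"
      unfolding h_def
    proof (intro sum.mono_neutral_cong_right ballI)
      fix k :: nat assume "k \<in> {1..n} - {m<..n}"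
      then show "(if real n * y i < real k then 1 else 0 :: real) = 0"
      proof -
        have "k \<le> nat \<lfloor>real n * y i\<rfloor>" using \<open>k \<in> {1..n} - {m<..n}\<close> unfolding m_def by auto
        then have "real k \<le> real (nat \<lfloor>real n * y i\<rfloor>)" by simp
        also have "\<dots> \<le> real n * y i" using y(1)[of i] by (intro of_nat_floor) auto
        finally show ?thesis by simp
      qed
    next
      fix k :: nat assume "k \<in> {m<..n}"
      then have "\<not> k \<le> nat \<lfloor>real n * y i\<rfloor>" by (auto simp: m_def)
      then have "\<not> real k \<le> real n * y i" using le_nat_floor by blast
      then show "(if real n * y i < real k then 1 else 0 :: real) = 1" by simp
    qed auto
    also have "\<dots> = real n - real m" by (simp add: m_def)
    finally have *: "(\<Sum>k\<in>{1..n}. h i k) / real n = 1 - real m / real n" using n by (simp add: field_simps)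
    have "real m \<ge> real n * ((y i - 1 / real n) / 2)"
    proof (cases "real n * y i < 1")
      case True
      then have "y i - 1 / real n \<le> 0" using n by (simp add: field_simps)
      then have "real n * ((y i - 1 / real n) / 2) \<le> 0" by (intro mult_nonneg_nonpos) auto
      then show ?thesis by simp
    next
      case False
      define w a where "w = real (nat \<lfloor>real n * y i\<rfloor>)" and "a = real n * y i"
      have w: "w \<ge> a - 1" "w \<ge> 0" unfolding w_def a_def by linarith+
      have a: "a \<le> real n * 2" unfolding a_def using y(2)[OF that] by (intro mult_left_mono) auto
      have "real m = real n \<or> real m = w" by (simp add: m_def w_def min_def)
      then have "(a - 1) / 2 \<le> real m"
      proof
        assume "real m = real n"
        then show ?thesis using a by simp
      next
        assume "real m = w"
        then show ?thesis using w by simp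
      qed
      moreover have "real n * ((y i - 1 / real n) / 2) = (a - 1) / 2" using n by (simp add: a_def field_simps)
      ultimately show ?thesis by (simp only:)
    qed
    then have "real m / real n \<ge> (y i - 1 / real n) / 2" using n by (simp add: field_simps)
    then show ?thesis unfolding * by linarith
  qed
  \<comment> \<open>by independence, the product is the probability that no term reaches the level\<close>
  have "(\<Prod>i<n. (\<Sum>k\<in>{1..n}. h i k) / real n) \<le> (\<Prod>i<n. exp (- ((y i - 1 / real n) / 2)))"
  proof (intro prod_mono conjI)
    fix i assume "i \<in> {..<n}"
    then have "(\<Sum>k\<in>{1..n}. h i k) / real n \<le> 1 + (- ((y i - 1 / real n) / 2))" using h[of i] by simp
    also have "\<dots> \<le> exp (- ((y i - 1 / real n) / 2))" by (rule exp_ge_add_one_self)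
    finally show "(\<Sum>k\<in>{1..n}. h i k) / real n \<le> exp (- ((y i - 1 / real n) / 2))" .
    show "0 \<le> (\<Sum>k\<in>{1..n}. h i k) / real n" by (auto simp: h_def intro!: divide_nonneg_nonneg sum_nonneg)
  qed
  also have "\<dots> = exp (\<Sum>i<n. - ((y i - 1 / real n) / 2))" by (simp add: exp_sum)
  also have "(\<Sum>i<n. - ((y i - 1 / real n) / 2)) = - 1/2"
    using n by (simp add: sum_negf sum_subtractf sum_y flip: sum_divide_distrib)
  also have "exp (- 1/2) \<le> (2/3 :: real)"
  proof -
    have "exp (1/2 :: real) \<ge> 1 + 1/2" by (rule exp_ge_add_one_self)
    then have "inverse (exp (1/2 :: real)) \<le> inverse (3/2)" by (intro le_imp_inverse_le) auto
    then show ?thesis by (simp add: exp_minus[symmetric])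
  qed
  finally have prod: "average {1..n} n (\<lambda>k. \<Prod>i<n. h i (k i)) \<le> 2/3"
    using average_prod[of "{1..n}" n h] by simp
  have "(S / 2) powr (p/u) / 3 \<le> (S/2) powr (p/u) * (1 - average {1..n} n (\<lambda>k. \<Prod>i<n. h i (k i)))"
    using prod mult_left_mono[of "1/3" "1 - average {1..n} n (\<lambda>k. \<Prod>i<n. h i (k i))" "(S/2) powr (p/u)"] by simp
  also have "\<dots> = average {1..n} n (\<lambda>k. (S/2) powr (p/u) * (1 + (-1) * (\<Prod>i<n. h i (k i))))"
    unfolding average_cmult average_add using n by simp
  also have "\<dots> \<le> average {1..n} n G"
  proof (rule average_mono)
    fix k :: "nat \<Rightarrow> nat" assume k: "\<And>i. i < n \<Longrightarrow> k i \<in> {1..n}"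
    show "(S/2) powr (p/u) * (1 + (-1) * (\<Prod>i<n. h i (k i))) \<le> G k"
    proof (cases "\<forall>i<n. h i (k i) = 1")
      case True
      then have "(\<Prod>i<n. h i (k i)) = 1" by simp
      then show ?thesis using G0 by simp
    next
      case False
      then obtain i where i: "i < n" "h i (k i) = 0" by (auto simp: h_def split: if_splits)
      have k1: "real (k i) > 0" using k[OF i(1)] by simp
      have "real (k i) \<le> real n * y i" using i by (auto simp: h_def split: if_splits)
      then have "S / 2 \<le> real n / real (k i) * f i powr u"
        using S k1 by (simp add: y_def field_simps)
      also have "\<dots> = ((real n / real (k i)) powr (1/u) * f i) powr u"
        using u f[OF i(1)] by (simp add: powr_mult powr_powr)
      finally have "(S/2) powr (p/u) \<le> (((real n / real (k i)) powr (1/u) * f i) powr u) powr (p/u)"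
        using S p u by (intro powr_mono2) auto
      also have "\<dots> = ((real n / real (k i)) powr (1/u) * f i) powr p" using u by (simp add: powr_powr)
      also have "\<dots> \<le> G k" by (rule G[OF k i(1)])
      finally have "(S/2) powr (p/u) \<le> G k" .
      moreover have P: "(\<Prod>i<n. h i (k i)) = 0" using i by (intro prod_zero) auto
      ultimately show ?thesis unfolding P by simp
    qed
  qed
  finally have "(S / 2) powr (p/u) \<le> 3 * average {1..n} n G" by simp
  moreover have "S powr (p/u) = 2 powr (p/u) * (S/2) powr (p/u)" using S by (simp flip: powr_mult)
  ultimately have "S powr (p/u) \<le> 2 powr (p/u) * (3 * average {1..n} n G)" by simp
  then show ?thesis by (simp add: S_def algebra_simps)
qed

text \<open>
  At a single coordinate, the entries of \<open>g\<close> are split at the level \<open>\<kappa> G\<close>. The small entries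
  have a conjugate norm that is smaller than \<open>G\<close> by a power of \<open>\<kappa>\<close>, because the exponent
  conjugate to \<open>u\<close> exceeds 2. There are at most \<open>1/\<kappa>\<^sup>2\<close> large entries, and for each of them
  the product is at most \<open>F H\<close>.
\<close>

lemma split_sum_bound:
  fixes f g :: "nat \<Rightarrow> real"
  assumes f: "\<And>i. i < n \<Longrightarrow> f i \<ge> 0" and g: "\<And>i. i < n \<Longrightarrow> g i \<ge> 0"
    and u: "1 < u" "u < 2" and s: "s > 0" and \<kappa>: "\<kappa> > 0"
  defines "F \<equiv> (\<Sum>i<n. f i powr u) powr (1/u)" and "G \<equiv> sqrt (\<Sum>i<n. (g i)\<^sup>2)"
    and "H \<equiv> (\<Sum>i<n. g i powr s) powr (1/s)"
  shows "(\<Sum>i<n. f i * g i) \<le> \<kappa> powr (2/u - 1) * (F * G) + \<kappa> powr (-2) * (F * H)"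
proof -
  have fF: "f i \<le> F" if "i < n" for i
  proof -
    have "f i = (f i powr u) powr (1/u)" using f[OF that] u by (simp add: powr_powr)
    also have "\<dots> \<le> F" unfolding F_def using that u
      by (intro powr_mono2 member_le_sum[of i "{..<n}" "\<lambda>i. f i powr u"]) auto
    finally show ?thesis .
  qed
  have gH: "g i \<le> H" if "i < n" for i
  proof -
    have "g i = (g i powr s) powr (1/s)" using g[OF that] s by (simp add: powr_powr)
    also have "\<dots> \<le> H" unfolding H_def using that s
      by (intro powr_mono2 member_le_sum[of i "{..<n}" "\<lambda>i. g i powr s"]) auto
    finally show ?thesis .
  qed
  have F0: "F \<ge> 0" and G0: "G \<ge> 0" and H0: "H \<ge> 0" by (auto simp: F_def G_def H_def sum_nonneg)
  have G2: "(\<Sum>i<n. (g i)\<^sup>2) = G\<^sup>2" by (simp add: G_def sum_nonneg)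
  show ?thesis
  proof (cases "G = 0")
    case True
    then have "(\<Sum>i<n. (g i)\<^sup>2) = 0" using G2 by simp
    then have "\<forall>i\<in>{..<n}. (g i)\<^sup>2 = 0" by (subst (asm) sum_nonneg_eq_0_iff) auto
    then have "(\<Sum>i<n. f i * g i) = 0" by (intro sum.neutral) auto
    then show ?thesis using F0 G0 H0 by simp
  next
    case False
    then have Gp: "G > 0" using G0 by simp
    define B where "B = {i. i < n \<and> \<kappa> * G < g i}"
    define v where "v = u / (u - 1)"
    have v: "v > 2" "1/u + 1/v = 1" using u by (auto simp: v_def field_simps)
    have split: "(\<Sum>i<n. f i * g i) = (\<Sum>i\<in>{..<n} - B. f i * g i) + (\<Sum>i\<in>B. f i * g i)"
      by (intro sum.subset_diff) (auto simp: B_def)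
    have "(\<Sum>i\<in>{..<n} - B. g i powr v) \<le> (\<Sum>i\<in>{..<n} - B. (\<kappa> * G) powr (v - 2) * (g i)\<^sup>2)"
    proof (rule sum_mono)
      fix i assume i: "i \<in> {..<n} - B"
      then have "g i powr v = g i powr (v - 2) * (g i)\<^sup>2"
        using g[of i] by (cases "g i = 0") (auto simp flip: powr_numeral powr_add)
      also have "\<dots> \<le> (\<kappa> * G) powr (v - 2) * (g i)\<^sup>2"
        using i g v by (intro mult_right_mono powr_mono2) (auto simp: B_def)
      finally show "g i powr v \<le> (\<kappa> * G) powr (v - 2) * (g i)\<^sup>2" .
    qed
    also have "\<dots> \<le> (\<kappa> * G) powr (v - 2) * (\<Sum>i<n. (g i)\<^sup>2)"
      unfolding sum_distrib_left[symmetric] by (intro mult_left_mono sum_mono2) auto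
    also have "\<dots> = \<kappa> powr (v - 2) * G powr v"
      using Gp \<kappa> unfolding G2 by (simp add: powr_mult powr_diff)
    finally have gv: "(\<Sum>i\<in>{..<n} - B. g i powr v) \<le> \<kappa> powr (v - 2) * G powr v" .
    have "(\<Sum>i\<in>{..<n} - B. f i * g i) \<le> (\<Sum>i<n. f i powr u) powr (1/u) * (\<kappa> powr (v - 2) * G powr v) powr (1/v)"
      using u v f g gv by (intro Holder_sum_le) (auto intro!: sum_mono2)
    also have "\<dots> = F * (\<kappa> powr ((v - 2) / v) * G)"
      using v Gp by (simp add: F_def powr_mult powr_powr)
    also have "(v - 2) / v = 2/u - 1" using u by (simp add: v_def field_simps)
    finally have 1: "(\<Sum>i\<in>{..<n} - B. f i * g i) \<le> \<kappa> powr (2/u - 1) * (F * G)" by (simp add: mult_ac)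
    have "real (card B) * (\<kappa> * G)\<^sup>2 = (\<Sum>i\<in>B. (\<kappa> * G)\<^sup>2)" by simp
    also have "\<dots> \<le> (\<Sum>i\<in>B. (g i)\<^sup>2)"
      using \<kappa> Gp by (intro sum_mono power_mono) (auto simp: B_def)
    also have "\<dots> \<le> G\<^sup>2" unfolding G2[symmetric] by (intro sum_mono2) (auto simp: B_def)
    finally have card: "real (card B) \<le> \<kappa> powr (-2)"
      using \<kappa> Gp by (simp add: powr_minus power_mult_distrib field_simps)
    have "(\<Sum>i\<in>B. f i * g i) \<le> (\<Sum>i\<in>B. F * H)"
      using fF gH f g F0 by (intro sum_mono mult_mono) (auto simp: B_def)
    also have "\<dots> = real (card B) * (F * H)" by simp
    also have "\<dots> \<le> \<kappa> powr (-2) * (F * H)" using card F0 H0 by (intro mult_right_mono) auto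
    finally show ?thesis using split 1 by linarith
  qed
qed

text \<open>
  The improvement over the square function for \<open>p < q < 2\<close>: the \<open>\<ell>\<^sub>u\<close> function, which is
  larger than the square function for \<open>u < 2\<close>, has the same order of magnitude. The vectors to
  which the contraction is applied are random signs times the multipliers of \<open>average_heavy_max\<close>.
  Since \<open>q < u\<close>, their \<open>\<ell>\<^sub>q\<close> norms are on average of order \<open>n powr (1/q)\<close>.
\<close>

lemma contractive_heavy:
  assumes x: "contractive p q n N x" and p: "0 < p" "p < q" and u: "q < u"
  shows "(\<Sum>j<N. (\<Sum>i<n. cmod (x i j) powr u) powr (p/u))
     \<le> 6 * 2 powr (p/u) / (khintchine_const p * (1 - q/u) powr (p/q)) * real n powr (p/q)"
proof (cases "n = 0")
  case False
  have q: "q > 0" using p by simp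
  define \<theta> where "\<theta> k = (real n / real k) powr (1/u)" for k :: nat
  have \<theta>0: "\<theta> k \<ge> 0" for k by (simp add: \<theta>_def)
  define G where "G j k = average signs n (\<lambda>e. cmod (\<Sum>i<n. e i * (of_real (\<theta> (k i)) * x i j)) powr p) / khintchine_const p" for j k
  have G0: "G j k \<ge> 0" for j k using khintchine_const_pos[of p] by (auto simp: G_def intro!: divide_nonneg_nonneg average_nonneg)
  have G: "(\<theta> (k i) * cmod (x i j)) powr p \<le> G j k" if "i < n" for i j and k :: "nat \<Rightarrow> nat"
  proof -
    have "(\<theta> (k i) * cmod (x i j)) powr p = ((cmod (of_real (\<theta> (k i)) * x i j))\<^sup>2) powr (p/2)"
      using \<theta>0 by (simp add: norm_mult powr_powr flip: powr_numeral)
    also have "\<dots> \<le> (\<Sum>i<n. (cmod (of_real (\<theta> (k i)) * x i j))\<^sup>2) powr (p/2)"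
      using that p by (intro powr_mono2 member_le_sum[of i "{..<n}" "\<lambda>i. (cmod (of_real (\<theta> (k i)) * x i j))\<^sup>2"]) auto
    also have "\<dots> \<le> G j k"
      using khintchine[OF p(1), of "\<lambda>i. of_real (\<theta> (k i)) * x i j" n] khintchine_const_pos[of p]
      by (simp add: G_def field_simps)
    finally show ?thesis .
  qed
  define M where "M = real n / (1 - q/u)"
  have M: "M > 0" using False u q by (auto simp: M_def)
  have "(\<Sum>j<N. (\<Sum>i<n. cmod (x i j) powr u) powr (p/u)) \<le> (\<Sum>j<N. 3 * 2 powr (p/u) * average {1..n} n (G j))"
    using G G0 p u by (intro sum_mono average_heavy_max) (auto simp: \<theta>_def)
  also have "\<dots> = 3 * 2 powr (p/u) * average {1..n} n (\<lambda>k. \<Sum>j<N. G j k)"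
    by (simp add: average_sum sum_distrib_left)
  also have "average {1..n} n (\<lambda>k. \<Sum>j<N. G j k) \<le> average {1..n} n (\<lambda>k. (M powr (p/q) / khintchine_const p) * (1 + 1/M * (\<Sum>i<n. \<theta> (k i) powr q)))"
  proof (rule average_mono)
    fix k :: "nat \<Rightarrow> nat"
    let ?T = "\<Sum>i<n. \<theta> (k i) powr q"
    have T0: "?T \<ge> 0" by (intro sum_nonneg) auto
    have "(\<Sum>j<N. G j k) = average signs n (\<lambda>e. \<Sum>j<N. cmod (\<Sum>i<n. e i * (of_real (\<theta> (k i)) * x i j)) powr p) / khintchine_const p"
      by (simp add: G_def average_sum sum_divide_distrib)
    also have "\<dots> \<le> average signs n (\<lambda>e. ?T powr (p/q)) / khintchine_const p"
    proof (intro divide_right_mono average_mono)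
      fix e :: "nat \<Rightarrow> complex" assume e: "\<And>i. i < n \<Longrightarrow> e i \<in> signs"
      have e1: "cmod (e i) = 1" if "i < n" for i using e[OF that] by auto
      have "(\<Sum>j<N. cmod (\<Sum>i<n. (e i * of_real (\<theta> (k i))) * x i j) powr p) \<le> (\<Sum>i<n. cmod (e i * of_real (\<theta> (k i))) powr q) powr (p/q)"
        using x[unfolded contractive_def, rule_format, of "\<lambda>i. e i * of_real (\<theta> (k i))"] .
      also have "(\<Sum>i<n. cmod (e i * of_real (\<theta> (k i))) powr q) = ?T"
        using e1 \<theta>0 by (intro sum.cong) (auto simp: norm_mult)
      finally show "(\<Sum>j<N. cmod (\<Sum>i<n. e i * (of_real (\<theta> (k i)) * x i j)) powr p) \<le> ?T powr (p/q)"
        by (simp add: mult.assoc)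
    qed (use khintchine_const_pos[of p] in auto)
    also have "\<dots> = ?T powr (p/q) / khintchine_const p" by simp
    also have "?T powr (p/q) = M powr (p/q) * (?T / M) powr (p/q)"
      using M T0 by (simp add: powr_divide)
    finally have 1: "(\<Sum>j<N. G j k) \<le> M powr (p/q) * (?T / M) powr (p/q) / khintchine_const p" .
    have "(?T / M) powr (p/q) \<le> 1 + 1/M * ?T"
    proof (cases "?T / M \<le> 1")
      case True
      then have "(?T / M) powr (p/q) \<le> 1 powr (p/q)" using M T0 p q by (intro powr_mono2) auto
      then show ?thesis using M T0 by (simp add: add_increasing2)
    next
      case False
      then have "(?T / M) powr (p/q) \<le> (?T / M) powr 1" using p q by (intro powr_mono) auto
      then show ?thesis using False by simp
    qed
    then have "M powr (p/q) * (?T / M) powr (p/q) / khintchine_const p \<le> M powr (p/q) * (1 + 1/M * ?T) / khintchine_const p"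
      using khintchine_const_pos[of p] by (intro divide_right_mono mult_left_mono) auto
    with 1 show "(\<Sum>j<N. G j k) \<le> (M powr (p/q) / khintchine_const p) * (1 + 1/M * ?T)"
      by simp
  qed
  also have "\<dots> = (M powr (p/q) / khintchine_const p) * (1 + 1/M * average {1..n} n (\<lambda>k. \<Sum>i<n. \<theta> (k i) powr q))"
    using False unfolding average_cmult average_add by simp
  also have "average {1..n} n (\<lambda>k. \<Sum>i<n. \<theta> (k i) powr q) = (\<Sum>k=1..n. \<theta> k powr q)"
    using False by (subst average_mean) auto
  also have "(\<Sum>k=1..n. \<theta> k powr q) = (\<Sum>k=1..n. (real n / real k) powr (q/u))"
    by (simp add: \<theta>_def powr_powr mult.commute)
  also have "(\<Sum>k=1..n. (real n / real k) powr (q/u)) \<le> M"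
    unfolding M_def using q u by (intro sum_powr_neg_le) auto
  also have "1/M * M = 1" using M by simp
  finally have "(\<Sum>j<N. (\<Sum>i<n. cmod (x i j) powr u) powr (p/u)) \<le> 3 * 2 powr (p/u) * (M powr (p/q) / khintchine_const p * (1 + 1))"
    using M khintchine_const_pos[of p] by (simp add: mult_left_mono divide_right_mono)
  also have "M powr (p/q) = real n powr (p/q) / (1 - q/u) powr (p/q)"
    using q u by (simp add: M_def powr_divide)
  finally show ?thesis by (simp add: mult.commute mult.left_commute)
qed simp

section \<open>The trace estimate\<close>

lemma square_sum_le_of_ge_2:
  fixes f :: "nat \<Rightarrow> real"
  assumes p: "p > 2" and f: "\<And>i. i < n \<Longrightarrow> f i \<ge> 0"
  shows "(\<Sum>i<n. (f i)\<^sup>2) powr (p/2) \<le> real n powr (p/2 - 1) * (\<Sum>i<n. f i powr p)"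
proof -
  have "1 / (p/2) + 1 / (p / (p - 2)) = 1" "p / (p - 2) > 1" using p by (simp_all add: field_simps)
  then have "(\<Sum>i<n. (f i)\<^sup>2 * 1) \<le> (\<Sum>i<n. ((f i)\<^sup>2) powr (p/2)) powr (1/(p/2)) * (\<Sum>i<n. 1 powr (p/(p-2))) powr (1/(p/(p-2)))"
    using p by (intro Holder_sum) auto
  also have "(\<Sum>i<n. ((f i)\<^sup>2) powr (p/2)) = (\<Sum>i<n. f i powr p)"
    using f by (intro sum.cong) (auto simp: powr_powr simp flip: powr_numeral)
  finally have "(\<Sum>i<n. (f i)\<^sup>2) powr (p/2) \<le> ((\<Sum>i<n. f i powr p) powr (2/p) * real n powr ((p-2)/p)) powr (p/2)"
    using p by (intro powr_mono2) (auto intro: sum_nonneg)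
  also have "\<dots> = (\<Sum>i<n. f i powr p) * real n powr (p/2 - 1)"
  proof -
    have "(p - 2) / p * (p/2) = p/2 - 1" using p by (simp add: field_simps)
    then have "(real n powr ((p - 2)/p)) powr (p/2) = real n powr (p/2 - 1)" by (simp only: powr_powr)
    moreover have "((\<Sum>i<n. f i powr p) powr (2/p)) powr (p/2) = (\<Sum>i<n. f i powr p)"
      using p by (simp add: powr_powr sum_nonneg)
    ultimately show ?thesis by (simp only: powr_mult)
  qed
  finally show ?thesis by (simp add: mult.commute)
qed

lemma square_sum_le_of_le_2:
  fixes f :: "nat \<Rightarrow> real"
  assumes p: "0 < p" "p < 2" and f: "\<And>i. i < n \<Longrightarrow> f i \<ge> 0"
  shows "(\<Sum>i<n. (f i)\<^sup>2) powr (p/2) \<le> (\<Sum>i<n. f i powr p)"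
proof -
  define S where "S = (\<Sum>i<n. f i powr p)"
  have S: "S \<ge> 0" unfolding S_def by (intro sum_nonneg) auto
  have "(f i)\<^sup>2 \<le> f i powr p * S powr ((2 - p)/p)" if "i < n" for i
  proof -
    have "f i powr p \<le> S" unfolding S_def using that
      by (intro member_le_sum[of i "{..<n}" "\<lambda>i. f i powr p"]) simp_all
    then have "(f i powr p) powr ((2 - p)/p) \<le> S powr ((2 - p)/p)" using p by (intro powr_mono2) auto
    moreover have "(f i powr p) powr ((2 - p)/p) = f i powr (2 - p)" using p by (simp add: powr_powr)
    moreover have "(f i)\<^sup>2 = f i powr p * f i powr (2 - p)"
      using f[OF that] by (cases "f i = 0") (simp_all flip: powr_add)
    ultimately show ?thesis by (simp add: mult_left_mono)
  qed
  then have "(\<Sum>i<n. (f i)\<^sup>2) \<le> (\<Sum>i<n. f i powr p * S powr ((2 - p)/p))" by (intro sum_mono) auto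
  also have "\<dots> = S * S powr ((2 - p)/p)" by (simp add: S_def sum_distrib_right)
  also have "\<dots> = S powr (2/p)"
  proof (cases "S = 0")
    case False
    have "(2 - p)/p = 2/p - 1" using p by (simp add: field_simps)
    then show ?thesis using S False by (simp add: powr_diff)
  qed simp
  finally have "(\<Sum>i<n. (f i)\<^sup>2) powr (p/2) \<le> (S powr (2/p)) powr (p/2)"
    using p by (intro powr_mono2) (auto intro: sum_nonneg)
  also have "\<dots> = S" using p S by (simp add: powr_powr)
  finally show ?thesis by (simp add: S_def)
qed

text \<open>
  Hoelder's inequality against the square function of \<open>y\<close>. With the bound \<open>A = n powr (p/q)\<close>
  that Khintchine's inequality gives for the square function of \<open>x\<close> the result would be
  \<open>O(n)\<close>, so any better bound for \<open>R\<close> is a gain.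
\<close>

lemma pairing_bound:
  fixes p q s t :: real
  assumes p: "1 < p" and q: "1 < q" and st: "s = p/(p-1)" "t = q/(q-1)"
    and y: "contractive s t n N y"
    and R0: "\<And>j. R j \<ge> 0" and R: "(\<Sum>j<N. R j powr p) \<le> A"
  shows "(\<Sum>j<N. R j * sqrt (\<Sum>i<n. (cmod (y i j))\<^sup>2)) \<le> A powr (1/p) * real n powr (1 - 1/q) * (1 / khintchine_const s) powr (1/s)"
proof -
  have s: "s > 1" "1/p + 1/s = 1" using p by (simp_all add: st field_simps)
  have "(\<Sum>j<N. R j * sqrt (\<Sum>i<n. (cmod (y i j))\<^sup>2)) \<le> A powr (1/p) * (real n powr (s/t) / khintchine_const s) powr (1/s)"
  proof (rule Holder_sum_le[OF p s R0 _ R])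
    have "(\<Sum>j<N. sqrt (\<Sum>i<n. (cmod (y i j))\<^sup>2) powr s) = (\<Sum>j<N. (\<Sum>i<n. (cmod (y i j))\<^sup>2) powr (s/2))"
      by (intro sum.cong) (auto simp: sum_nonneg powr_powr simp flip: powr_half_sqrt)
    then show "(\<Sum>j<N. sqrt (\<Sum>i<n. (cmod (y i j))\<^sup>2) powr s) \<le> real n powr (s/t) / khintchine_const s"
      using contractive_square[OF y] s by simp
  qed (auto simp: sum_nonneg)
  also have "(real n powr (s/t) / khintchine_const s) powr (1/s) = real n powr (1 - 1/q) * (1 / khintchine_const s) powr (1/s)"
  proof -
    have "1/t = 1 - 1/q" using q by (simp add: st field_simps)
    moreover have "real n powr (s/t) / khintchine_const s = real n powr (s/t) * (1 / khintchine_const s)" by simp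
    ultimately show ?thesis using s by (simp only: powr_mult powr_powr) simp
  qed
  finally show ?thesis by (simp add: mult.assoc)
qed

text \<open>
  For \<open>p > 2\<close>, the square function of \<open>n\<close> vectors of norm at most 1 has norm at most
  \<open>n powr (1/2)\<close>, which is less than \<open>n powr (1/q)\<close>.
\<close>

lemma trace_estimate_large:
  assumes q: "1 < q" "q < 2" and p: "2 < p" and st: "s = p/(p-1)" "t = q/(q-1)"
    and x: "contractive p q n N x" and y: "contractive s t n N y"
  shows "(\<Sum>j<N. \<Sum>i<n. cmod (x i j) * cmod (y i j)) \<le> (1 / khintchine_const s) powr (1/s) * real n powr (1 - (1/q - 1/2))"
proof -
  let ?R = "\<lambda>j. sqrt (\<Sum>i<n. (cmod (x i j))\<^sup>2)"
  have "(\<Sum>j<N. \<Sum>i<n. cmod (x i j) * cmod (y i j)) \<le> (\<Sum>j<N. ?R j * sqrt (\<Sum>i<n. (cmod (y i j))\<^sup>2))"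
    using L2_set_mult_ineq[of "\<lambda>i. cmod (x i _)" "\<lambda>i. cmod (y i _)" "{..<n}"]
    by (intro sum_mono) (simp add: L2_set_def)
  also have "\<dots> \<le> (real n powr (p/2)) powr (1/p) * real n powr (1 - 1/q) * (1 / khintchine_const s) powr (1/s)"
  proof (rule pairing_bound[OF _ q(1) st y])
    have "(\<Sum>j<N. ?R j powr p) = (\<Sum>j<N. (\<Sum>i<n. (cmod (x i j))\<^sup>2) powr (p/2))"
      by (intro sum.cong) (auto simp: sum_nonneg powr_powr simp flip: powr_half_sqrt)
    also have "\<dots> \<le> (\<Sum>j<N. real n powr (p/2 - 1) * (\<Sum>i<n. cmod (x i j) powr p))"
      by (intro sum_mono square_sum_le_of_ge_2 p) auto
    also have "\<dots> \<le> real n powr (p/2 - 1) * real n"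
      unfolding sum_distrib_left[symmetric] by (intro mult_left_mono contractive_entries[OF x]) auto
    also have "\<dots> = real n powr (p/2)" by (cases "n = 0") (auto simp: powr_diff)
    finally show "(\<Sum>j<N. ?R j powr p) \<le> real n powr (p/2)" .
  qed (use p in \<open>auto simp: sum_nonneg\<close>)
  also have "(real n powr (p/2)) powr (1/p) * real n powr (1 - 1/q) = real n powr (1 - (1/q - 1/2))"
    using p by (simp add: powr_powr flip: powr_add)
  finally show ?thesis by (simp add: mult.commute)
qed

text \<open>
  For \<open>p < 2\<close>, the square function of \<open>n\<close> vectors of norm at most 1 has norm at most
  \<open>n powr (1/p)\<close>, which is less than \<open>n powr (1/q)\<close> when \<open>q < p\<close>.
\<close>

lemma trace_estimate_middle:
  assumes q: "1 < q" and p: "q < p" "p < 2" and st: "s = p/(p-1)" "t = q/(q-1)"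
    and x: "contractive p q n N x" and y: "contractive s t n N y"
  shows "(\<Sum>j<N. \<Sum>i<n. cmod (x i j) * cmod (y i j)) \<le> (1 / khintchine_const s) powr (1/s) * real n powr (1 - (1/q - 1/p))"
proof -
  let ?R = "\<lambda>j. sqrt (\<Sum>i<n. (cmod (x i j))\<^sup>2)"
  have "(\<Sum>j<N. \<Sum>i<n. cmod (x i j) * cmod (y i j)) \<le> (\<Sum>j<N. ?R j * sqrt (\<Sum>i<n. (cmod (y i j))\<^sup>2))"
    using L2_set_mult_ineq[of "\<lambda>i. cmod (x i _)" "\<lambda>i. cmod (y i _)" "{..<n}"]
    by (intro sum_mono) (simp add: L2_set_def)
  also have "\<dots> \<le> real n powr (1/p) * real n powr (1 - 1/q) * (1 / khintchine_const s) powr (1/s)"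
  proof (rule pairing_bound[OF _ q(1) st y])
    have "(\<Sum>j<N. ?R j powr p) = (\<Sum>j<N. (\<Sum>i<n. (cmod (x i j))\<^sup>2) powr (p/2))"
      by (intro sum.cong) (auto simp: sum_nonneg powr_powr simp flip: powr_half_sqrt)
    also have "\<dots> \<le> (\<Sum>j<N. \<Sum>i<n. cmod (x i j) powr p)"
      using p q by (intro sum_mono square_sum_le_of_le_2) auto
    also have "\<dots> \<le> real n" by (rule contractive_entries[OF x])
    finally show "(\<Sum>j<N. ?R j powr p) \<le> real n" .
  qed (use p q in \<open>auto simp: sum_nonneg\<close>)
  also have "real n powr (1/p) * real n powr (1 - 1/q) = real n powr (1 - (1/q - 1/p))"
    by (simp add: algebra_simps flip: powr_add)
  finally show ?thesis by (simp add: mult.commute)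
qed

text \<open>
  For \<open>p < q < 2\<close> the estimates for square functions are attained, and the stronger
  \<open>\<ell>\<^sub>u\<close> function is used with the splitting of \<open>split_sum_bound\<close>. In the two terms of that
  bound, \<open>F\<close> against \<open>G\<close> contributes \<open>O(n)\<close> and \<open>F\<close> against \<open>H\<close> contributes
  \<open>O(n powr (1 - \<gamma>))\<close> with \<open>\<gamma> = 1/p - 1/q\<close>, because \<open>H\<close> is bounded
  by the norms of the single vectors. A level \<open>\<kappa>\<close> that is a small negative power of \<open>n\<close>
  improves the first term and does not spoil the second.
\<close>

lemma trace_estimate_small:
  assumes p: "1 < p" "p < q" and q: "q < 2" and st: "s = p/(p-1)" "t = q/(q-1)"
  shows "\<exists>C \<delta>. 0 < \<delta> \<and> 0 \<le> C \<and> (\<forall>n N x y. contractive p q n N x \<longrightarrow> contractive s t n N y \<longrightarrow>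
     (\<Sum>j<N. \<Sum>i<n. cmod (x i j) * cmod (y i j)) \<le> C * real n powr (1 - \<delta>))"
proof -
  define u where "u = (q + 2) / 2"
  have u: "q < u" "u < 2" using q by (auto simp: u_def)
  have s: "s > 1" "1/p + 1/s = 1" using p by (simp_all add: st field_simps)
  define c where "c = 6 * 2 powr (p/u) / (khintchine_const p * (1 - q/u) powr (p/q))"
  have c: "c > 0" using u p q khintchine_const_pos[of p] by (auto simp: c_def)
  define \<gamma> where "\<gamma> = 1/p - 1/q"
  have \<gamma>: "\<gamma> > 0" using p by (simp add: \<gamma>_def field_simps)
  define \<delta> where "\<delta> = min (\<gamma>/4 * (2/u - 1)) (\<gamma>/2)"
  have \<delta>: "\<delta> > 0" "\<delta> \<le> \<gamma>/4 * (2/u - 1)" "\<delta> \<le> \<gamma>/2" using \<gamma> u p unfolding \<delta>_def by (auto simp only: min_less_iff_conj intro!: mult_pos_pos) auto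
  define C1 where "C1 = c powr (1/p) * (1 / khintchine_const s) powr (1/s)"
  define C2 where "C2 = c powr (1/p)"
  show ?thesis
  proof (rule exI[of _ "C1 + C2"], rule exI[of _ \<delta>], intro conjI allI impI)
    show "0 < \<delta>" by (rule \<delta>)
    show "0 \<le> C1 + C2" by (simp add: C1_def C2_def)
    fix n N x y
    assume x: "contractive p q n N x" and y: "contractive s t n N y"
    show "(\<Sum>j<N. \<Sum>i<n. cmod (x i j) * cmod (y i j)) \<le> (C1 + C2) * real n powr (1 - \<delta>)"
    proof (cases "n = 0")
      case False
      then have n: "real n \<ge> 1" by simp
      \<comment> \<open>any exponent strictly between \<open>- \<gamma>/2\<close> and 0 would do\<close>
      define \<kappa> where "\<kappa> = real n powr (-\<gamma>/4)"
      have \<kappa>: "\<kappa> > 0" using n by (simp add: \<kappa>_def)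
      let ?F = "\<lambda>j. (\<Sum>i<n. cmod (x i j) powr u) powr (1/u)"
      let ?G = "\<lambda>j. sqrt (\<Sum>i<n. (cmod (y i j))\<^sup>2)"
      let ?H = "\<lambda>j. (\<Sum>i<n. cmod (y i j) powr s) powr (1/s)"
      have F: "(\<Sum>j<N. ?F j powr p) \<le> c * real n powr (p/q)"
        using contractive_heavy[OF x _ p(2) u(1)] p by (simp add: powr_powr c_def)
      have H: "(\<Sum>j<N. ?H j powr s) \<le> real n"
        using contractive_entries[OF y] s by (simp add: powr_powr sum_nonneg)
      have F1: "(c * real n powr (p/q)) powr (1/p) = c powr (1/p) * real n powr (1/q)"
        using p by (simp add: powr_mult powr_powr)
      have FG: "(\<Sum>j<N. ?F j * ?G j) \<le> C1 * real n"
      proof -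
        have "(\<Sum>j<N. ?F j * ?G j) \<le> (c * real n powr (p/q)) powr (1/p) * real n powr (1 - 1/q) * (1 / khintchine_const s) powr (1/s)"
          using p q by (intro pairing_bound[OF _ _ st y _ F]) auto
        also have "\<dots> = C1 * (real n powr (1/q) * real n powr (1 - 1/q))"
          unfolding F1 by (simp add: C1_def)
        also have "real n powr (1/q) * real n powr (1 - 1/q) = real n" using n by (simp flip: powr_add)
        finally show ?thesis .
      qed
      have FH: "(\<Sum>j<N. ?F j * ?H j) \<le> C2 * real n powr (1 - \<gamma>)"
      proof -
        have "(\<Sum>j<N. ?F j * ?H j) \<le> (c * real n powr (p/q)) powr (1/p) * real n powr (1/s)"
          using s by (intro Holder_sum_le[OF p(1) s _ _ F H]) auto
        also have "\<dots> = C2 * (real n powr (1/q) * real n powr (1/s))" unfolding F1 by (simp add: C2_def)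
        also have "real n powr (1/q) * real n powr (1/s) = real n powr (1/q + 1/s)" by (simp add: powr_add)
        also have "1/q + 1/s = 1 - \<gamma>" using s by (simp add: \<gamma>_def)
        finally show ?thesis .
      qed
      have "(\<Sum>j<N. \<Sum>i<n. cmod (x i j) * cmod (y i j))
          \<le> (\<Sum>j<N. \<kappa> powr (2/u - 1) * (?F j * ?G j) + \<kappa> powr (-2) * (?F j * ?H j))"
        using u p s \<kappa> by (intro sum_mono split_sum_bound) auto
      also have "\<dots> = \<kappa> powr (2/u - 1) * (\<Sum>j<N. ?F j * ?G j) + \<kappa> powr (-2) * (\<Sum>j<N. ?F j * ?H j)"
        by (simp add: sum.distrib sum_distrib_left)
      also have "\<dots> \<le> \<kappa> powr (2/u - 1) * (C1 * real n) + \<kappa> powr (-2) * (C2 * real n powr (1 - \<gamma>))"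
        by (intro add_mono mult_left_mono FG FH) auto
      also have "\<dots> = C1 * real n powr (1 - \<gamma>/4 * (2/u - 1)) + C2 * real n powr (1 - \<gamma>/2)"
      proof -
        have "\<kappa> powr (2/u - 1) * real n = real n powr (-\<gamma>/4 * (2/u - 1)) * real n powr 1"
          using n by (simp add: \<kappa>_def powr_powr)
        also have "\<dots> = real n powr (1 - \<gamma>/4 * (2/u - 1))"
          by (simp only: powr_add[symmetric]) (simp add: algebra_simps)
        finally have 1: "\<kappa> powr (2/u - 1) * real n = real n powr (1 - \<gamma>/4 * (2/u - 1))" .
        have "\<kappa> powr (-2) * real n powr (1 - \<gamma>) = real n powr (\<gamma>/2) * real n powr (1 - \<gamma>)"
          by (simp add: \<kappa>_def powr_powr)
        also have "\<dots> = real n powr (1 - \<gamma>/2)" by (simp only: powr_add[symmetric]) (simp add: algebra_simps)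
        finally have 2: "\<kappa> powr (-2) * real n powr (1 - \<gamma>) = real n powr (1 - \<gamma>/2)" .
        show ?thesis unfolding 1[symmetric] 2[symmetric] by (simp only: mult_ac)
      qed
      also have "\<dots> \<le> C1 * real n powr (1 - \<delta>) + C2 * real n powr (1 - \<delta>)"
        using n \<delta> by (intro add_mono mult_left_mono powr_mono) (auto simp: C1_def C2_def)
      finally show ?thesis by (simp add: distrib_right)
    qed simp
  qed
qed

lemma trace_estimate_below_2:
  assumes "1 < p" "1 < q" "q < 2" "p \<noteq> 2" "p \<noteq> q" and st: "s = p/(p-1)" "t = q/(q-1)"
  shows "\<exists>C \<delta>. 0 < \<delta> \<and> 0 \<le> C \<and> (\<forall>n N x y. contractive p q n N x \<longrightarrow> contractive s t n N y \<longrightarrow>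
     (\<Sum>j<N. \<Sum>i<n. cmod (x i j) * cmod (y i j)) \<le> C * real n powr (1 - \<delta>))"
proof -
  consider "2 < p" | "q < p" "p < 2" | "p < q" using assms by linarith
  then show ?thesis
  proof cases
    case 1
    have "1/q - 1/2 > 0" using assms by (simp add: field_simps)
    show ?thesis
      by (rule exI[of _ "(1 / khintchine_const s) powr (1/s)"], rule exI[of _ "1/q - 1/2"])
         (use \<open>1/q - 1/2 > 0\<close> trace_estimate_large[OF assms(2,3) 1 st] in auto)
  next
    case 2
    have "1/q - 1/p > 0" using assms 2 by (simp add: field_simps)
    show ?thesis
      by (rule exI[of _ "(1 / khintchine_const s) powr (1/s)"], rule exI[of _ "1/q - 1/p"])
         (use \<open>1/q - 1/p > 0\<close> trace_estimate_middle[OF assms(2) 2 st] in auto)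
  next
    case 3
    then show ?thesis using trace_estimate_small[OF assms(1) 3 assms(3) st] by blast
  qed
qed

text \<open>
  The statement does not change if \<open>x\<close> and \<open>y\<close> are exchanged together with the conjugate
  exponents. This reduces everything to \<open>q < 2\<close>.
\<close>

theorem trace_estimate:
  assumes "1 < p" "1 < q" "q \<noteq> 2" "p \<noteq> 2" "p \<noteq> q"
  shows "\<exists>C \<delta>. 0 < \<delta> \<and> 0 \<le> C \<and> (\<forall>n N x y. contractive p q n N x \<longrightarrow> contractive (p/(p-1)) (q/(q-1)) n N y \<longrightarrow>
     (\<Sum>j<N. \<Sum>i<n. cmod (x i j) * cmod (y i j)) \<le> C * real n powr (1 - \<delta>))"
proof (cases "q < 2")
  case True
  then show ?thesis using trace_estimate_below_2[OF assms(1,2) True assms(4,5) refl refl] by simp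
next
  case False
  let ?s = "p/(p-1)" and ?t = "q/(q-1)"
  have "1 < ?s" "1 < ?t" "?t < 2" "?s \<noteq> 2" "?s \<noteq> ?t"
    using assms False by (auto simp: field_simps)
  moreover have "p = ?s / (?s - 1)" "q = ?t / (?t - 1)" using assms by (simp_all add: field_simps)
  ultimately obtain C \<delta> where "0 < \<delta>" "0 \<le> C" and C: "\<And>n N x y. contractive ?s ?t n N x \<Longrightarrow> contractive p q n N y \<Longrightarrow>
     (\<Sum>j<N. \<Sum>i<n. cmod (x i j) * cmod (y i j)) \<le> C * real n powr (1 - \<delta>)"
    using trace_estimate_below_2[of ?s ?t p q] by blast
  have C': "(\<Sum>j<N. \<Sum>i<n. cmod (x i j) * cmod (y i j)) \<le> C * real n powr (1 - \<delta>)"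
    if "contractive p q n N x" "contractive ?s ?t n N y" for n N x y
    using C[OF that(2,1)] by (subst mult.commute)
  show ?thesis
    by (rule exI[of _ C], rule exI[of _ \<delta>]) (use \<open>0 < \<delta>\<close> \<open>0 \<le> C\<close> C' in auto)
qed

text \<open>
  Duality of the finite-dimensional spaces: the norm of \<open>v\<close> is computed with the vector
  \<open>z\<close> at which Hoelder's inequality is an equality.
\<close>

lemma contractive_transpose:
  assumes a: "1 < a" and b: "1 < b" and y: "contractive a b N n (\<lambda>j i. y i j)"
  shows "contractive (b/(b-1)) (a/(a-1)) n N y"
  unfolding contractive_def
proof (intro allI)
  fix c :: "nat \<Rightarrow> complex"
  define s t where "s = b/(b-1)" and "t = a/(a-1)"
  have s: "s > 1" "(s - 1) * b = s" "1/b = 1 - 1/s" using b by (simp_all add: s_def field_simps)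
  have t: "t > 1" "1/t + 1/a = 1" using a by (simp_all add: t_def field_simps)
  define v where "v j = (\<Sum>i<n. c i * y i j)" for j
  define S where "S = (\<Sum>j<N. cmod (v j) powr s)"
  define G where "G = (\<Sum>i<n. cmod (c i) powr t)"
  define z where "z j = cnj (v j) * of_real (cmod (v j) powr (s - 2))" for j
  have zv: "z j * v j = of_real (cmod (v j) powr s)" for j
  proof (cases "v j = 0")
    case False
    have "z j * v j = (v j * cnj (v j)) * of_real (cmod (v j) powr (s - 2))" by (simp add: z_def)
    also have "v j * cnj (v j) = of_real (cmod (v j) powr 2)"
      using False by (simp add: complex_mult_cnj cmod_power2)
    also have "of_real (cmod (v j) powr 2) * of_real (cmod (v j) powr (s - 2)) = (of_real (cmod (v j) powr 2 * cmod (v j) powr (s - 2)) :: complex)"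
      by (rule of_real_mult[symmetric])
    also have "cmod (v j) powr 2 * cmod (v j) powr (s - 2) = cmod (v j) powr s"
      unfolding powr_add[symmetric] by simp
    finally show ?thesis .
  qed (simp add: z_def)
  have zb: "cmod (z j) powr b = cmod (v j) powr s" for j
  proof (cases "v j = 0")
    case False
    have "cmod (z j) = cmod (v j) powr 1 * cmod (v j) powr (s - 2)" by (simp add: z_def norm_mult)
    also have "\<dots> = cmod (v j) powr (s - 1)" unfolding powr_add[symmetric] by simp
    finally show ?thesis using s by (simp add: powr_powr)
  qed (simp add: z_def)
  have S0: "S \<ge> 0" and G0: "G \<ge> 0" by (auto simp: S_def G_def intro: sum_nonneg)
  have "complex_of_real S = (\<Sum>j<N. z j * v j)" by (simp add: S_def zv)
  also have "\<dots> = (\<Sum>i<n. c i * (\<Sum>j<N. z j * y i j))"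
    unfolding v_def sum_distrib_left by (subst sum.swap) (simp add: mult_ac)
  finally have "S = cmod (\<Sum>i<n. c i * (\<Sum>j<N. z j * y i j))"
    using S0 by (metis norm_of_real abs_of_nonneg)
  also have "\<dots> \<le> (\<Sum>i<n. cmod (c i) * cmod (\<Sum>j<N. z j * y i j))"
    by (intro sum_norm_le) (simp add: norm_mult)
  also have "\<dots> \<le> G powr (1/t) * (S powr (a/b)) powr (1/a)"
  proof (rule Holder_sum_le[OF t(1) a t(2)])
    show "(\<Sum>i<n. cmod (c i) powr t) \<le> G" by (simp add: G_def)
    show "(\<Sum>i<n. cmod (\<Sum>j<N. z j * y i j) powr a) \<le> S powr (a/b)"
      using y[unfolded contractive_def, rule_format, of z] by (simp add: zb S_def)
  qed auto
  also have "(S powr (a/b)) powr (1/a) = S powr (1/b)" using a by (simp add: powr_powr)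
  finally have le: "S \<le> G powr (1/t) * S powr (1/b)" .
  have "S \<le> G powr (s/t)"
  proof (cases "S = 0")
    case False
    then have pos: "S powr (1/b) > 0" by simp
    have "S powr (1/s) * S powr (1/b) = S" using S0 False s by (simp flip: powr_add)
    then have "S powr (1/s) * S powr (1/b) \<le> G powr (1/t) * S powr (1/b)" using le by simp
    then have "S powr (1/s) \<le> G powr (1/t)" using pos by simp
    then have "(S powr (1/s)) powr s \<le> (G powr (1/t)) powr s" using s by (intro powr_mono2) auto
    then show ?thesis using s S0 by (simp add: powr_powr)
  qed simp
  then show "(\<Sum>j<N. cmod (\<Sum>i<n. c i * y i j) powr (b/(b-1))) \<le> (\<Sum>i<n. cmod (c i) powr (a/(a-1))) powr (b/(b-1) / (a/(a-1)))"
    by (simp add: S_def G_def v_def s_def t_def)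
qed

section \<open>Normed spaces and bounded operators\<close>

lemma complex_ring_simps [simp]:
  "carrier complex_ring = UNIV" "mult complex_ring = (*)" "one complex_ring = 1"
  "zero complex_ring = 0" "add complex_ring = (+)"
  by (simp_all add: complex_ring_def)

lemma cring_complex_ring: "cring complex_ring"
proof (intro cringI abelian_groupI comm_monoidI)
  fix x :: complex
  show "\<exists>y\<in>carrier complex_ring. y \<oplus>\<^bsub>complex_ring\<^esub> x = \<zero>\<^bsub>complex_ring\<^esub>"
    by (intro bexI[of _ "- x"]) auto
qed (auto simp: algebra_simps)

text \<open>
  The existence of additive inverses follows from scalar multiplication by \<open>- 1\<close>, and that the
  zero vector has norm 0 follows from scalar multiplication by 0.
\<close>

lemma normed_cspaceI:
  fixes V :: "('a, 'm) nspace_scheme" (structure)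
  assumes add: "\<And>x y. x \<in> carrier V \<Longrightarrow> y \<in> carrier V \<Longrightarrow> x \<oplus> y \<in> carrier V"
    and zero: "\<zero> \<in> carrier V"
    and smult: "\<And>c x. x \<in> carrier V \<Longrightarrow> c \<odot> x \<in> carrier V"
    and assoc: "\<And>x y z. x \<in> carrier V \<Longrightarrow> y \<in> carrier V \<Longrightarrow> z \<in> carrier V \<Longrightarrow> x \<oplus> y \<oplus> z = x \<oplus> (y \<oplus> z)"
    and comm: "\<And>x y. x \<in> carrier V \<Longrightarrow> y \<in> carrier V \<Longrightarrow> x \<oplus> y = y \<oplus> x"
    and l_zero: "\<And>x. x \<in> carrier V \<Longrightarrow> \<zero> \<oplus> x = x"
    and smult_0: "\<And>x. x \<in> carrier V \<Longrightarrow> 0 \<odot> x = \<zero>"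
    and smult_1: "\<And>x. x \<in> carrier V \<Longrightarrow> 1 \<odot> x = x"
    and l_distr: "\<And>c d x. x \<in> carrier V \<Longrightarrow> (c + d) \<odot> x = c \<odot> x \<oplus> d \<odot> x"
    and r_distr: "\<And>c x y. x \<in> carrier V \<Longrightarrow> y \<in> carrier V \<Longrightarrow> c \<odot> (x \<oplus> y) = c \<odot> x \<oplus> c \<odot> y"
    and smult_assoc: "\<And>c d x. x \<in> carrier V \<Longrightarrow> (c * d) \<odot> x = c \<odot> (d \<odot> x)"
    and norm_0: "\<And>x. x \<in> carrier V \<Longrightarrow> vnorm V x = 0 \<Longrightarrow> x = \<zero>"
    and triangle: "\<And>x y. x \<in> carrier V \<Longrightarrow> y \<in> carrier V \<Longrightarrow> vnorm V (x \<oplus> y) \<le> vnorm V x + vnorm V y"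
    and norm_smult: "\<And>c x. x \<in> carrier V \<Longrightarrow> vnorm V (c \<odot> x) = cmod c * vnorm V x"
  shows "normed_cspace V"
proof -
  have inv: "\<exists>y\<in>carrier V. y \<oplus> x = \<zero>" if "x \<in> carrier V" for x
  proof (intro bexI[of _ "(-1) \<odot> x"])
    have "(-1) \<odot> x \<oplus> 1 \<odot> x = (-1 + 1) \<odot> x" using l_distr[OF that] by metis
    then show "(-1) \<odot> x \<oplus> x = \<zero>" using smult_0[OF that] smult_1[OF that] by simp
  qed (rule smult[OF that])
  have "Module.module complex_ring V"
    by (intro moduleI cring_complex_ring abelian_groupI)
       (use assms inv in auto)
  then interpret Module.module complex_ring V .
  have "vnorm V \<zero> = 0"
    using norm_smult[OF zero, of 0] smult_0[OF zero] by simp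
  then show ?thesis
    by unfold_locales (use norm_0 triangle norm_smult in auto)
qed

context normed_cspace
begin

lemma smult_in [simp, intro]: "x \<in> carrier V \<Longrightarrow> c \<odot> x \<in> carrier V"
  using smult_closed by simp

lemma smult_distr_l: "x \<in> carrier V \<Longrightarrow> (c + d) \<odot> x = c \<odot> x \<oplus> d \<odot> x"
  using smult_l_distr[of c d x] by simp

lemma smult_distr_r: "x \<in> carrier V \<Longrightarrow> y \<in> carrier V \<Longrightarrow> c \<odot> (x \<oplus> y) = c \<odot> x \<oplus> c \<odot> y"
  using smult_r_distr[of c x y] by simp

lemma smult_times: "x \<in> carrier V \<Longrightarrow> (c * d) \<odot> x = c \<odot> (d \<odot> x)"
  using smult_assoc1[of c d x] by simp

lemma smult_1 [simp]: "x \<in> carrier V \<Longrightarrow> 1 \<odot> x = x"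
  using smult_one by simp

lemma smult_0 [simp]: "x \<in> carrier V \<Longrightarrow> 0 \<odot> x = \<zero>"
proof -
  assume x: "x \<in> carrier V"
  have "0 \<odot> x \<oplus> 0 \<odot> x = 0 \<odot> x" using smult_distr_l[OF x, of 0 0] by simp
  then show ?thesis using x by (simp add: M.add.l_cancel_one)
qed

lemma a_inv_eq: "x \<in> carrier V \<Longrightarrow> \<ominus> x = (-1) \<odot> x"
proof -
  assume x: "x \<in> carrier V"
  have "(-1) \<odot> x \<oplus> 1 \<odot> x = (-1 + 1) \<odot> x" using smult_distr_l[OF x] by metis
  then have "(-1) \<odot> x \<oplus> x = \<zero>" using x by simp
  then show ?thesis using x by (intro M.minus_equality) auto
qed

lemma a_minus_eq: "x \<in> carrier V \<Longrightarrow> y \<in> carrier V \<Longrightarrow> x \<ominus> y = x \<oplus> (-1) \<odot> y"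
  by (simp add: a_minus_def a_inv_eq)

lemma vnorm_zero [simp]: "vnorm V \<zero> = 0"
  using vnorm_eq_0_iff by simp

lemma vnorm_nonneg [simp]: "x \<in> carrier V \<Longrightarrow> 0 \<le> vnorm V x"
proof -
  assume x: "x \<in> carrier V"
  have "x \<oplus> (-1) \<odot> x = \<zero>" using x a_minus_eq[OF x x] M.r_neg by (simp add: a_minus_def)
  then have "0 \<le> vnorm V x + vnorm V ((-1) \<odot> x)" using vnorm_triangle[of x "(-1) \<odot> x"] x by simp
  then show ?thesis using x by (simp add: vnorm_smult)
qed

lemma vnorm_minus_commute: "x \<in> carrier V \<Longrightarrow> y \<in> carrier V \<Longrightarrow> vnorm V (x \<ominus> y) = vnorm V (y \<ominus> x)"
proof -
  assume x: "x \<in> carrier V" and y: "y \<in> carrier V"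
  have "(-1) \<odot> (x \<ominus> y) = y \<ominus> x"
    using x y by (simp add: a_minus_eq smult_distr_r M.a_comm flip: smult_times)
  then show ?thesis using vnorm_smult[of "x \<ominus> y" "-1"] x y by simp
qed

lemma vnorm_triangle_minus:
  assumes "x \<in> carrier V" "y \<in> carrier V" "z \<in> carrier V"
  shows "vnorm V (x \<ominus> z) \<le> vnorm V (x \<ominus> y) + vnorm V (y \<ominus> z)"
proof -
  have "x \<ominus> z = (x \<ominus> y) \<oplus> (y \<ominus> z)"
    using assms by (simp add: a_minus_def M.a_assoc M.r_neg1)
  then show ?thesis using assms vnorm_triangle[of "x \<ominus> y" "y \<ominus> z"] by simp
qed

lemma vnorm_minus_eq_0: 
  assumes "x \<in> carrier V" "y \<in> carrier V"
  shows "vnorm V (x \<ominus> y) = 0 \<longleftrightarrow> x = y"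
proof -
  have "x = y" if "x \<ominus> y = \<zero>"
  proof -
    have "x = x \<ominus> y \<oplus> y" using assms by (simp add: a_minus_def M.a_assoc M.l_neg)
    then show ?thesis using that assms by simp
  qed
  then show ?thesis using assms by (auto simp: vnorm_eq_0_iff a_minus_def M.r_neg)
qed

lemma vnorm_minus_le: "x \<in> carrier V \<Longrightarrow> y \<in> carrier V \<Longrightarrow> vnorm V (x \<ominus> y) \<le> vnorm V x + vnorm V y"
  using vnorm_triangle[of x "(-1) \<odot> y"] by (simp add: a_minus_eq vnorm_smult)

lemma vnorm_le_add_minus: "x \<in> carrier V \<Longrightarrow> y \<in> carrier V \<Longrightarrow> vnorm V x \<le> vnorm V y + vnorm V (x \<ominus> y)"
  using vnorm_triangle[of y "x \<ominus> y"] by (simp add: a_minus_def M.a_ac M.r_neg2 M.r_neg1 M.r_neg M.l_neg)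

sublocale Metric_space "carrier V" "vdist V"
proof
  show "0 \<le> vdist V x y" for x y by (simp add: vdist_def)
  show "vdist V x y = vdist V y x" for x y by (simp add: vdist_def vnorm_minus_commute)
  show "vdist V x y = 0 \<longleftrightarrow> x = y" if "x \<in> carrier V" "y \<in> carrier V" for x y
    using that by (simp add: vdist_def vnorm_minus_eq_0)
  show "vdist V x z \<le> vdist V x y + vdist V y z" if "x \<in> carrier V" "y \<in> carrier V" "z \<in> carrier V" for x y z
    using that by (simp add: vdist_def vnorm_triangle_minus)
qed

text \<open>
  The differences are taken with the subtraction of the space, so that the condition can be moved
  between a space and its subspaces without reference to their metrics.
\<close>

definition Cauchy_seq :: "(nat \<Rightarrow> 'a) \<Rightarrow> bool" where
  "Cauchy_seq \<sigma> \<longleftrightarrow> (\<forall>n. \<sigma> n \<in> carrier V) \<and>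
     (\<forall>e>0. \<exists>N. \<forall>m\<ge>N. \<forall>n\<ge>N. vnorm V (\<sigma> m \<ominus> \<sigma> n) < e)"

lemma MCauchy_iff: "MCauchy \<sigma> \<longleftrightarrow> Cauchy_seq \<sigma>"
proof -
  have "range \<sigma> \<subseteq> carrier V \<longleftrightarrow> (\<forall>n. \<sigma> n \<in> carrier V)" by auto
  moreover have "(\<forall>n. \<sigma> n \<in> carrier V) \<Longrightarrow> vdist V (\<sigma> m) (\<sigma> n) = vnorm V (\<sigma> m \<ominus> \<sigma> n)" for m n
    by (simp add: vdist_def)
  ultimately show ?thesis unfolding MCauchy_def Cauchy_seq_def by (auto; metis)
qed

lemma limitin_iff: "(\<And>n. \<sigma> n \<in> carrier V) \<Longrightarrow>
    limitin mtopology \<sigma> x sequentially \<longleftrightarrow> x \<in> carrier V \<and> (\<lambda>n. vnorm V (\<sigma> n \<ominus> x)) \<longlonglongrightarrow> 0"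
  by (auto simp: limitin_metric_dist_null vdist_def)

lemma closure_of_iff:
  "S \<subseteq> carrier V \<Longrightarrow> x \<in> norm_topology V closure_of S \<longleftrightarrow>
     x \<in> carrier V \<and> (\<forall>e>0. \<exists>y\<in>S. vnorm V (x \<ominus> y) < e)"
  unfolding norm_topology_def metric_closure_of by (auto simp: in_mball vdist_def subset_iff; metis)

end

lemma (in normed_cspace) banach_cspaceI:
  assumes "\<And>\<sigma>. Cauchy_seq \<sigma> \<Longrightarrow> \<exists>x\<in>carrier V. (\<lambda>n. vnorm V (\<sigma> n \<ominus> x)) \<longlonglongrightarrow> 0"
  shows "banach_cspace V"
proof
  show "mcomplete"
    unfolding mcomplete_def
  proof (intro allI impI)
    fix \<sigma> assume "MCauchy \<sigma>"
    then have c: "Cauchy_seq \<sigma>" by (simp add: MCauchy_iff)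
    then obtain x where "x \<in> carrier V" "(\<lambda>n. vnorm V (\<sigma> n \<ominus> x)) \<longlonglongrightarrow> 0" using assms by blast
    then show "\<exists>x. limitin mtopology \<sigma> x sequentially"
      using c by (intro exI[of _ x]) (subst limitin_iff, auto simp: Cauchy_seq_def)
  qed
qed

lemma (in banach_cspace) Cauchy_seq_converges:
  assumes "Cauchy_seq \<sigma>"
  shows "\<exists>x\<in>carrier V. (\<lambda>n. vnorm V (\<sigma> n \<ominus> x)) \<longlonglongrightarrow> 0"
proof -
  obtain x where "limitin mtopology \<sigma> x sequentially"
    using complete assms unfolding mcomplete_def MCauchy_iff by blast
  then show ?thesis using assms by (subst (asm) limitin_iff) (auto simp: Cauchy_seq_def)
qed

text \<open>
  The norm of the subspace may differ from the norm of the ambient space, as it does for the bimodule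
  \<open>Z\<close> below.
\<close>

lemma normed_cspace_subspace:
  fixes W :: "('a, 'n) nspace_scheme"
  assumes "normed_cspace V"
    and W: "carrier W \<subseteq> carrier V" "add W = add V" "zero W = zero V" "Module.smult W = Module.smult V"
    and closed: "\<zero>\<^bsub>V\<^esub> \<in> carrier W" "\<And>x y. x \<in> carrier W \<Longrightarrow> y \<in> carrier W \<Longrightarrow> x \<oplus>\<^bsub>V\<^esub> y \<in> carrier W"
      "\<And>c x. x \<in> carrier W \<Longrightarrow> c \<odot>\<^bsub>V\<^esub> x \<in> carrier W"
    and norm: "\<And>x. x \<in> carrier W \<Longrightarrow> vnorm W x = 0 \<Longrightarrow> x = \<zero>\<^bsub>V\<^esub>"
      "\<And>x y. x \<in> carrier W \<Longrightarrow> y \<in> carrier W \<Longrightarrow> vnorm W (x \<oplus>\<^bsub>V\<^esub> y) \<le> vnorm W x + vnorm W y"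
      "\<And>c x. x \<in> carrier W \<Longrightarrow> vnorm W (c \<odot>\<^bsub>V\<^esub> x) = cmod c * vnorm W x"
  shows "normed_cspace W"
proof -
  interpret V: normed_cspace V by fact
  have in_V: "x \<in> carrier W \<Longrightarrow> x \<in> carrier V" for x using W by auto
  show ?thesis
    by (rule normed_cspaceI)
       (use closed norm in \<open>simp_all add: W(2-4) in_V V.M.a_ac V.smult_distr_l V.smult_distr_r V.smult_times\<close>)
qed

lemma clinear_mapD:
  assumes "clinear_map V W f"
  shows "x \<in> carrier V \<Longrightarrow> f x \<in> carrier W"
    and "x \<in> carrier V \<Longrightarrow> y \<in> carrier V \<Longrightarrow> f (x \<oplus>\<^bsub>V\<^esub> y) = f x \<oplus>\<^bsub>W\<^esub> f y"
    and "x \<in> carrier V \<Longrightarrow> f (c \<odot>\<^bsub>V\<^esub> x) = c \<odot>\<^bsub>W\<^esub> f x"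
  using assms by (auto simp: clinear_map_def)

lemma clinear_mapI:
  assumes "\<And>x. x \<in> carrier V \<Longrightarrow> f x \<in> carrier W"
    and "\<And>x y. x \<in> carrier V \<Longrightarrow> y \<in> carrier V \<Longrightarrow> f (x \<oplus>\<^bsub>V\<^esub> y) = f x \<oplus>\<^bsub>W\<^esub> f y"
    and "\<And>c x. x \<in> carrier V \<Longrightarrow> f (c \<odot>\<^bsub>V\<^esub> x) = c \<odot>\<^bsub>W\<^esub> f x"
  shows "clinear_map V W f"
  using assms by (auto simp: clinear_map_def)

lemma operator_space_simps [simp]:
  "zero (operator_space V W) = (\<lambda>x\<in>carrier V. \<zero>\<^bsub>W\<^esub>)"
  "add (operator_space V W) = (\<lambda>f g. \<lambda>x\<in>carrier V. f x \<oplus>\<^bsub>W\<^esub> g x)"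
  "Module.smult (operator_space V W) = (\<lambda>c f. \<lambda>x\<in>carrier V. c \<odot>\<^bsub>W\<^esub> f x)"
  by (simp_all add: operator_space_def)

locale normed_pair = V: normed_cspace V + W: normed_cspace W
  for V :: "('a, 'm) nspace_scheme" and W :: "('b, 'n) nspace_scheme"
begin

abbreviation "L \<equiv> operator_space V W"

lemma carrier_L: "f \<in> carrier L \<longleftrightarrow> f \<in> extensional (carrier V) \<and> clinear_map V W f \<and>
   (\<exists>K. \<forall>x\<in>carrier V. vnorm W (f x) \<le> K * vnorm V x)"
  by (auto simp: operator_space_def bounded_clinear_map_def)

lemma vnorm_L: "vnorm L f = (SUP x\<in>{x \<in> carrier V. vnorm V x \<le> 1}. vnorm W (f x))"
  by (simp add: operator_space_def)

lemma L_clinear: "f \<in> carrier L \<Longrightarrow> clinear_map V W f"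
  by (simp add: carrier_L)

lemma L_app [simp]: "f \<in> carrier L \<Longrightarrow> x \<in> carrier V \<Longrightarrow> f x \<in> carrier W"
  using clinear_mapD(1)[OF L_clinear] .

lemma L_add: "f \<in> carrier L \<Longrightarrow> x \<in> carrier V \<Longrightarrow> y \<in> carrier V \<Longrightarrow> f (x \<oplus>\<^bsub>V\<^esub> y) = f x \<oplus>\<^bsub>W\<^esub> f y"
  using clinear_mapD(2)[OF L_clinear] .

lemma L_smult: "f \<in> carrier L \<Longrightarrow> x \<in> carrier V \<Longrightarrow> f (c \<odot>\<^bsub>V\<^esub> x) = c \<odot>\<^bsub>W\<^esub> f x"
  using clinear_mapD(3)[OF L_clinear] .

lemma clinear_zero: "clinear_map V W f \<Longrightarrow> f \<zero>\<^bsub>V\<^esub> = \<zero>\<^bsub>W\<^esub>"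
  using clinear_mapD[of V W f "\<zero>\<^bsub>V\<^esub>"] V.smult_0[of "\<zero>\<^bsub>V\<^esub>"] W.smult_0[of "f \<zero>\<^bsub>V\<^esub>"] V.M.zero_closed
  by metis

lemma L_ext: "f \<in> carrier L \<Longrightarrow> g \<in> carrier L \<Longrightarrow> (\<And>x. x \<in> carrier V \<Longrightarrow> f x = g x) \<Longrightarrow> f = g"
  by (auto simp: carrier_L intro: extensionalityI)

lemma L_I: "f \<in> extensional (carrier V) \<Longrightarrow> clinear_map V W f \<Longrightarrow>
   (\<And>x. x \<in> carrier V \<Longrightarrow> vnorm W (f x) \<le> K * vnorm V x) \<Longrightarrow> f \<in> carrier L"
  by (auto simp: carrier_L)

lemma bound_normalized:
  assumes "clinear_map V W f" and "\<And>x. x \<in> carrier V \<Longrightarrow> vnorm V x \<le> 1 \<Longrightarrow> vnorm W (f x) \<le> K"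
    and "x \<in> carrier V"
  shows "vnorm W (f x) \<le> K * vnorm V x"
proof (cases "vnorm V x = 0")
  case True
  then show ?thesis using assms by (simp add: V.vnorm_eq_0_iff clinear_zero)
next
  case False
  then have pos: "vnorm V x > 0" using assms(3) by (simp add: order_less_le)
  let ?c = "complex_of_real (1 / vnorm V x)"
  have "vnorm W (f (?c \<odot>\<^bsub>V\<^esub> x)) \<le> K"
    using assms pos by (intro assms(2)) (auto simp: V.vnorm_smult norm_divide)
  also have "vnorm W (f (?c \<odot>\<^bsub>V\<^esub> x)) = vnorm W (f x) / vnorm V x"
    using assms pos by (simp add: clinear_mapD[OF assms(1)] W.vnorm_smult norm_divide)
  finally show ?thesis using pos by (simp add: field_simps)
qed

lemma unit_ball_ne: "{x \<in> carrier V. vnorm V x \<le> 1} \<noteq> {}"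
  by (auto intro!: exI[of _ "\<zero>\<^bsub>V\<^esub>"])

lemma vnorm_L_bdd:
  assumes "f \<in> carrier L"
  shows "bdd_above ((\<lambda>x. vnorm W (f x)) ` {x \<in> carrier V. vnorm V x \<le> 1})"
proof -
  obtain K where K: "\<And>x. x \<in> carrier V \<Longrightarrow> vnorm W (f x) \<le> K * vnorm V x"
    using assms by (auto simp: carrier_L)
  have "vnorm W (f x) \<le> \<bar>K\<bar>" if "x \<in> carrier V" "vnorm V x \<le> 1" for x
  proof -
    have "vnorm W (f x) \<le> K * vnorm V x" by (rule K) fact
    also have "\<dots> \<le> \<bar>K\<bar> * vnorm V x" using that by (intro mult_right_mono) auto
    also have "\<dots> \<le> \<bar>K\<bar> * 1" using that by (intro mult_left_mono) auto
    finally show ?thesis by simp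
  qed
  then show ?thesis by (intro bdd_aboveI[of _ "\<bar>K\<bar>"]) auto
qed

lemma L_bound: "f \<in> carrier L \<Longrightarrow> x \<in> carrier V \<Longrightarrow> vnorm W (f x) \<le> vnorm L f * vnorm V x"
proof (rule bound_normalized)
  fix x assume f: "f \<in> carrier L" and "x \<in> carrier V" "vnorm V x \<le> 1"
  then show "vnorm W (f x) \<le> vnorm L f"
    unfolding vnorm_L by (intro cSUP_upper vnorm_L_bdd) auto
qed (auto intro: L_clinear)

lemma vnorm_L_le:
  assumes "K \<ge> 0" "\<And>x. x \<in> carrier V \<Longrightarrow> vnorm W (f x) \<le> K * vnorm V x"
  shows "vnorm L f \<le> K"
  unfolding vnorm_L
proof (rule cSUP_least[OF unit_ball_ne])
  fix x assume x: "x \<in> {x \<in> carrier V. vnorm V x \<le> 1}"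
  then have "vnorm W (f x) \<le> K * vnorm V x" by (intro assms) auto
  also have "\<dots> \<le> K * 1" using x assms(1) by (intro mult_left_mono) auto
  finally show "vnorm W (f x) \<le> K" by simp
qed

lemma vnorm_L_nonneg: "f \<in> carrier L \<Longrightarrow> 0 \<le> vnorm L f"
  unfolding vnorm_L by (rule order_trans[OF _ cSUP_upper[OF _ vnorm_L_bdd, of "\<zero>\<^bsub>V\<^esub>"]]) auto

lemma L_add_closed: "f \<in> carrier L \<Longrightarrow> g \<in> carrier L \<Longrightarrow> f \<oplus>\<^bsub>L\<^esub> g \<in> carrier L"
proof (rule L_I)
  assume f: "f \<in> carrier L" and g: "g \<in> carrier L"
  show "clinear_map V W (f \<oplus>\<^bsub>L\<^esub> g)"
    by (rule clinear_mapI)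
       (use f g in \<open>auto simp: L_add L_smult W.smult_distr_r W.M.a_ac\<close>)
  fix x assume x: "x \<in> carrier V"
  have "vnorm W (f x \<oplus>\<^bsub>W\<^esub> g x) \<le> vnorm W (f x) + vnorm W (g x)"
    using x f g by (intro W.vnorm_triangle) auto
  also have "\<dots> \<le> (vnorm L f + vnorm L g) * vnorm V x"
    using L_bound[OF f x] L_bound[OF g x] by (simp add: distrib_right)
  finally show "vnorm W ((f \<oplus>\<^bsub>L\<^esub> g) x) \<le> (vnorm L f + vnorm L g) * vnorm V x" using x by simp
qed auto

lemma L_smult_closed: "f \<in> carrier L \<Longrightarrow> c \<odot>\<^bsub>L\<^esub> f \<in> carrier L"
proof (rule L_I)
  assume f: "f \<in> carrier L"
  show "clinear_map V W (c \<odot>\<^bsub>L\<^esub> f)"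
    by (rule clinear_mapI)
       (use f in \<open>auto simp: L_add L_smult W.smult_distr_r mult.commute simp flip: W.smult_times\<close>)
  fix x assume x: "x \<in> carrier V"
  show "vnorm W ((c \<odot>\<^bsub>L\<^esub> f) x) \<le> (cmod c * vnorm L f) * vnorm V x"
    using L_bound[OF f x] f x by (simp add: W.vnorm_smult mult.assoc mult_left_mono)
qed auto

lemma L_zero_closed: "\<zero>\<^bsub>L\<^esub> \<in> carrier L"
  by (rule L_I[where K = 0]) (auto intro!: clinear_mapI)

lemma L_norm_smult: "f \<in> carrier L \<Longrightarrow> vnorm L (c \<odot>\<^bsub>L\<^esub> f) = cmod c * vnorm L f"
proof -
  have le: "vnorm L (c \<odot>\<^bsub>L\<^esub> f) \<le> cmod c * vnorm L f" if f: "f \<in> carrier L" for c f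
  proof (rule vnorm_L_le)
    fix x assume x: "x \<in> carrier V"
    show "vnorm W ((c \<odot>\<^bsub>L\<^esub> f) x) \<le> (cmod c * vnorm L f) * vnorm V x"
      using L_bound[OF f x] f x by (simp add: W.vnorm_smult mult.assoc mult_left_mono)
  qed (use vnorm_L_nonneg[OF f] in auto)
  assume f: "f \<in> carrier L"
  show ?thesis
  proof (cases "c = 0")
    case True
    then show ?thesis using le[OF f, of 0] vnorm_L_nonneg[OF L_smult_closed[OF f, of 0]] by simp
  next
    case False
    have "f = inverse c \<odot>\<^bsub>L\<^esub> (c \<odot>\<^bsub>L\<^esub> f)"
      by (rule L_ext[OF f L_smult_closed[OF L_smult_closed[OF f]]])
         (use f False in \<open>simp flip: W.smult_times\<close>)
    then have "vnorm L f \<le> cmod (inverse c) * vnorm L (c \<odot>\<^bsub>L\<^esub> f)"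
      using le[OF L_smult_closed[OF f], of "inverse c" c] by metis
    then have "cmod c * vnorm L f \<le> cmod c * (cmod (inverse c) * vnorm L (c \<odot>\<^bsub>L\<^esub> f))"
      by (intro mult_left_mono) auto
    also have "\<dots> = vnorm L (c \<odot>\<^bsub>L\<^esub> f)" using False by (simp add: norm_inverse)
    finally have "cmod c * vnorm L f \<le> vnorm L (c \<odot>\<^bsub>L\<^esub> f)" .
    then show ?thesis using le[OF f, of c] by (simp del: operator_space_simps)
  qed
qed

lemma L_norm_add: "f \<in> carrier L \<Longrightarrow> g \<in> carrier L \<Longrightarrow> vnorm L (f \<oplus>\<^bsub>L\<^esub> g) \<le> vnorm L f + vnorm L g"
proof (rule vnorm_L_le)
  assume f: "f \<in> carrier L" and g: "g \<in> carrier L"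
  then show "0 \<le> vnorm L f + vnorm L g" using vnorm_L_nonneg by simp
  fix x assume x: "x \<in> carrier V"
  have "vnorm W (f x \<oplus>\<^bsub>W\<^esub> g x) \<le> vnorm W (f x) + vnorm W (g x)"
    using x f g by (intro W.vnorm_triangle) auto
  also have "\<dots> \<le> (vnorm L f + vnorm L g) * vnorm V x"
    using L_bound[OF f x] L_bound[OF g x] by (simp add: distrib_right)
  finally show "vnorm W ((f \<oplus>\<^bsub>L\<^esub> g) x) \<le> (vnorm L f + vnorm L g) * vnorm V x" using x by simp
qed

lemma normed_cspace_L: "normed_cspace L"
proof (rule normed_cspaceI)
  fix f assume f: "f \<in> carrier L"
  show "f = \<zero>\<^bsub>L\<^esub>" if "vnorm L f = 0"
  proof (rule L_ext[OF f L_zero_closed])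
    fix x assume x: "x \<in> carrier V"
    have "vnorm W (f x) \<le> 0" using L_bound[OF f x] that by simp
    then show "f x = \<zero>\<^bsub>L\<^esub> x" using f x by (simp add: order_antisym flip: W.vnorm_eq_0_iff)
  qed
qed (auto simp: L_add_closed L_smult_closed L_zero_closed L_norm_smult L_norm_add simp del: operator_space_simps
  intro!: L_ext L_add_closed L_smult_closed L_zero_closed,
  auto simp: W.M.a_ac W.smult_distr_l W.smult_distr_r W.smult_times)

sublocale L: normed_cspace L by (rule normed_cspace_L)

lemma L_minus: "f \<in> carrier L \<Longrightarrow> g \<in> carrier L \<Longrightarrow> x \<in> carrier V \<Longrightarrow> (f \<ominus>\<^bsub>L\<^esub> g) x = f x \<ominus>\<^bsub>W\<^esub> g x"
  by (simp add: L.a_minus_eq W.a_minus_eq)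

end

context normed_cspace
begin

definition converges :: "(nat \<Rightarrow> 'a) \<Rightarrow> 'a \<Rightarrow> bool" where
  "converges \<sigma> x \<longleftrightarrow> (\<lambda>n. vnorm V (\<sigma> n \<ominus> x)) \<longlonglongrightarrow> 0"

lemma converges_unique:
  assumes \<sigma>: "\<And>n. \<sigma> n \<in> carrier V" and x: "x \<in> carrier V" "y \<in> carrier V"
    and "converges \<sigma> x" "converges \<sigma> y"
  shows "x = y"
proof -
  have "(\<lambda>n. vnorm V (\<sigma> n \<ominus> x) + vnorm V (\<sigma> n \<ominus> y)) \<longlonglongrightarrow> 0 + 0"
    using assms unfolding converges_def by (intro tendsto_add)
  moreover have "vnorm V (x \<ominus> y) \<le> vnorm V (\<sigma> n \<ominus> x) + vnorm V (\<sigma> n \<ominus> y)" for n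
    using vnorm_triangle_minus[OF x(1) \<sigma> x(2), of n] vnorm_minus_commute[OF x(1) \<sigma>, of n] by simp
  ultimately have "vnorm V (x \<ominus> y) \<le> 0 + 0"
    by (intro LIMSEQ_le_const) auto
  then have "vnorm V (x \<ominus> y) = 0" using x by (intro order_antisym) auto
  then show ?thesis using x vnorm_minus_eq_0 by simp
qed

lemma converges_add:
  assumes \<sigma>: "\<And>n. \<sigma> n \<in> carrier V" "\<And>n. \<rho> n \<in> carrier V" and x: "x \<in> carrier V" "y \<in> carrier V"
    and "converges \<sigma> x" "converges \<rho> y"
  shows "converges (\<lambda>n. \<sigma> n \<oplus> \<rho> n) (x \<oplus> y)"
proof -
  have lim: "(\<lambda>n. vnorm V (\<sigma> n \<ominus> x) + vnorm V (\<rho> n \<ominus> y)) \<longlonglongrightarrow> 0"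
    using tendsto_add[OF assms(5,6)[unfolded converges_def]] by simp
  have "vnorm V ((\<sigma> n \<oplus> \<rho> n) \<ominus> (x \<oplus> y)) \<le> vnorm V (\<sigma> n \<ominus> x) + vnorm V (\<rho> n \<ominus> y)" for n
  proof -
    have "(\<sigma> n \<oplus> \<rho> n) \<ominus> (x \<oplus> y) = (\<sigma> n \<ominus> x) \<oplus> (\<rho> n \<ominus> y)"
      using \<sigma> x by (simp add: a_minus_eq smult_distr_r M.a_ac)
    then show ?thesis using vnorm_triangle[of "\<sigma> n \<ominus> x" "\<rho> n \<ominus> y"] \<sigma> x by simp
  qed
  then show ?thesis unfolding converges_def
    using \<sigma> x by (intro tendsto_sandwich[OF _ _ tendsto_const lim] always_eventually allI) auto
qed

lemma converges_smult:
  assumes \<sigma>: "\<And>n. \<sigma> n \<in> carrier V" and x: "x \<in> carrier V" and "converges \<sigma> x"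
  shows "converges (\<lambda>n. c \<odot> \<sigma> n) (c \<odot> x)"
proof -
  have "c \<odot> \<sigma> n \<ominus> c \<odot> x = c \<odot> (\<sigma> n \<ominus> x)" for n
    using \<sigma> x by (simp add: a_minus_eq smult_distr_r mult.commute flip: smult_times)
  then have "vnorm V (c \<odot> \<sigma> n \<ominus> c \<odot> x) = cmod c * vnorm V (\<sigma> n \<ominus> x)" for n
    using \<sigma> x by (simp add: vnorm_smult)
  then show ?thesis
    using tendsto_mult_right_zero[OF assms(3)[unfolded converges_def], of "cmod c"] by (simp add: converges_def)
qed

lemma vnorm_limit_le:
  assumes \<sigma>: "\<And>n. \<sigma> n \<in> carrier V" and x: "x \<in> carrier V" and "converges \<sigma> x"
    and le: "\<And>n. n \<ge> N \<Longrightarrow> vnorm V (\<sigma> n) \<le> K"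
  shows "vnorm V x \<le> K"
proof -
  have "(\<lambda>n. K + vnorm V (\<sigma> n \<ominus> x)) \<longlonglongrightarrow> K + 0"
    using assms(3) unfolding converges_def by (intro tendsto_add tendsto_const)
  moreover have "vnorm V x \<le> K + vnorm V (\<sigma> n \<ominus> x)" if "n \<ge> N" for n
    using vnorm_le_add_minus[OF x \<sigma>, of n] le[OF that] vnorm_minus_commute[OF x \<sigma>, of n] by simp
  ultimately show ?thesis using LIMSEQ_le_const[of _ "K + 0" "vnorm V x"] by auto
qed

end

context normed_pair
begin

text \<open>
  The pointwise limit of a Cauchy sequence of operators is linear, and the Cauchy estimates
  \<open>bound\<close> pass to the limit.
\<close>

lemma banach_cspace_L:
  assumes "banach_cspace W"
  shows "banach_cspace L"
proof (rule L.banach_cspaceI)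
  interpret W: banach_cspace W by fact
  fix \<sigma> assume \<sigma>: "L.Cauchy_seq \<sigma>"
  then have \<sigma>L: "\<sigma> n \<in> carrier L" for n by (simp add: L.Cauchy_seq_def)
  have small: "\<exists>N. \<forall>m\<ge>N. \<forall>n\<ge>N. vnorm L (\<sigma> m \<ominus>\<^bsub>L\<^esub> \<sigma> n) < e" if "e > 0" for e
    using \<sigma> that by (auto simp: L.Cauchy_seq_def)
  have diff: "vnorm W (\<sigma> m x \<ominus>\<^bsub>W\<^esub> \<sigma> n x) \<le> vnorm L (\<sigma> m \<ominus>\<^bsub>L\<^esub> \<sigma> n) * vnorm V x" if "x \<in> carrier V" for m n x
    using L_bound[of "\<sigma> m \<ominus>\<^bsub>L\<^esub> \<sigma> n" x] \<sigma>L that by (simp add: L_minus)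
  have "\<exists>y\<in>carrier W. W.converges (\<lambda>n. \<sigma> n x) y" if x: "x \<in> carrier V" for x
    unfolding W.converges_def
  proof (rule W.Cauchy_seq_converges, unfold W.Cauchy_seq_def, intro conjI allI impI)
    show "\<sigma> n x \<in> carrier W" for n using \<sigma>L x by simp
    fix e :: real assume e: "e > 0"
    have pos: "vnorm V x + 1 > 0" using x V.vnorm_nonneg[of x] by linarith
    obtain N where N: "\<And>m n. m \<ge> N \<Longrightarrow> n \<ge> N \<Longrightarrow> vnorm L (\<sigma> m \<ominus>\<^bsub>L\<^esub> \<sigma> n) < e / (vnorm V x + 1)"
      using small[of "e / (vnorm V x + 1)"] e pos by auto
    show "\<exists>N. \<forall>m\<ge>N. \<forall>n\<ge>N. vnorm W (\<sigma> m x \<ominus>\<^bsub>W\<^esub> \<sigma> n x) < e"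
    proof (intro exI allI impI)
      fix m n assume "m \<ge> N" "n \<ge> N"
      have "vnorm W (\<sigma> m x \<ominus>\<^bsub>W\<^esub> \<sigma> n x) \<le> vnorm L (\<sigma> m \<ominus>\<^bsub>L\<^esub> \<sigma> n) * vnorm V x" by (rule diff[OF x])
      also have "\<dots> \<le> vnorm L (\<sigma> m \<ominus>\<^bsub>L\<^esub> \<sigma> n) * (vnorm V x + 1)"
        using \<sigma>L by (intro mult_left_mono) auto
      also have "\<dots> < e / (vnorm V x + 1) * (vnorm V x + 1)"
        using N[OF \<open>m \<ge> N\<close> \<open>n \<ge> N\<close>] pos by (intro mult_strict_right_mono)
      also have "\<dots> = e" using pos by simp
      finally show "vnorm W (\<sigma> m x \<ominus>\<^bsub>W\<^esub> \<sigma> n x) < e" .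
    qed
  qed
  then obtain g where g: "\<And>x. x \<in> carrier V \<Longrightarrow> g x \<in> carrier W" "\<And>x. x \<in> carrier V \<Longrightarrow> W.converges (\<lambda>n. \<sigma> n x) (g x)"
    by metis
  define f where "f = restrict g (carrier V)"
  have f: "x \<in> carrier V \<Longrightarrow> f x \<in> carrier W" "x \<in> carrier V \<Longrightarrow> W.converges (\<lambda>n. \<sigma> n x) (f x)" for x
    using g by (auto simp: f_def)
  have lin: "clinear_map V W f"
  proof (rule clinear_mapI)
    fix x y assume x: "x \<in> carrier V" and y: "y \<in> carrier V"
    have "W.converges (\<lambda>n. \<sigma> n x \<oplus>\<^bsub>W\<^esub> \<sigma> n y) (f x \<oplus>\<^bsub>W\<^esub> f y)"
      using x y f \<sigma>L by (intro W.converges_add) auto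
    then have "W.converges (\<lambda>n. \<sigma> n (x \<oplus>\<^bsub>V\<^esub> y)) (f x \<oplus>\<^bsub>W\<^esub> f y)"
      using x y \<sigma>L by (simp add: L_add)
    then show "f (x \<oplus>\<^bsub>V\<^esub> y) = f x \<oplus>\<^bsub>W\<^esub> f y"
      using x y \<sigma>L f by (intro W.converges_unique[of "\<lambda>n. \<sigma> n (x \<oplus>\<^bsub>V\<^esub> y)"]) auto
  next
    fix c x assume x: "x \<in> carrier V"
    have "W.converges (\<lambda>n. c \<odot>\<^bsub>W\<^esub> \<sigma> n x) (c \<odot>\<^bsub>W\<^esub> f x)"
      using x f \<sigma>L by (intro W.converges_smult) auto
    then have "W.converges (\<lambda>n. \<sigma> n (c \<odot>\<^bsub>V\<^esub> x)) (c \<odot>\<^bsub>W\<^esub> f x)"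
      using x \<sigma>L by (simp add: L_smult)
    then show "f (c \<odot>\<^bsub>V\<^esub> x) = c \<odot>\<^bsub>W\<^esub> f x"
      using x \<sigma>L f by (intro W.converges_unique[of "\<lambda>n. \<sigma> n (c \<odot>\<^bsub>V\<^esub> x)"]) auto
  qed (rule f)
  have bound: "vnorm W (\<sigma> m x \<ominus>\<^bsub>W\<^esub> f x) \<le> e * vnorm V x"
    if N: "\<And>m n. m \<ge> N \<Longrightarrow> n \<ge> N \<Longrightarrow> vnorm L (\<sigma> m \<ominus>\<^bsub>L\<^esub> \<sigma> n) < e" and m: "m \<ge> N" and x: "x \<in> carrier V" for N m e x
  proof (rule W.vnorm_limit_le)
    have "W.converges (\<lambda>n. \<sigma> m x) (\<sigma> m x)" using x \<sigma>L W.vnorm_minus_eq_0[of "\<sigma> m x" "\<sigma> m x"] by (simp add: W.converges_def)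
    then have "W.converges (\<lambda>n. \<sigma> m x \<oplus>\<^bsub>W\<^esub> (-1) \<odot>\<^bsub>W\<^esub> \<sigma> n x) (\<sigma> m x \<oplus>\<^bsub>W\<^esub> (-1) \<odot>\<^bsub>W\<^esub> f x)"
      using x \<sigma>L f by (intro W.converges_add W.converges_smult) auto
    then show "W.converges (\<lambda>n. \<sigma> m x \<ominus>\<^bsub>W\<^esub> \<sigma> n x) (\<sigma> m x \<ominus>\<^bsub>W\<^esub> f x)"
      using x \<sigma>L f by (simp add: W.a_minus_eq)
    fix n assume "n \<ge> N"
    show "vnorm W (\<sigma> m x \<ominus>\<^bsub>W\<^esub> \<sigma> n x) \<le> e * vnorm V x"
      by (rule order_trans[OF diff[OF x] mult_right_mono]) (use N[OF m \<open>n \<ge> N\<close>] x in auto)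
  qed (use x \<sigma>L f in auto)
  have "f \<in> carrier L"
  proof -
    obtain N where N: "\<And>m n. m \<ge> N \<Longrightarrow> n \<ge> N \<Longrightarrow> vnorm L (\<sigma> m \<ominus>\<^bsub>L\<^esub> \<sigma> n) < 1" using small[of 1] by auto
    show ?thesis
    proof (rule L_I[OF _ lin])
      fix x assume x: "x \<in> carrier V"
      have "vnorm W (f x) \<le> vnorm W (\<sigma> N x) + vnorm W (f x \<ominus>\<^bsub>W\<^esub> \<sigma> N x)"
        using x \<sigma>L f by (intro W.vnorm_le_add_minus) auto
      also have "\<dots> \<le> vnorm L (\<sigma> N) * vnorm V x + 1 * vnorm V x"
        using bound[OF N, of N N x] L_bound[OF \<sigma>L x, of N] W.vnorm_minus_commute[of "f x" "\<sigma> N x"] x \<sigma>L f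
        by (intro add_mono) auto
      finally show "vnorm W (f x) \<le> (vnorm L (\<sigma> N) + 1) * vnorm V x" by (simp add: distrib_right)
    qed (simp add: f_def)
  qed
  moreover have "(\<lambda>n. vnorm L (\<sigma> n \<ominus>\<^bsub>L\<^esub> f)) \<longlonglongrightarrow> 0"
  proof (rule LIMSEQ_I)
    fix e :: real assume e: "0 < e"
    obtain N where N: "\<And>m n. m \<ge> N \<Longrightarrow> n \<ge> N \<Longrightarrow> vnorm L (\<sigma> m \<ominus>\<^bsub>L\<^esub> \<sigma> n) < e/2" using small[of "e/2"] e by auto
    have "vnorm L (\<sigma> m \<ominus>\<^bsub>L\<^esub> f) \<le> e/2" if "m \<ge> N" for m
      using e bound[OF N that] \<sigma>L \<open>f \<in> carrier L\<close> by (intro vnorm_L_le) (auto simp: L_minus)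
    then have "norm (vnorm L (\<sigma> m \<ominus>\<^bsub>L\<^esub> f) - 0) < e" if "m \<ge> N" for m
      using e \<sigma>L \<open>f \<in> carrier L\<close> that by (auto intro: order_le_less_trans[of _ "e/2"])
    then show "\<exists>no. \<forall>n\<ge>no. norm (vnorm L (\<sigma> n \<ominus>\<^bsub>L\<^esub> f) - 0) < e" by blast
  qed
  ultimately show "\<exists>f\<in>carrier L. (\<lambda>n. vnorm L (\<sigma> n \<ominus>\<^bsub>L\<^esub> f)) \<longlonglongrightarrow> 0" by blast
qed

end

lemma complex_line_simps [simp]:
  "carrier complex_line = UNIV" "zero complex_line = 0" "add complex_line = (+)"
  "Module.smult complex_line = (*)" "vnorm complex_line = cmod"
  by (simp_all add: complex_line_def)

lemma normed_cspace_complex_line: "normed_cspace complex_line"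
  by (rule normed_cspaceI) (auto simp: algebra_simps norm_triangle_ineq norm_mult)

lemma complex_line_minus [simp]: "x \<ominus>\<^bsub>complex_line\<^esub> y = x - y"
  using normed_cspace.a_minus_eq[OF normed_cspace_complex_line, of x y] by simp

context normed_cspace
begin

lemma clinear_functional_finsum:
  assumes f: "\<And>x y. x \<in> carrier V \<Longrightarrow> y \<in> carrier V \<Longrightarrow> f (x \<oplus> y) = f x + f y" "f \<zero> = (0::complex)"
    and "finite B" and g: "\<And>b. b \<in> B \<Longrightarrow> g b \<in> carrier V"
  shows "f (\<Oplus>b\<in>B. g b) = (\<Sum>b\<in>B. f (g b))"
  using \<open>finite B\<close> g
proof (induction B rule: finite_induct)
  case (insert b B)
  then show ?case by (subst M.finsum_insert) (auto simp: f)
qed (simp add: f)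

lemma vnorm_finsum_le:
  assumes "finite B" "\<And>b. b \<in> B \<Longrightarrow> g b \<in> carrier V"
  shows "vnorm V (\<Oplus>b\<in>B. g b) \<le> (\<Sum>b\<in>B. vnorm V (g b))"
  using assms
proof (induction B rule: finite_induct)
  case (insert b B)
  have "vnorm V (\<Oplus>b\<in>insert b B. g b) = vnorm V (g b \<oplus> (\<Oplus>b\<in>B. g b))"
    using insert by (subst M.finsum_insert) auto
  also have "\<dots> \<le> vnorm V (g b) + vnorm V (\<Oplus>b\<in>B. g b)"
    using insert by (intro vnorm_triangle M.finsum_closed) auto
  finally show ?case using insert by force
qed simp

end

section \<open>Unconditional bases and truncated traces\<close>

text \<open>
  A Banach space with a basis \<open>bas\<close> of unconditional constant 1, given by its coordinate
  functionals. The operators \<open>cut S\<close> are the coordinate projections. The finite sets \<open>I k\<close>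
  exhaust the index set, and the projections onto them converge strongly to the identity.
\<close>

locale unconditional_basis = banach_cspace V for V :: "'a nspace" (structure) +
  fixes coord :: "'i \<Rightarrow> 'a \<Rightarrow> complex" and bas :: "'i \<Rightarrow> 'a"
    and cut :: "'i set \<Rightarrow> 'a \<Rightarrow> 'a" and I :: "nat \<Rightarrow> 'i set"
  assumes coord_eqI: "\<lbrakk>x \<in> carrier V; y \<in> carrier V; \<And>i. coord i x = coord i y\<rbrakk> \<Longrightarrow> x = y"
    and coord_add: "\<lbrakk>x \<in> carrier V; y \<in> carrier V\<rbrakk> \<Longrightarrow> coord i (x \<oplus> y) = coord i x + coord i y"
    and coord_smult: "x \<in> carrier V \<Longrightarrow> coord i (c \<odot> x) = c * coord i x"
    and coord_le: "x \<in> carrier V \<Longrightarrow> cmod (coord i x) \<le> vnorm V x"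
    and bas_in [simp]: "bas i \<in> carrier V"
    and coord_bas: "coord j (bas i) = (if j = i then 1 else 0)"
    and vnorm_bas: "vnorm V (bas i) \<le> 1"
    and cut_in [simp]: "x \<in> carrier V \<Longrightarrow> cut S x \<in> carrier V"
    and coord_cut: "x \<in> carrier V \<Longrightarrow> coord i (cut S x) = (if i \<in> S then coord i x else 0)"
    and vnorm_cut: "x \<in> carrier V \<Longrightarrow> vnorm V (cut S x) \<le> vnorm V x"
    and finite_I: "finite (I k)" and I_mono: "k \<le> l \<Longrightarrow> I k \<subseteq> I l" and I_cover: "\<exists>k. i \<in> I k"
    and cut_tail: "x \<in> carrier V \<Longrightarrow> (\<lambda>k. vnorm V (cut (- I k) x)) \<longlonglongrightarrow> 0"
begin

sublocale normed_pair V V by unfold_locales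

lemma coord_zero [simp]: "coord i \<zero> = 0"
  using coord_smult[of "\<zero>" i 0] by simp

lemma coord_minus: "x \<in> carrier V \<Longrightarrow> y \<in> carrier V \<Longrightarrow> coord i (x \<ominus> y) = coord i x - coord i y"
  by (simp add: a_minus_eq coord_add coord_smult)

lemma coord_finsum:
  "finite B \<Longrightarrow> (\<And>b. b \<in> B \<Longrightarrow> g b \<in> carrier V) \<Longrightarrow> coord i (\<Oplus>b\<in>B. g b) = (\<Sum>b\<in>B. coord i (g b))"
  by (rule clinear_functional_finsum) (auto simp: coord_add)

lemma cut_add: "x \<in> carrier V \<Longrightarrow> y \<in> carrier V \<Longrightarrow> cut S (x \<oplus> y) = cut S x \<oplus> cut S y"
  by (rule coord_eqI) (auto simp: coord_cut coord_add)

lemma cut_smult: "x \<in> carrier V \<Longrightarrow> cut S (c \<odot> x) = c \<odot> cut S x"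
  by (rule coord_eqI) (auto simp: coord_cut coord_smult)

lemma cut_compl: "x \<in> carrier V \<Longrightarrow> x \<ominus> cut S x = cut (- S) x"
  by (rule coord_eqI) (auto simp: coord_cut coord_minus)

lemma cut_decomp: "x \<in> carrier V \<Longrightarrow> cut S x \<oplus> cut (- S) x = x"
  by (rule coord_eqI) (auto simp: coord_cut coord_add)

text \<open>
  Bounded operators that are not required to be extensional, so that they can be composed as
  functions, together with a bound for their norm.
\<close>

definition bounded_by :: "real \<Rightarrow> ('a \<Rightarrow> 'a) \<Rightarrow> bool" where
  "bounded_by K b \<longleftrightarrow> clinear_map V V b \<and> K \<ge> 0 \<and> (\<forall>x\<in>carrier V. vnorm V (b x) \<le> K * vnorm V x)"

lemma bounded_byI:
  assumes "K \<ge> 0" "\<And>x. x \<in> carrier V \<Longrightarrow> b x \<in> carrier V"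
    and "\<And>x y. x \<in> carrier V \<Longrightarrow> y \<in> carrier V \<Longrightarrow> b (x \<oplus> y) = b x \<oplus> b y"
    and "\<And>c x. x \<in> carrier V \<Longrightarrow> b (c \<odot> x) = c \<odot> b x"
    and "\<And>x. x \<in> carrier V \<Longrightarrow> vnorm V (b x) \<le> K * vnorm V x"
  shows "bounded_by K b"
  using assms by (auto simp: bounded_by_def intro!: clinear_mapI)

lemma bounded_byD:
  assumes "bounded_by K b"
  shows "K \<ge> 0" "x \<in> carrier V \<Longrightarrow> b x \<in> carrier V"
    and "x \<in> carrier V \<Longrightarrow> y \<in> carrier V \<Longrightarrow> b (x \<oplus> y) = b x \<oplus> b y"
    and "x \<in> carrier V \<Longrightarrow> b (c \<odot> x) = c \<odot> b x"
    and "x \<in> carrier V \<Longrightarrow> vnorm V (b x) \<le> K * vnorm V x"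
  using assms by (auto simp: bounded_by_def clinear_map_def)

lemma bounded_by_zero: "bounded_by K b \<Longrightarrow> b \<zero> = \<zero>"
  by (auto simp: bounded_by_def intro: clinear_zero)

lemma bounded_by_minus: "bounded_by K b \<Longrightarrow> x \<in> carrier V \<Longrightarrow> y \<in> carrier V \<Longrightarrow> b (x \<ominus> y) = b x \<ominus> b y"
  by (simp add: a_minus_eq bounded_byD)

lemma bounded_by_id: "bounded_by 1 (\<lambda>x. x)"
  by (rule bounded_byI) auto

lemma bounded_by_cut: "bounded_by 1 (cut S)"
  by (rule bounded_byI) (auto simp: cut_add cut_smult vnorm_cut)

lemma bounded_by_L: "a \<in> carrier L \<Longrightarrow> bounded_by (vnorm L a) a"
  by (rule bounded_byI) (auto simp: vnorm_L_nonneg L_add L_smult L_bound)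

lemma bounded_by_comp: "bounded_by K b \<Longrightarrow> bounded_by M c \<Longrightarrow> bounded_by (K * M) (\<lambda>x. b (c x))"
proof (rule bounded_byI)
  assume b: "bounded_by K b" and c: "bounded_by M c"
  fix x assume x: "x \<in> carrier V"
  have "vnorm V (b (c x)) \<le> K * vnorm V (c x)" using x bounded_byD[OF b] bounded_byD[OF c] by auto
  also have "\<dots> \<le> K * (M * vnorm V x)" using x bounded_byD[OF b] bounded_byD[OF c] by (intro mult_left_mono) auto
  finally show "vnorm V (b (c x)) \<le> K * M * vnorm V x" by (simp add: mult.assoc)
qed (auto simp: bounded_byD)

lemma L_of_bounded_by: "bounded_by K b \<Longrightarrow> restrict b (carrier V) \<in> carrier L"
  by (rule L_I[where K = K]) (auto simp: bounded_byD intro!: clinear_mapI)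

lemma vnorm_L_of_bounded_by: "bounded_by K b \<Longrightarrow> vnorm L (restrict b (carrier V)) \<le> K"
  by (rule vnorm_L_le) (auto simp: bounded_byD)

lemma coord_bounded_by_cut:
  assumes "bounded_by K b" "finite J" and x: "x \<in> carrier V"
  shows "coord i (b (cut J x)) = (\<Sum>j\<in>J. coord j x * coord i (b (bas j)))"
  using \<open>finite J\<close>
proof (induction J rule: finite_induct)
  case empty
  have "cut {} x = \<zero>" by (rule coord_eqI) (auto simp: coord_cut x)
  then show ?case using bounded_by_zero[OF assms(1)] by simp
next
  case (insert j J)
  have "cut (insert j J) x = (coord j x \<odot> bas j) \<oplus> cut J x"
    using insert by (intro coord_eqI) (auto simp: coord_cut x coord_add coord_smult coord_bas)
  then show ?case using insert x bounded_byD[OF assms(1)] by (simp add: coord_add coord_smult)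
qed

lemma coord_tendsto:
  assumes b: "bounded_by K b" and x: "x \<in> carrier V"
  shows "(\<lambda>k. coord i (b (cut (I k) x))) \<longlonglongrightarrow> coord i (b x)"
proof -
  have "(\<lambda>k. K * vnorm V (cut (- I k) x)) \<longlonglongrightarrow> 0"
    using tendsto_mult_right_zero[OF cut_tail[OF x]] .
  moreover have "norm (coord i (b (cut (I k) x)) - coord i (b x)) \<le> K * vnorm V (cut (- I k) x)" for k
  proof -
    have "coord i (b x) - coord i (b (cut (I k) x)) = coord i (b (x \<ominus> cut (I k) x))"
      using x bounded_byD[OF b] by (simp add: coord_minus bounded_by_minus[OF b])
    also have "x \<ominus> cut (I k) x = cut (- I k) x" by (rule cut_compl[OF x])
    finally have "norm (coord i (b (cut (I k) x)) - coord i (b x)) = cmod (coord i (b (cut (- I k) x)))"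
      by (metis norm_minus_commute)
    also have "\<dots> \<le> vnorm V (b (cut (- I k) x))" using x bounded_byD[OF b] by (intro coord_le) auto
    also have "\<dots> \<le> K * vnorm V (cut (- I k) x)" using x bounded_byD[OF b] by auto
    finally show ?thesis .
  qed
  ultimately have "(\<lambda>k. coord i (b (cut (I k) x)) - coord i (b x)) \<longlonglongrightarrow> 0"
    by (rule Lim_null_comparison[OF always_eventually[OF allI], rotated])
  then show ?thesis by (rule LIM_zero_cancel)
qed

text \<open>
  The trace of an operator followed by the projection onto the coordinates in \<open>I k\<close>.
\<close>

definition trunc_trace :: "nat \<Rightarrow> ('a \<Rightarrow> 'a) \<Rightarrow> complex" where
  "trunc_trace k b = (\<Sum>i\<in>I k. coord i (b (bas i)))"

lemma trunc_trace_cong: "(\<And>x. x \<in> carrier V \<Longrightarrow> b x = c x) \<Longrightarrow> trunc_trace k b = trunc_trace k c"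
  by (simp add: trunc_trace_def)

lemma trunc_trace_add: "(\<And>x. x \<in> carrier V \<Longrightarrow> b x \<in> carrier V) \<Longrightarrow> (\<And>x. x \<in> carrier V \<Longrightarrow> c x \<in> carrier V) \<Longrightarrow>
  trunc_trace k (\<lambda>x. b x \<oplus> c x) = trunc_trace k b + trunc_trace k c"
  by (simp add: trunc_trace_def coord_add sum.distrib)

lemma trunc_trace_minus: "(\<And>x. x \<in> carrier V \<Longrightarrow> b x \<in> carrier V) \<Longrightarrow> (\<And>x. x \<in> carrier V \<Longrightarrow> c x \<in> carrier V) \<Longrightarrow>
  trunc_trace k (\<lambda>x. b x \<ominus> c x) = trunc_trace k b - trunc_trace k c"
  by (simp add: trunc_trace_def coord_minus sum_subtractf)

lemma trunc_trace_smult: "(\<And>x. x \<in> carrier V \<Longrightarrow> b x \<in> carrier V) \<Longrightarrow> trunc_trace k (\<lambda>x. s \<odot> b x) = s * trunc_trace k b"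
  by (simp add: trunc_trace_def coord_smult sum_distrib_left)

lemma trunc_trace_le: "bounded_by K b \<Longrightarrow> cmod (trunc_trace k b) \<le> real (card (I k)) * K"
proof -
  assume b: "bounded_by K b"
  have "cmod (coord i (b (bas i))) \<le> K" for i
  proof -
    have "cmod (coord i (b (bas i))) \<le> vnorm V (b (bas i))" using bounded_byD[OF b] by (intro coord_le) auto
    also have "\<dots> \<le> K * vnorm V (bas i)" using bounded_byD[OF b] by auto
    also have "\<dots> \<le> K * 1" using bounded_byD(1)[OF b] vnorm_bas[of i] by (intro mult_left_mono)
    finally show ?thesis by simp
  qed
  then have "cmod (trunc_trace k b) \<le> (\<Sum>i\<in>I k. K)" unfolding trunc_trace_def by (intro sum_norm_le)
  then show ?thesis by simp
qed

lemma trunc_trace_cut: "bounded_by K b \<Longrightarrow> k \<ge> l \<Longrightarrow> trunc_trace k (\<lambda>x. cut (I l) (b x)) = trunc_trace l b"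
  unfolding trunc_trace_def using I_mono[of l k] finite_I[of k]
  by (intro sum.mono_neutral_cong_right) (auto simp: coord_cut bounded_byD)

text \<open>
  A replacement for the trace property. One factor contains a projection of finite rank; the double
  sum over coordinates is exchanged and the basis expansion of \<open>a (bas i)\<close> is summed up.
\<close>

lemma trunc_trace_commute:
  assumes a: "bounded_by K a" and b: "bounded_by M b"
  shows "(\<lambda>l. trunc_trace l (\<lambda>x. a (cut (I k) (b x)))) \<longlonglongrightarrow> trunc_trace k (\<lambda>x. b (a x))"
proof -
  have "trunc_trace l (\<lambda>x. a (cut (I k) (b x))) = (\<Sum>i\<in>I k. coord i (b (cut (I l) (a (bas i)))))" for l
  proof -
    have "trunc_trace l (\<lambda>x. a (cut (I k) (b x))) = (\<Sum>j\<in>I l. \<Sum>i\<in>I k. coord i (b (bas j)) * coord j (a (bas i)))"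
      unfolding trunc_trace_def by (intro sum.cong refl coord_bounded_by_cut[OF a finite_I]) (auto simp: bounded_byD[OF b])
    also have "\<dots> = (\<Sum>i\<in>I k. \<Sum>j\<in>I l. coord j (a (bas i)) * coord i (b (bas j)))"
      by (subst sum.swap) (simp add: mult.commute)
    also have "\<dots> = (\<Sum>i\<in>I k. coord i (b (cut (I l) (a (bas i)))))"
      by (intro sum.cong refl coord_bounded_by_cut[OF b finite_I, symmetric]) (auto simp: bounded_byD[OF a])
    finally show ?thesis .
  qed
  moreover have "(\<lambda>l. \<Sum>i\<in>I k. coord i (b (cut (I l) (a (bas i))))) \<longlonglongrightarrow> (\<Sum>i\<in>I k. coord i (b (a (bas i))))"
    by (intro tendsto_sum coord_tendsto[OF b]) (auto simp: bounded_byD[OF a])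
  ultimately show ?thesis by (simp add: trunc_trace_def)
qed

definition tail :: "nat \<Rightarrow> ('a \<Rightarrow> 'a) \<Rightarrow> ('a \<Rightarrow> 'a)" where
  "tail k a = (\<lambda>x\<in>carrier V. cut (- I k) (a x))"

lemma tail_L [simp]: "a \<in> carrier L \<Longrightarrow> tail k a \<in> carrier L"
  unfolding tail_def using L_of_bounded_by[OF bounded_by_comp[OF bounded_by_cut bounded_by_L]] .

lemma vnorm_tail_le: "a \<in> carrier L \<Longrightarrow> vnorm L (tail k a) \<le> vnorm L a"
  unfolding tail_def using vnorm_L_of_bounded_by[OF bounded_by_comp[OF bounded_by_cut bounded_by_L]] by simp

lemma tail_add: "a \<in> carrier L \<Longrightarrow> b \<in> carrier L \<Longrightarrow> tail k (a \<oplus>\<^bsub>L\<^esub> b) = tail k a \<oplus>\<^bsub>L\<^esub> tail k b"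
  by (auto simp: tail_def cut_add)

lemma tail_smult: "a \<in> carrier L \<Longrightarrow> tail k (c \<odot>\<^bsub>L\<^esub> a) = c \<odot>\<^bsub>L\<^esub> tail k a"
  by (auto simp: tail_def cut_smult)

lemma tail_minus: "a \<in> carrier L \<Longrightarrow> b \<in> carrier L \<Longrightarrow> tail k (a \<ominus>\<^bsub>L\<^esub> b) = tail k a \<ominus>\<^bsub>L\<^esub> tail k b"
  by (simp add: L.a_minus_eq tail_add tail_smult del: operator_space_simps)

end

section \<open>Approximable operators\<close>

context unconditional_basis
begin

text \<open>
  Gaussian elimination: in the span of finitely many vectors, finitely many coordinates determine all
  the others linearly. Coordinates are bounded functionals, and so this presents an operator with values in the
  span as a finite sum of bounded functionals times vectors. The induction step adds a vector
  \<open>b\<close>. If the given formula fails for \<open>b\<close>, there is a coordinate \<open>i0\<close> where the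
  error \<open>r\<close> of the formula does not vanish, and this coordinate measures the multiple of
  \<open>b\<close>.
\<close>

lemma span_coordinates:
  assumes "finite B" "B \<subseteq> carrier V"
  shows "\<exists>J v. finite J \<and> (\<forall>j. v j \<in> carrier V) \<and>
    (\<forall>c i. coord i (\<Oplus>b\<in>B. c b \<odot> b) = (\<Sum>j\<in>J. coord j (\<Oplus>b\<in>B. c b \<odot> b) * coord i (v j)))"
  using assms
proof (induction B rule: finite_induct)
  case empty
  then show ?case by (intro exI[of _ "{}"] exI[of _ "\<lambda>_. \<zero>"]) auto
next
  case (insert b B)
  then have "B \<subseteq> carrier V" by auto
  from insert.IH[OF this] obtain J v where Jv: "finite J \<and> (\<forall>j. v j \<in> carrier V) \<and>
    (\<forall>c i. coord i (\<Oplus>b\<in>B. c b \<odot> b) = (\<Sum>j\<in>J. coord j (\<Oplus>b\<in>B. c b \<odot> b) * coord i (v j)))"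
    by (elim exE)
  then have J: "finite J" and v: "\<And>j. v j \<in> carrier V"
    and rep: "\<And>c i. coord i (\<Oplus>b\<in>B. c b \<odot> b) = (\<Sum>j\<in>J. coord j (\<Oplus>b\<in>B. c b \<odot> b) * coord i (v j))"
    by blast+
  have b: "b \<in> carrier V" using insert by auto
  define r where "r i = coord i b - (\<Sum>j\<in>J. coord j b * coord i (v j))" for i
  define b' where "b' = b \<ominus> (\<Oplus>j\<in>J. coord j b \<odot> v j)"
  have b': "b' \<in> carrier V" "coord i b' = r i" for i
    using b v J by (auto simp: b'_def r_def coord_minus coord_finsum coord_smult)
  have y: "coord i (\<Oplus>b\<in>insert b B. c b \<odot> b) - (\<Sum>j\<in>J. coord j (\<Oplus>b\<in>insert b B. c b \<odot> b) * coord i (v j)) = c b * r i" for c i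
  proof -
    have e: "(\<Oplus>b\<in>insert b B. c b \<odot> b) = c b \<odot> b \<oplus> (\<Oplus>b\<in>B. c b \<odot> b)"
      using insert by (subst M.finsum_insert) auto
    have "coord i (\<Oplus>b\<in>insert b B. c b \<odot> b) = c b * coord i b + coord i (\<Oplus>b\<in>B. c b \<odot> b)" for i
      using insert b by (subst e, subst coord_add) (auto simp: coord_smult intro!: M.finsum_closed)
    then show ?thesis
      using rep[of i c] by (simp add: r_def algebra_simps sum.distrib sum_distrib_left)
  qed
  show ?case
  proof (cases "\<forall>i. r i = 0")
    case True
    show ?thesis
    proof (rule exI[of _ J], rule exI[of _ v], intro conjI allI)
      show "coord i (\<Oplus>b\<in>insert b B. c b \<odot> b) = (\<Sum>j\<in>J. coord j (\<Oplus>b\<in>insert b B. c b \<odot> b) * coord i (v j))" for c i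
        using y[of i c] True by simp
    qed (use J v in auto)
  next
    case False
    then obtain i0 where i0: "r i0 \<noteq> 0" by auto
    \<comment> \<open>the new formula corrects the old one by its error at \<open>i0\<close>\<close>
    define w where "w j = (if j \<in> J then v j \<oplus> (- coord i0 (v j) / r i0) \<odot> b' else \<zero>) \<oplus> (if j = i0 then (1 / r i0) \<odot> b' else \<zero>)" for j
    have w: "w j \<in> carrier V" for j using v b' by (auto simp: w_def)
    have cw: "coord i (w j) = (if j \<in> J then coord i (v j) - coord i0 (v j) / r i0 * r i else 0) + (if j = i0 then r i / r i0 else 0)" for i j
      using v b' by (auto simp: w_def coord_add coord_smult)
    show ?thesis
    proof (rule exI[of _ "insert i0 J"], rule exI[of _ w], intro conjI allI)
      show "finite (insert i0 J)" using J by simp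
      show "w j \<in> carrier V" for j by (rule w)
      fix c i
      let ?y = "\<Oplus>b\<in>insert b B. c b \<odot> b"
      have "(\<Sum>j\<in>insert i0 J. coord j ?y * coord i (w j))
         = (\<Sum>j\<in>insert i0 J. coord j ?y * (if j \<in> J then coord i (v j) - coord i0 (v j) / r i0 * r i else 0))
           + (\<Sum>j\<in>insert i0 J. coord j ?y * (if j = i0 then r i / r i0 else 0))"
        by (simp only: cw distrib_left sum.distrib)
      also have "(\<Sum>j\<in>insert i0 J. coord j ?y * (if j = i0 then r i / r i0 else 0)) = coord i0 ?y * (r i / r i0)"
        using J by (simp add: if_distrib cong: if_cong)
      also have "(\<Sum>j\<in>insert i0 J. coord j ?y * (if j \<in> J then coord i (v j) - coord i0 (v j) / r i0 * r i else 0))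
         = (\<Sum>j\<in>J. coord j ?y * (coord i (v j) - coord i0 (v j) / r i0 * r i))"
        using J by (intro sum.mono_neutral_cong_right) auto
      also have "\<dots> = (\<Sum>j\<in>J. coord j ?y * coord i (v j)) - (\<Sum>j\<in>J. coord j ?y * coord i0 (v j)) * (r i / r i0)"
        by (simp add: right_diff_distrib sum_subtractf sum_distrib_right sum_divide_distrib mult.assoc)
      also have "\<dots> = (coord i ?y - c b * r i) - (coord i0 ?y - c b * r i0) * (r i / r i0)"
        using y[of i c] y[of i0 c] by (simp add: algebra_simps)
      also have "\<dots> + coord i0 ?y * (r i / r i0) = coord i ?y"
        using i0 by (simp add: field_simps)
      finally show "coord i ?y = (\<Sum>j\<in>insert i0 J. coord j ?y * coord i (w j))" by simp
    qed
  qed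
qed

text \<open>
  By \<open>span_coordinates\<close> the rank is finite in the sense of bounded functionals, and strong
  convergence on finitely many vectors suffices.
\<close>

lemma finite_rank_tail:
  assumes f: "f \<in> carrier L" "finite_rank V f"
  shows "(\<lambda>k. vnorm L (tail k f)) \<longlonglongrightarrow> 0"
proof -
  obtain B where B: "finite B" "B \<subseteq> carrier V" "\<And>x. x \<in> carrier V \<Longrightarrow> \<exists>c. f x = (\<Oplus>b\<in>B. c b \<odot> b)"
    using f(2) by (auto simp: finite_rank_def)
  from span_coordinates[OF B(1,2)] obtain J v where Jv: "finite J \<and> (\<forall>j. v j \<in> carrier V) \<and>
    (\<forall>c i. coord i (\<Oplus>b\<in>B. c b \<odot> b) = (\<Sum>j\<in>J. coord j (\<Oplus>b\<in>B. c b \<odot> b) * coord i (v j)))"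
    by (elim exE)
  then have J: "finite J" and v: "\<And>j. v j \<in> carrier V"
    and rep: "\<And>c i. coord i (\<Oplus>b\<in>B. c b \<odot> b) = (\<Sum>j\<in>J. coord j (\<Oplus>b\<in>B. c b \<odot> b) * coord i (v j))"
    by blast+
  have cf: "coord i (f x) = (\<Sum>j\<in>J. coord j (f x) * coord i (v j))" if x: "x \<in> carrier V" for i x
  proof -
    obtain c where c: "f x = (\<Oplus>b\<in>B. c b \<odot> b)" using B(3)[OF x] by (rule exE)
    show ?thesis unfolding c by (rule rep)
  qed
  have le: "vnorm L (tail k f) \<le> vnorm L f * (\<Sum>j\<in>J. vnorm V (cut (- I k) (v j)))" for k
  proof (rule vnorm_L_le)
    show "0 \<le> vnorm L f * (\<Sum>j\<in>J. vnorm V (cut (- I k) (v j)))"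
      using f v by (intro mult_nonneg_nonneg sum_nonneg) auto
    fix x assume x: "x \<in> carrier V"
    have fx: "f x \<in> carrier V" using f x by simp
    have "cut (- I k) (f x) = (\<Oplus>j\<in>J. coord j (f x) \<odot> cut (- I k) (v j))"
      using J v fx by (intro coord_eqI M.finsum_closed) (auto simp: coord_cut coord_finsum coord_smult cf[OF x, symmetric])
    then have "vnorm V (tail k f x) \<le> (\<Sum>j\<in>J. vnorm V (coord j (f x) \<odot> cut (- I k) (v j)))"
      using x J v by (simp add: tail_def vnorm_finsum_le)
    also have "\<dots> = (\<Sum>j\<in>J. cmod (coord j (f x)) * vnorm V (cut (- I k) (v j)))"
      using v by (simp add: vnorm_smult)
    also have "\<dots> \<le> (\<Sum>j\<in>J. (vnorm L f * vnorm V x) * vnorm V (cut (- I k) (v j)))"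
      using v by (intro sum_mono mult_right_mono order_trans[OF coord_le[OF fx] L_bound[OF f(1) x]]) auto
    finally show "vnorm V (tail k f x) \<le> vnorm L f * (\<Sum>j\<in>J. vnorm V (cut (- I k) (v j))) * vnorm V x"
      by (simp add: sum_distrib_left[symmetric] mult_ac)
  qed
  have "(\<lambda>k. vnorm L f * (\<Sum>j\<in>J. vnorm V (cut (- I k) (v j)))) \<longlonglongrightarrow> vnorm L f * (\<Sum>j\<in>J. 0)"
    by (intro tendsto_mult tendsto_const tendsto_sum cut_tail v)
  then have lim: "(\<lambda>k. vnorm L f * (\<Sum>j\<in>J. vnorm V (cut (- I k) (v j)))) \<longlonglongrightarrow> 0" by simp
  show ?thesis
  proof (rule tendsto_sandwich[OF _ _ tendsto_const lim])
    show "\<forall>\<^sub>F k in sequentially. 0 \<le> vnorm L (tail k f)"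
      using vnorm_L_nonneg[OF tail_L[OF f(1)]] by simp
    show "\<forall>\<^sub>F k in sequentially. vnorm L (tail k f) \<le> vnorm L f * (\<Sum>j\<in>J. vnorm V (cut (- I k) (v j)))"
      using le by simp
  qed
qed

lemma finite_rank_head:
  assumes a: "a \<in> carrier L"
  shows "finite_rank V (\<lambda>x\<in>carrier V. cut (I k) (a x))"
  unfolding finite_rank_def
proof (intro exI[of _ "bas ` I k"] conjI ballI)
  fix x assume x: "x \<in> carrier V"
  have inj: "inj_on bas (I k)"
    by (rule inj_onI) (metis coord_bas zero_neq_one)
  have "cut (I k) (a x) = (\<Oplus>b\<in>bas ` I k. coord (inv_into (I k) bas b) (a x) \<odot> b)"
  proof (rule coord_eqI)
    fix i
    have "coord i (\<Oplus>b\<in>bas ` I k. coord (inv_into (I k) bas b) (a x) \<odot> b) = (\<Sum>b\<in>bas ` I k. coord i (coord (inv_into (I k) bas b) (a x) \<odot> b))"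
      using finite_I by (intro coord_finsum) auto
    also have "\<dots> = (\<Sum>j\<in>I k. coord i (coord j (a x) \<odot> bas j))"
      using inj by (simp add: sum.reindex)
    also have "\<dots> = (\<Sum>j\<in>I k. if j = i then coord j (a x) else 0)"
      by (intro sum.cong) (auto simp: coord_smult coord_bas)
    also have "\<dots> = coord i (cut (I k) (a x))"
      using finite_I[of k] a x by (simp add: coord_cut)
    finally show "coord i (cut (I k) (a x)) = coord i (\<Oplus>b\<in>bas ` I k. coord (inv_into (I k) bas b) (a x) \<odot> b)" by simp
  qed (use a x in \<open>auto intro!: M.finsum_closed\<close>)
  then show "\<exists>c. (\<lambda>x\<in>carrier V. cut (I k) (a x)) x = (\<Oplus>b\<in>bas ` I k. c b \<odot> b)"
    using x by (intro exI[of _ "\<lambda>b. coord (inv_into (I k) bas b) (a x)"]) simp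
qed (auto simp: finite_I)

abbreviation "A \<equiv> approximable_algebra V"

lemma operator_algebra_simps [simp]:
  "carrier (operator_algebra V) = carrier L" "add (operator_algebra V) = add L" "zero (operator_algebra V) = zero L"
  "Module.smult (operator_algebra V) = Module.smult L" "vnorm (operator_algebra V) = vnorm L"
  by (simp_all add: operator_algebra_def operator_space_def)

lemma A_simps [simp]:
  "add A = add L" "zero A = zero L" "Module.smult A = Module.smult L" "vnorm A = vnorm L" "mult A = compose (carrier V)"
  by (simp_all add: approximable_algebra_def) (simp_all add: operator_algebra_def)

text \<open>
  Sums, products and norm limits inherit this description at once, whereas combinations of operators of
  finite rank are awkward. Truncated operators have finite rank. Conversely, truncations do not increase
  norms, so that \<open>finite_rank_tail\<close> extends to norm limits.
\<close>

lemma carrier_A: "a \<in> carrier A \<longleftrightarrow> a \<in> carrier L \<and> (\<lambda>k. vnorm L (tail k a)) \<longlonglongrightarrow> 0"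
proof -
  interpret OA: normed_cspace "operator_algebra V"
    by (rule normed_cspace_subspace[OF normed_cspace_L])
       (auto simp: L_add_closed L_smult_closed L_zero_closed L_norm_smult L_norm_add L.vnorm_eq_0_iff simp del: operator_space_simps)
  have minus: "a \<ominus>\<^bsub>operator_algebra V\<^esub> f = a \<ominus>\<^bsub>L\<^esub> f" if "a \<in> carrier L" "f \<in> carrier L" for a f
    using that by (simp add: OA.a_minus_eq L.a_minus_eq del: operator_space_simps)
  have cl: "a \<in> carrier A \<longleftrightarrow> a \<in> carrier L \<and> (\<forall>e>0. \<exists>f. f \<in> carrier L \<and> finite_rank V f \<and> vnorm L (a \<ominus>\<^bsub>L\<^esub> f) < e)" for a
  proof -
    have "carrier A = norm_topology (operator_algebra V) closure_of {f \<in> carrier L. finite_rank V f}"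
      by (simp add: approximable_algebra_def)
    moreover have "{f \<in> carrier L. finite_rank V f} \<subseteq> carrier (operator_algebra V)" by simp
    ultimately have "a \<in> carrier A \<longleftrightarrow> a \<in> carrier L \<and> (\<forall>e>0. \<exists>f\<in>{f \<in> carrier L. finite_rank V f}. vnorm L (a \<ominus>\<^bsub>operator_algebra V\<^esub> f) < e)"
      using OA.closure_of_iff by (simp only: operator_algebra_simps)
    then show ?thesis using minus by (simp cong: conj_cong)
  qed
  show ?thesis
  proof (intro iffI conjI)
    assume a: "a \<in> carrier A"
    show aL: "a \<in> carrier L" using a cl by auto
    show "(\<lambda>k. vnorm L (tail k a)) \<longlonglongrightarrow> 0"
    proof (rule LIMSEQ_I)
      fix e :: real assume e: "0 < e"
      then obtain f where f: "f \<in> carrier L" "finite_rank V f" "vnorm L (a \<ominus>\<^bsub>L\<^esub> f) < e/2"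
        using a cl half_gt_zero by metis
      obtain N where N': "\<forall>k\<ge>N. norm (vnorm L (tail k f) - 0) < e/2"
        using LIMSEQ_D[OF finite_rank_tail[OF f(1,2)] half_gt_zero[OF e]] by (rule exE)
      then have N: "vnorm L (tail k f) < e/2" if "k \<ge> N" for k
        using that by (auto simp: abs_less_iff)
      have "vnorm L (tail k a) < e" if "k \<ge> N" for k
      proof -
        have "vnorm L (tail k a) \<le> vnorm L (tail k f) + vnorm L (tail k (a \<ominus>\<^bsub>L\<^esub> f))"
          using aL f by (simp add: tail_minus L.vnorm_le_add_minus)
        also have "\<dots> < e/2 + e/2"
          using N[OF that] vnorm_tail_le[of "a \<ominus>\<^bsub>L\<^esub> f" k] aL f by (intro add_strict_mono) auto
        finally show ?thesis by simp
      qed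
      then show "\<exists>N. \<forall>k\<ge>N. norm (vnorm L (tail k a) - 0) < e"
        using aL by (intro exI[of _ N]) (auto simp: vnorm_L_nonneg)
    qed
  next
    assume a: "a \<in> carrier L \<and> (\<lambda>k. vnorm L (tail k a)) \<longlonglongrightarrow> 0"
    show "a \<in> carrier A"
      unfolding cl
    proof (intro conjI allI impI)
      fix e :: real assume "0 < e"
      then obtain k where "norm (vnorm L (tail k a) - 0) < e"
        using LIMSEQ_D[OF conjunct2[OF a]] by blast
      then have k: "vnorm L (tail k a) < e" by (simp add: abs_less_iff)
      let ?f = "\<lambda>x\<in>carrier V. cut (I k) (a x)"
      have f: "?f \<in> carrier L" using a L_of_bounded_by[OF bounded_by_comp[OF bounded_by_cut bounded_by_L]] by auto
      have "a \<ominus>\<^bsub>L\<^esub> ?f = tail k a"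
      proof (rule L_ext)
        fix x assume "x \<in> carrier V"
        then show "(a \<ominus>\<^bsub>L\<^esub> ?f) x = tail k a x"
          using conjunct1[OF a] f by (simp add: L_minus tail_def cut_compl)
      qed (use a f in \<open>simp_all del: operator_space_simps\<close>)
      then show "\<exists>f. f \<in> carrier L \<and> finite_rank V f \<and> vnorm L (a \<ominus>\<^bsub>L\<^esub> f) < e"
        using k f finite_rank_head[OF conjunct1[OF a], of k] by (intro exI[of _ ?f]) (simp del: operator_space_simps)
    qed (use a in auto)
  qed
qed

end

section \<open>Operators tested against doubly factored contractions\<close>

text \<open>
  The set \<open>P\<close> of indices splits the space into two complementary summands, the ranges of
  \<open>cut P\<close> and \<open>cut (- P)\<close>.
\<close>

locale split_basis = unconditional_basis V coord bas cut I
  for V :: "'a nspace" (structure) and coord :: "'i \<Rightarrow> 'a \<Rightarrow> complex" and bas cut I +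
  fixes P :: "'i set"
begin

text \<open>
  Products of contractions that pass through one of the two summands and after that through the
  other. The outer contractions are arbitrary, which makes the set invariant under multiplication by
  contractions from both sides.
\<close>

definition factored :: "('a \<Rightarrow> 'a) set" where
  "factored = {w. \<exists>S c1 c2 c3. (S = P \<or> S = - P) \<and> bounded_by 1 c1 \<and> bounded_by 1 c2 \<and> bounded_by 1 c3 \<and>
     w = (\<lambda>x. c1 (cut S (c2 (cut (- S) (c3 x)))))}"

lemma factored_bounded_by: "w \<in> factored \<Longrightarrow> bounded_by 1 w"
proof -
  assume "w \<in> factored"
  then obtain S c1 c2 c3 where c: "bounded_by 1 c1" "bounded_by 1 c2" "bounded_by 1 c3" and w: "w = (\<lambda>x. c1 (cut S (c2 (cut (- S) (c3 x)))))"
    by (auto simp: factored_def)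
  show ?thesis unfolding w
    using bounded_by_comp[OF c(1) bounded_by_comp[OF bounded_by_cut bounded_by_comp[OF c(2) bounded_by_comp[OF bounded_by_cut c(3)]]]] by simp
qed

lemma factored_ex: "\<exists>w. w \<in> factored"
  unfolding factored_def using bounded_by_id by blast

definition factor_values :: "('a \<Rightarrow> 'a) \<Rightarrow> real set" where
  "factor_values z = {cmod (trunc_trace k (\<lambda>x. w (z x))) |k w. w \<in> factored}"

text \<open>
  The norm dual to the operators in \<open>factored\<close> under trace duality.
\<close>

definition factor_norm :: "('a \<Rightarrow> 'a) \<Rightarrow> real" where "factor_norm z = Sup (factor_values z)"

definition Zcarrier :: "('a \<Rightarrow> 'a) set" where "Zcarrier = {z \<in> carrier L. bdd_above (factor_values z)}"

lemma Zcarrier_L: "z \<in> Zcarrier \<Longrightarrow> z \<in> carrier L"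
  by (simp add: Zcarrier_def)

lemma factor_values_ne: "factor_values z \<noteq> {}"
  using factored_ex by (auto simp: factor_values_def)

lemma factor_norm_upper: "z \<in> Zcarrier \<Longrightarrow> w \<in> factored \<Longrightarrow> cmod (trunc_trace k (\<lambda>x. w (z x))) \<le> factor_norm z"
  unfolding factor_norm_def by (rule cSup_upper) (auto simp: factor_values_def Zcarrier_def)

lemma Zcarrier_I:
  assumes "z \<in> carrier L" "\<And>k w. w \<in> factored \<Longrightarrow> cmod (trunc_trace k (\<lambda>x. w (z x))) \<le> K"
  shows "z \<in> Zcarrier" "factor_norm z \<le> K"
proof -
  have "x \<le> K" if "x \<in> factor_values z" for x
    using that assms(2) by (auto simp: factor_values_def)
  then show "z \<in> Zcarrier" "factor_norm z \<le> K"
    using assms(1) factor_values_ne unfolding Zcarrier_def factor_norm_def by (auto intro!: bdd_aboveI cSup_least)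
qed

lemma factor_norm_nonneg: "z \<in> Zcarrier \<Longrightarrow> 0 \<le> factor_norm z"
  using factored_ex factor_norm_upper norm_ge_zero order_trans by metis

lemma trunc_trace_w_add:
  assumes "bounded_by M w" "z1 \<in> carrier L" "z2 \<in> carrier L"
  shows "trunc_trace k (\<lambda>x. w ((z1 \<oplus>\<^bsub>L\<^esub> z2) x)) = trunc_trace k (\<lambda>x. w (z1 x)) + trunc_trace k (\<lambda>x. w (z2 x))"
proof -
  have "trunc_trace k (\<lambda>x. w ((z1 \<oplus>\<^bsub>L\<^esub> z2) x)) = trunc_trace k (\<lambda>x. w (z1 x) \<oplus> w (z2 x))"
    using assms by (intro trunc_trace_cong) (simp add: bounded_byD)
  also have "\<dots> = trunc_trace k (\<lambda>x. w (z1 x)) + trunc_trace k (\<lambda>x. w (z2 x))"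
    using assms by (intro trunc_trace_add) (simp_all add: bounded_byD)
  finally show ?thesis .
qed

lemma trunc_trace_w_smult:
  assumes "bounded_by M w" "z \<in> carrier L"
  shows "trunc_trace k (\<lambda>x. w ((c \<odot>\<^bsub>L\<^esub> z) x)) = c * trunc_trace k (\<lambda>x. w (z x))"
proof -
  have "trunc_trace k (\<lambda>x. w ((c \<odot>\<^bsub>L\<^esub> z) x)) = trunc_trace k (\<lambda>x. c \<odot> w (z x))"
    using assms by (intro trunc_trace_cong) (simp add: bounded_byD)
  also have "\<dots> = c * trunc_trace k (\<lambda>x. w (z x))"
    using assms by (intro trunc_trace_smult) (simp_all add: bounded_byD)
  finally show ?thesis .
qed

lemma trunc_trace_w_minus:
  assumes "bounded_by M w" "z1 \<in> carrier L" "z2 \<in> carrier L"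
  shows "trunc_trace k (\<lambda>x. w ((z1 \<ominus>\<^bsub>L\<^esub> z2) x)) = trunc_trace k (\<lambda>x. w (z1 x)) - trunc_trace k (\<lambda>x. w (z2 x))"
  using assms trunc_trace_w_add[OF assms(1,2) L_smult_closed[OF assms(3)], of k "-1"] trunc_trace_w_smult[OF assms(1,3), of k "-1"]
  by (simp add: L.a_minus_eq del: operator_space_simps)

lemma bounded_by_normalize:
  assumes "bounded_by M c"
  shows "\<exists>c'. bounded_by 1 c' \<and> (\<forall>x\<in>carrier V. c x = complex_of_real M \<odot> c' x)"
proof (cases "M = 0")
  case True
  have 0: "vnorm V (c x) = 0" if "x \<in> carrier V" for x
    using bounded_byD(5)[OF assms that] bounded_byD(2)[OF assms that] True by (intro order_antisym) auto
  have "c x = \<zero>" if "x \<in> carrier V" for x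
    using 0[OF that] vnorm_eq_0_iff[OF bounded_byD(2)[OF assms that]] by simp
  then show ?thesis using True by (intro exI[of _ "\<lambda>_. \<zero>"]) (auto intro!: bounded_byI)
next
  case False
  then have M: "M > 0" using bounded_byD(1)[OF assms] by simp
  show ?thesis
  proof (intro exI[of _ "\<lambda>x. complex_of_real (1 / M) \<odot> c x"] conjI ballI)
    show "bounded_by 1 (\<lambda>x. complex_of_real (1 / M) \<odot> c x)"
    proof (rule bounded_byI)
      fix x assume x: "x \<in> carrier V"
      show "vnorm V (complex_of_real (1 / M) \<odot> c x) \<le> 1 * vnorm V x"
        using x M bounded_byD(2,5)[OF assms x] by (simp add: vnorm_smult norm_divide field_simps)
      show "complex_of_real (1 / M) \<odot> c (s \<odot> x) = s \<odot> (complex_of_real (1 / M) \<odot> c x)" for s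
        using x assms by (simp add: bounded_byD mult.commute flip: smult_times)
    qed (use assms in \<open>simp_all add: bounded_byD smult_distr_r\<close>)
    show "c x = complex_of_real M \<odot> (complex_of_real (1 / M) \<odot> c x)" if "x \<in> carrier V" for x
      using that M assms by (simp add: bounded_byD flip: smult_times)
  qed
qed

text \<open>
  Normalization of the three factors to contractions.
\<close>

lemma factor_norm_scaled:
  assumes z: "z \<in> Zcarrier" and S: "S = P \<or> S = - P" and c: "bounded_by M1 c1" "bounded_by M2 c2" "bounded_by M3 c3"
  shows "cmod (trunc_trace k (\<lambda>x. c1 (cut S (c2 (cut (- S) (c3 (z x))))))) \<le> M1 * M2 * M3 * factor_norm z"
proof -
  note zL = Zcarrier_L[OF z]
  obtain d1 where d1: "bounded_by 1 d1" "\<And>x. x \<in> carrier V \<Longrightarrow> c1 x = complex_of_real M1 \<odot> d1 x" using bounded_by_normalize[OF c(1)] by auto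
  obtain d2 where d2: "bounded_by 1 d2" "\<And>x. x \<in> carrier V \<Longrightarrow> c2 x = complex_of_real M2 \<odot> d2 x" using bounded_by_normalize[OF c(2)] by auto
  obtain d3 where d3: "bounded_by 1 d3" "\<And>x. x \<in> carrier V \<Longrightarrow> c3 x = complex_of_real M3 \<odot> d3 x" using bounded_by_normalize[OF c(3)] by auto
  define w where "w x = d1 (cut S (d2 (cut (- S) (d3 x))))" for x
  have w: "w \<in> factored" unfolding factored_def w_def using S d1(1) d2(1) d3(1) by blast
  note bw = factored_bounded_by[OF w]
  have "trunc_trace k (\<lambda>x. c1 (cut S (c2 (cut (- S) (c3 (z x)))))) = trunc_trace k (\<lambda>x. complex_of_real (M1 * M2 * M3) \<odot> w (z x))"
  proof (rule trunc_trace_cong)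
    fix x assume x: "x \<in> carrier V"
    then have zx: "z x \<in> carrier V" using zL by simp
    show "c1 (cut S (c2 (cut (- S) (c3 (z x))))) = complex_of_real (M1 * M2 * M3) \<odot> w (z x)"
      using zx by (simp add: d1(2) d2(2) d3(2) w_def bounded_byD[OF d1(1)] bounded_byD[OF d2(1)] bounded_byD[OF d3(1)] cut_smult mult_ac flip: smult_times)
  qed
  also have "\<dots> = complex_of_real (M1 * M2 * M3) * trunc_trace k (\<lambda>x. w (z x))"
    using zL by (intro trunc_trace_smult) (auto simp: bounded_byD[OF bw])
  also have "cmod \<dots> = (M1 * M2 * M3) * cmod (trunc_trace k (\<lambda>x. w (z x)))"
    using c by (simp add: norm_mult bounded_byD(1))
  also have "\<dots> \<le> (M1 * M2 * M3) * factor_norm z"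
    using c by (intro mult_left_mono factor_norm_upper[OF z w]) (simp add: bounded_byD(1))
  finally show ?thesis .
qed

lemma Zcarrier_add: "z1 \<in> Zcarrier \<Longrightarrow> z2 \<in> Zcarrier \<Longrightarrow> z1 \<oplus>\<^bsub>L\<^esub> z2 \<in> Zcarrier"
  and factor_norm_add: "z1 \<in> Zcarrier \<Longrightarrow> z2 \<in> Zcarrier \<Longrightarrow> factor_norm (z1 \<oplus>\<^bsub>L\<^esub> z2) \<le> factor_norm z1 + factor_norm z2"
proof -
  assume z: "z1 \<in> Zcarrier" "z2 \<in> Zcarrier"
  have "cmod (trunc_trace k (\<lambda>x. w ((z1 \<oplus>\<^bsub>L\<^esub> z2) x))) \<le> factor_norm z1 + factor_norm z2" if w: "w \<in> factored" for k w
    unfolding trunc_trace_w_add[OF factored_bounded_by[OF w] Zcarrier_L[OF z(1)] Zcarrier_L[OF z(2)]]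
    by (intro norm_triangle_le add_mono factor_norm_upper z w)
  note bound = Zcarrier_I[OF L_add_closed[OF Zcarrier_L[OF z(1)] Zcarrier_L[OF z(2)]] this]
  show "z1 \<oplus>\<^bsub>L\<^esub> z2 \<in> Zcarrier" by (rule bound(1))
  show "factor_norm (z1 \<oplus>\<^bsub>L\<^esub> z2) \<le> factor_norm z1 + factor_norm z2" by (rule bound(2))
qed

lemma Zcarrier_smult: "z \<in> Zcarrier \<Longrightarrow> c \<odot>\<^bsub>L\<^esub> z \<in> Zcarrier"
  and factor_norm_smult_le: "z \<in> Zcarrier \<Longrightarrow> factor_norm (c \<odot>\<^bsub>L\<^esub> z) \<le> cmod c * factor_norm z"
proof -
  assume z: "z \<in> Zcarrier"
  have "cmod (trunc_trace k (\<lambda>x. w ((c \<odot>\<^bsub>L\<^esub> z) x))) \<le> cmod c * factor_norm z" if w: "w \<in> factored" for k w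
    unfolding trunc_trace_w_smult[OF factored_bounded_by[OF w] Zcarrier_L[OF z]] norm_mult
    by (intro mult_left_mono factor_norm_upper z w) auto
  note bound = Zcarrier_I[OF L_smult_closed[OF Zcarrier_L[OF z]] this]
  show "c \<odot>\<^bsub>L\<^esub> z \<in> Zcarrier" by (rule bound(1))
  show "factor_norm (c \<odot>\<^bsub>L\<^esub> z) \<le> cmod c * factor_norm z" by (rule bound(2))
qed

lemma factor_norm_smult: "z \<in> Zcarrier \<Longrightarrow> factor_norm (c \<odot>\<^bsub>L\<^esub> z) = cmod c * factor_norm z"
proof (cases "c = 0")
  case True
  assume "z \<in> Zcarrier"
  then show ?thesis using factor_norm_smult_le[of z c] factor_norm_nonneg[OF Zcarrier_smult[of z c]] True by (simp del: operator_space_simps)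
next
  case False
  assume z: "z \<in> Zcarrier"
  have "inverse c \<odot>\<^bsub>L\<^esub> (c \<odot>\<^bsub>L\<^esub> z) = z"
    using False Zcarrier_L[OF z] by (simp del: operator_space_simps flip: L.smult_times)
  then have "factor_norm z \<le> cmod (inverse c) * factor_norm (c \<odot>\<^bsub>L\<^esub> z)"
    using factor_norm_smult_le[OF Zcarrier_smult[OF z, of c], of "inverse c"] by simp
  then have "cmod c * factor_norm z \<le> cmod c * (cmod (inverse c) * factor_norm (c \<odot>\<^bsub>L\<^esub> z))" by (intro mult_left_mono) auto
  also have "\<dots> = factor_norm (c \<odot>\<^bsub>L\<^esub> z)" using False by (simp add: norm_inverse)
  finally show ?thesis using factor_norm_smult_le[OF z, of c] by simp
qed

lemma Zcarrier_zero: "\<zero>\<^bsub>L\<^esub> \<in> Zcarrier"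
proof (rule Zcarrier_I[where K = 0])
  fix k w assume w: "w \<in> factored"
  have "trunc_trace k (\<lambda>x. w (\<zero>\<^bsub>L\<^esub> x)) = 0"
    using trunc_trace_w_smult[OF factored_bounded_by[OF w] L_zero_closed, of k 0] L.smult_0[OF L_zero_closed] by (simp del: operator_space_simps)
  then show "cmod (trunc_trace k (\<lambda>x. w (\<zero>\<^bsub>L\<^esub> x))) \<le> 0" by simp
qed (rule L_zero_closed)

text \<open>
  The operator norm is added to \<open>factor_norm\<close> so that limits of Cauchy sequences are again
  bounded operators. The operator norms of coordinate projections are at most 1, so this term is
  harmless when they are compared with their rank.
\<close>

definition Z :: "('a \<Rightarrow> 'a) nspace" where
  "Z = L\<lparr>carrier := Zcarrier, vnorm := (\<lambda>z. vnorm L z + factor_norm z)\<rparr>"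

lemma Z_simps [simp]:
  "carrier Z = Zcarrier" "vnorm Z = (\<lambda>z. vnorm L z + factor_norm z)" "add Z = add L" "zero Z = zero L" "Module.smult Z = Module.smult L"
  by (simp_all add: Z_def)

lemma normed_cspace_Z: "normed_cspace Z"
proof (rule normed_cspace_subspace[OF normed_cspace_L])
  fix z assume z: "z \<in> carrier Z" and "vnorm Z z = 0"
  then have "vnorm L z + factor_norm z = 0" by simp
  then have "vnorm L z = 0" using factor_norm_nonneg[of z] vnorm_L_nonneg[OF Zcarrier_L, of z] z by simp
  then show "z = \<zero>\<^bsub>L\<^esub>" using z Zcarrier_L[of z] by (simp add: L.vnorm_eq_0_iff del: operator_space_simps)
next
  fix z1 z2 assume "z1 \<in> carrier Z" "z2 \<in> carrier Z"
  then have z: "z1 \<in> Zcarrier" "z2 \<in> Zcarrier" by simp_all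
  then show "vnorm Z (z1 \<oplus>\<^bsub>L\<^esub> z2) \<le> vnorm Z z1 + vnorm Z z2"
    using factor_norm_add[OF z] L_norm_add[OF Zcarrier_L[OF z(1)] Zcarrier_L[OF z(2)]] by (simp del: operator_space_simps)
next
  fix c z assume "z \<in> carrier Z"
  then have z: "z \<in> Zcarrier" by simp
  then show "vnorm Z (c \<odot>\<^bsub>L\<^esub> z) = cmod c * vnorm Z z"
    using factor_norm_smult[OF z] L_norm_smult[OF Zcarrier_L[OF z]] by (simp add: distrib_left del: operator_space_simps)
qed (auto simp: Zcarrier_L Zcarrier_add Zcarrier_smult Zcarrier_zero simp del: operator_space_simps)

sublocale Z: normed_cspace Z by (rule normed_cspace_Z)

lemma Z_minus: "z1 \<in> Zcarrier \<Longrightarrow> z2 \<in> Zcarrier \<Longrightarrow> z1 \<ominus>\<^bsub>Z\<^esub> z2 = z1 \<ominus>\<^bsub>L\<^esub> z2"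
  using Zcarrier_L by (simp add: Z.a_minus_eq L.a_minus_eq del: operator_space_simps)

lemma Zcarrier_minus: "z1 \<in> Zcarrier \<Longrightarrow> z2 \<in> Zcarrier \<Longrightarrow> z1 \<ominus>\<^bsub>L\<^esub> z2 \<in> Zcarrier"
  using Z.M.minus_closed[of z1 z2] by (simp add: Z_minus)

text \<open>
  The limit is taken in operator norm. Every single truncated trace is continuous in this norm, so
  \<open>factor_norm\<close> is lower semicontinuous and the Cauchy estimates survive.
\<close>

lemma banach_cspace_Z: "banach_cspace Z"
proof (rule Z.banach_cspaceI)
  fix \<sigma> assume \<sigma>: "Z.Cauchy_seq \<sigma>"
  then have \<sigma>Z: "\<sigma> n \<in> Zcarrier" for n by (simp add: Z.Cauchy_seq_def)
  note \<sigma>L = Zcarrier_L[OF \<sigma>Z]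
  have small: "\<exists>N. \<forall>m\<ge>N. \<forall>n\<ge>N. vnorm L (\<sigma> m \<ominus>\<^bsub>L\<^esub> \<sigma> n) + factor_norm (\<sigma> m \<ominus>\<^bsub>L\<^esub> \<sigma> n) < e" if "e > 0" for e
    using \<sigma> that \<sigma>Z by (simp add: Z.Cauchy_seq_def Z_minus)
  interpret LB: banach_cspace L
    by (rule banach_cspace_L) unfold_locales
  have "L.Cauchy_seq \<sigma>"
    unfolding L.Cauchy_seq_def
  proof (intro conjI allI impI \<sigma>L)
    fix e :: real assume "e > 0"
    then obtain N where N: "\<forall>m\<ge>N. \<forall>n\<ge>N. vnorm L (\<sigma> m \<ominus>\<^bsub>L\<^esub> \<sigma> n) + factor_norm (\<sigma> m \<ominus>\<^bsub>L\<^esub> \<sigma> n) < e" using small by blast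
    have "vnorm L (\<sigma> m \<ominus>\<^bsub>L\<^esub> \<sigma> n) < e" if "m \<ge> N" "n \<ge> N" for m n
      using N[rule_format, OF that] factor_norm_nonneg[OF Zcarrier_minus[OF \<sigma>Z \<sigma>Z], of m n] by simp
    then show "\<exists>N. \<forall>m\<ge>N. \<forall>n\<ge>N. vnorm L (\<sigma> m \<ominus>\<^bsub>L\<^esub> \<sigma> n) < e" by blast
  qed
  then obtain z where zL: "z \<in> carrier L" and lim: "(\<lambda>n. vnorm L (\<sigma> n \<ominus>\<^bsub>L\<^esub> z)) \<longlonglongrightarrow> 0"
    using LB.Cauchy_seq_converges by blast
  have trlim: "(\<lambda>m. trunc_trace k (\<lambda>x. w (\<sigma> m x))) \<longlonglongrightarrow> trunc_trace k (\<lambda>x. w (z x))" if w: "w \<in> factored" for k w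
  proof -
    have "norm (trunc_trace k (\<lambda>x. w (\<sigma> m x)) - trunc_trace k (\<lambda>x. w (z x))) \<le> real (card (I k)) * vnorm L (\<sigma> m \<ominus>\<^bsub>L\<^esub> z)" for m
    proof -
      have "bounded_by (1 * vnorm L (\<sigma> m \<ominus>\<^bsub>L\<^esub> z)) (\<lambda>x. w ((\<sigma> m \<ominus>\<^bsub>L\<^esub> z) x))"
        using \<sigma>L zL by (intro bounded_by_comp[OF factored_bounded_by[OF w] bounded_by_L]) (simp del: operator_space_simps)
      from trunc_trace_le[OF this, of k] show ?thesis
        using trunc_trace_w_minus[OF factored_bounded_by[OF w] \<sigma>L zL, of k m] by simp
    qed
    moreover have "(\<lambda>m. real (card (I k)) * vnorm L (\<sigma> m \<ominus>\<^bsub>L\<^esub> z)) \<longlonglongrightarrow> 0"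
      using tendsto_mult_right_zero[OF lim] .
    ultimately have "(\<lambda>m. trunc_trace k (\<lambda>x. w (\<sigma> m x)) - trunc_trace k (\<lambda>x. w (z x))) \<longlonglongrightarrow> 0"
      by (rule Lim_null_comparison[OF always_eventually[OF allI]])
    then show ?thesis by (rule LIM_zero_cancel)
  qed
  have close: "\<sigma> n \<ominus>\<^bsub>L\<^esub> z \<in> Zcarrier \<and> factor_norm (\<sigma> n \<ominus>\<^bsub>L\<^esub> z) \<le> e"
    if N: "\<forall>m\<ge>N. \<forall>n\<ge>N. vnorm L (\<sigma> m \<ominus>\<^bsub>L\<^esub> \<sigma> n) + factor_norm (\<sigma> m \<ominus>\<^bsub>L\<^esub> \<sigma> n) < e" and n: "n \<ge> N" for N n e
  proof -
    have "cmod (trunc_trace k (\<lambda>x. w ((\<sigma> n \<ominus>\<^bsub>L\<^esub> z) x))) \<le> e" if w: "w \<in> factored" for k w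
    proof -
      have "(\<lambda>m. cmod (trunc_trace k (\<lambda>x. w (\<sigma> n x)) - trunc_trace k (\<lambda>x. w (\<sigma> m x)))) \<longlonglongrightarrow> cmod (trunc_trace k (\<lambda>x. w (\<sigma> n x)) - trunc_trace k (\<lambda>x. w (z x)))"
        by (intro tendsto_norm tendsto_diff tendsto_const trlim w)
      moreover have "cmod (trunc_trace k (\<lambda>x. w (\<sigma> n x)) - trunc_trace k (\<lambda>x. w (\<sigma> m x))) \<le> e" if m: "m \<ge> N" for m
      proof -
        have "cmod (trunc_trace k (\<lambda>x. w (\<sigma> n x)) - trunc_trace k (\<lambda>x. w (\<sigma> m x))) \<le> factor_norm (\<sigma> n \<ominus>\<^bsub>L\<^esub> \<sigma> m)"
          using factor_norm_upper[OF Zcarrier_minus[OF \<sigma>Z \<sigma>Z] w, of k n m] trunc_trace_w_minus[OF factored_bounded_by[OF w] \<sigma>L \<sigma>L, of k n m] by simp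
        also have "\<dots> \<le> e" using N[rule_format, OF n m] vnorm_L_nonneg[OF Zcarrier_L[OF Zcarrier_minus[OF \<sigma>Z \<sigma>Z]], of n m] by simp
        finally show ?thesis .
      qed
      ultimately have "cmod (trunc_trace k (\<lambda>x. w (\<sigma> n x)) - trunc_trace k (\<lambda>x. w (z x))) \<le> e"
        by (intro LIMSEQ_le_const2) auto
      then show ?thesis using trunc_trace_w_minus[OF factored_bounded_by[OF w] \<sigma>L zL, of k n] by simp
    qed
    then show ?thesis using Zcarrier_I[of "\<sigma> n \<ominus>\<^bsub>L\<^esub> z" e] \<sigma>L zL by (simp del: operator_space_simps)
  qed
  have zZ: "z \<in> Zcarrier"
  proof -
    obtain N where "\<forall>m\<ge>N. \<forall>n\<ge>N. vnorm L (\<sigma> m \<ominus>\<^bsub>L\<^esub> \<sigma> n) + factor_norm (\<sigma> m \<ominus>\<^bsub>L\<^esub> \<sigma> n) < 1" using small[of 1] by auto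
    from close[OF this, of N] have "\<sigma> N \<ominus>\<^bsub>L\<^esub> z \<in> Zcarrier" by simp
    from Zcarrier_minus[OF \<sigma>Z[of N] this] have "\<sigma> N \<ominus>\<^bsub>L\<^esub> (\<sigma> N \<ominus>\<^bsub>L\<^esub> z) \<in> Zcarrier" .
    moreover have "\<sigma> N \<ominus>\<^bsub>L\<^esub> (\<sigma> N \<ominus>\<^bsub>L\<^esub> z) = z"
      using \<sigma>L[of N] zL by (simp add: a_minus_def L.M.minus_add L.M.r_neg2 del: operator_space_simps)
    ultimately show ?thesis by simp
  qed
  have "(\<lambda>n. vnorm Z (\<sigma> n \<ominus>\<^bsub>Z\<^esub> z)) \<longlonglongrightarrow> 0"
  proof -
    have "(\<lambda>n. factor_norm (\<sigma> n \<ominus>\<^bsub>L\<^esub> z)) \<longlonglongrightarrow> 0"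
    proof (rule LIMSEQ_I)
      fix e :: real assume e: "0 < e"
      obtain N where N: "\<forall>m\<ge>N. \<forall>n\<ge>N. vnorm L (\<sigma> m \<ominus>\<^bsub>L\<^esub> \<sigma> n) + factor_norm (\<sigma> m \<ominus>\<^bsub>L\<^esub> \<sigma> n) < e/2" using small[of "e/2"] e by auto
      have "norm (factor_norm (\<sigma> n \<ominus>\<^bsub>L\<^esub> z) - 0) < e" if "n \<ge> N" for n
        using close[OF N that] factor_norm_nonneg[of "\<sigma> n \<ominus>\<^bsub>L\<^esub> z"] e by auto
      then show "\<exists>N. \<forall>n\<ge>N. norm (factor_norm (\<sigma> n \<ominus>\<^bsub>L\<^esub> z) - 0) < e" by blast
    qed
    from tendsto_add[OF lim this] show ?thesis using \<sigma>Z zZ by (simp add: Z_minus)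
  qed
  then show "\<exists>z\<in>carrier Z. (\<lambda>n. vnorm Z (\<sigma> n \<ominus>\<^bsub>Z\<^esub> z)) \<longlonglongrightarrow> 0" using zZ by auto
qed

end

section \<open>The bimodule\<close>

text \<open>
  For a linear map the hypothesis \<open>le\<close> is boundedness.
\<close>

lemma (in normed_pair) continuous_map_of_bounded:
  assumes f: "f \<in> carrier V \<rightarrow> carrier W" and K: "K \<ge> 0"
    and le: "\<And>x y. x \<in> carrier V \<Longrightarrow> y \<in> carrier V \<Longrightarrow> vnorm W (f x \<ominus>\<^bsub>W\<^esub> f y) \<le> K * vnorm V (x \<ominus>\<^bsub>V\<^esub> y)"
  shows "continuous_map (norm_topology V) (norm_topology W) f"
  unfolding norm_topology_def V.metric_continuous_map[OF W.Metric_space_axioms]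
proof (intro conjI ballI allI impI)
  show "f ` carrier V \<subseteq> carrier W" using f by auto
  fix a and e :: real assume a: "a \<in> carrier V" and e: "e > 0"
  show "\<exists>d>0. \<forall>x. x \<in> carrier V \<and> vdist V a x < d \<longrightarrow> vdist W (f a) (f x) < e"
  proof (intro exI[of _ "e / (K + 1)"] conjI allI impI)
    show "e / (K + 1) > 0" using e K by simp
    fix x assume x: "x \<in> carrier V \<and> vdist V a x < e / (K + 1)"
    then have d: "vnorm V (a \<ominus>\<^bsub>V\<^esub> x) < e / (K + 1)" using a by (auto simp: vdist_def)
    have "vdist W (f a) (f x) \<le> K * vnorm V (a \<ominus>\<^bsub>V\<^esub> x)"
      using a x f le[of a x] by (auto simp: vdist_def Pi_iff)
    also have "\<dots> \<le> (K + 1) * vnorm V (a \<ominus>\<^bsub>V\<^esub> x)" using a x by (intro mult_right_mono) auto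
    also have "\<dots> < (K + 1) * (e / (K + 1))" using d K by (intro mult_strict_left_mono) auto
    also have "\<dots> = e" using K by simp
    finally show "vdist W (f a) (f x) < e" .
  qed
qed

context split_basis
begin

lemma comp_L: "a \<in> carrier L \<Longrightarrow> b \<in> carrier L \<Longrightarrow> compose (carrier V) a b \<in> carrier L"
  and vnorm_comp: "a \<in> carrier L \<Longrightarrow> b \<in> carrier L \<Longrightarrow> vnorm L (compose (carrier V) a b) \<le> vnorm L a * vnorm L b"
  unfolding compose_def
  using L_of_bounded_by[OF bounded_by_comp[OF bounded_by_L bounded_by_L]] vnorm_L_of_bounded_by[OF bounded_by_comp[OF bounded_by_L bounded_by_L]] by auto

lemma comp_app [simp]: "x \<in> carrier V \<Longrightarrow> compose (carrier V) a b x = a (b x)"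
  by (simp add: compose_def)

lemma A_L: "a \<in> carrier A \<Longrightarrow> a \<in> carrier L"
  by (simp add: carrier_A)

lemma comp_add_left: "a \<in> carrier L \<Longrightarrow> a' \<in> carrier L \<Longrightarrow> b \<in> carrier L \<Longrightarrow>
    compose (carrier V) (a \<oplus>\<^bsub>L\<^esub> a') b = compose (carrier V) a b \<oplus>\<^bsub>L\<^esub> compose (carrier V) a' b"
  by (auto simp: compose_def)

lemma comp_add_right: "a \<in> carrier L \<Longrightarrow> b \<in> carrier L \<Longrightarrow> b' \<in> carrier L \<Longrightarrow>
    compose (carrier V) a (b \<oplus>\<^bsub>L\<^esub> b') = compose (carrier V) a b \<oplus>\<^bsub>L\<^esub> compose (carrier V) a b'"
  by (auto simp: compose_def L_add)

lemma comp_smult_left: "a \<in> carrier L \<Longrightarrow> b \<in> carrier L \<Longrightarrow>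
    compose (carrier V) (c \<odot>\<^bsub>L\<^esub> a) b = c \<odot>\<^bsub>L\<^esub> compose (carrier V) a b"
  by (auto simp: compose_def)

lemma comp_smult_right: "a \<in> carrier L \<Longrightarrow> b \<in> carrier L \<Longrightarrow>
    compose (carrier V) a (c \<odot>\<^bsub>L\<^esub> b) = c \<odot>\<^bsub>L\<^esub> compose (carrier V) a b"
  by (auto simp: compose_def L_smult)

lemma comp_assoc: "a \<in> carrier L \<Longrightarrow> b \<in> carrier L \<Longrightarrow> c \<in> carrier L \<Longrightarrow>
    compose (carrier V) (compose (carrier V) a b) c = compose (carrier V) a (compose (carrier V) b c)"
  by (auto simp: compose_def)

lemma carrier_A_I:
  assumes "a \<in> carrier L" "\<And>k. vnorm L (tail k a) \<le> g k" "g \<longlonglongrightarrow> 0"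
  shows "a \<in> carrier A"
  unfolding carrier_A
proof
  show "(\<lambda>k. vnorm L (tail k a)) \<longlonglongrightarrow> 0"
    by (rule tendsto_sandwich[OF _ _ tendsto_const assms(3)])
       (use assms vnorm_L_nonneg[OF tail_L[OF assms(1)]] in auto)
qed fact

lemma A_tail: "a \<in> carrier A \<Longrightarrow> (\<lambda>k. vnorm L (tail k a)) \<longlonglongrightarrow> 0"
  by (simp add: carrier_A)

lemma A_add: "a \<in> carrier A \<Longrightarrow> b \<in> carrier A \<Longrightarrow> a \<oplus>\<^bsub>L\<^esub> b \<in> carrier A"
proof (rule carrier_A_I)
  assume ab: "a \<in> carrier A" "b \<in> carrier A"
  show "vnorm L (tail k (a \<oplus>\<^bsub>L\<^esub> b)) \<le> vnorm L (tail k a) + vnorm L (tail k b)" for k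
    unfolding tail_add[OF A_L[OF ab(1)] A_L[OF ab(2)]] by (intro L_norm_add tail_L A_L ab)
  show "(\<lambda>k. vnorm L (tail k a) + vnorm L (tail k b)) \<longlonglongrightarrow> 0"
    using tendsto_add[OF A_tail[OF ab(1)] A_tail[OF ab(2)]] by simp
qed (intro L_add_closed A_L)

lemma A_smult: "a \<in> carrier A \<Longrightarrow> c \<odot>\<^bsub>L\<^esub> a \<in> carrier A"
proof (rule carrier_A_I)
  assume a: "a \<in> carrier A"
  show "vnorm L (tail k (c \<odot>\<^bsub>L\<^esub> a)) \<le> cmod c * vnorm L (tail k a)" for k
    unfolding tail_smult[OF A_L[OF a]] L_norm_smult[OF tail_L[OF A_L[OF a]]] by simp
  show "(\<lambda>k. cmod c * vnorm L (tail k a)) \<longlonglongrightarrow> 0"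
    using tendsto_mult_right_zero[OF A_tail[OF a]] .
qed (intro L_smult_closed A_L)

lemma A_zero: "\<zero>\<^bsub>L\<^esub> \<in> carrier A"
proof (rule carrier_A_I[OF L_zero_closed])
  show "vnorm L (tail k \<zero>\<^bsub>L\<^esub>) \<le> 0" for k
    using vnorm_tail_le[OF L_zero_closed, of k] by (simp del: operator_space_simps)
qed simp

lemma A_comp: "a \<in> carrier A \<Longrightarrow> b \<in> carrier L \<Longrightarrow> compose (carrier V) a b \<in> carrier A"
proof (rule carrier_A_I)
  assume a: "a \<in> carrier A" and b: "b \<in> carrier L"
  show "vnorm L (tail k (compose (carrier V) a b)) \<le> vnorm L (tail k a) * vnorm L b" for k
  proof -
    have "tail k (compose (carrier V) a b) = compose (carrier V) (tail k a) b"
      using b by (auto simp: tail_def compose_def)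
    then show ?thesis using vnorm_comp[OF tail_L[OF A_L[OF a]] b] by simp
  qed
  show "(\<lambda>k. vnorm L (tail k a) * vnorm L b) \<longlonglongrightarrow> 0"
    using tendsto_mult_left_zero[OF A_tail[OF a]] .
qed (blast intro: comp_L A_L)

lemma normed_cspace_A: "normed_cspace A"
  by (rule normed_cspace_subspace[OF normed_cspace_L])
     (auto simp: A_L A_add A_smult A_zero L_norm_smult L_norm_add L.vnorm_eq_0_iff simp del: operator_space_simps)

sublocale A: normed_cspace A by (rule normed_cspace_A)

lemma A_minus: "a \<in> carrier A \<Longrightarrow> b \<in> carrier A \<Longrightarrow> a \<ominus>\<^bsub>A\<^esub> b = a \<ominus>\<^bsub>L\<^esub> b"
  using A_L by (simp add: A.a_minus_eq L.a_minus_eq del: operator_space_simps)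

lemma banach_cspace_A: "banach_cspace A"
proof (rule A.banach_cspaceI)
  fix \<sigma> assume \<sigma>: "A.Cauchy_seq \<sigma>"
  then have \<sigma>A: "\<sigma> n \<in> carrier A" for n by (simp add: A.Cauchy_seq_def)
  note \<sigma>L = A_L[OF \<sigma>A]
  interpret LB: banach_cspace L by (rule banach_cspace_L) unfold_locales
  have "L.Cauchy_seq \<sigma>"
    using \<sigma> \<sigma>A \<sigma>L by (simp add: A.Cauchy_seq_def L.Cauchy_seq_def A_minus)
  then obtain a where aL: "a \<in> carrier L" and lim: "(\<lambda>n. vnorm L (\<sigma> n \<ominus>\<^bsub>L\<^esub> a)) \<longlonglongrightarrow> 0"
    using LB.Cauchy_seq_converges by blast
  have "(\<lambda>k. vnorm L (tail k a)) \<longlonglongrightarrow> 0"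
  proof (rule LIMSEQ_I)
    fix e :: real assume e: "0 < e"
    obtain n where "norm (vnorm L (\<sigma> n \<ominus>\<^bsub>L\<^esub> a) - 0) < e/2"
      using LIMSEQ_D[OF lim half_gt_zero[OF e]] by blast
    then have n: "vnorm L (a \<ominus>\<^bsub>L\<^esub> \<sigma> n) < e/2"
      using L.vnorm_minus_commute[OF aL \<sigma>L[of n]] by (simp add: abs_less_iff)
    obtain N where N: "\<forall>k\<ge>N. norm (vnorm L (tail k (\<sigma> n)) - 0) < e/2"
      using LIMSEQ_D[OF A_tail[OF \<sigma>A] half_gt_zero[OF e]] by (rule exE)
    have "vnorm L (tail k a) < e" if k: "k \<ge> N" for k
    proof -
      have "vnorm L (tail k a) \<le> vnorm L (tail k (\<sigma> n)) + vnorm L (tail k a \<ominus>\<^bsub>L\<^esub> tail k (\<sigma> n))"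
        by (intro L.vnorm_le_add_minus tail_L aL \<sigma>L)
      also have "tail k a \<ominus>\<^bsub>L\<^esub> tail k (\<sigma> n) = tail k (a \<ominus>\<^bsub>L\<^esub> \<sigma> n)" by (rule tail_minus[OF aL \<sigma>L, symmetric])
      also have "vnorm L (tail k (\<sigma> n)) + vnorm L (tail k (a \<ominus>\<^bsub>L\<^esub> \<sigma> n)) < e/2 + e/2"
        using N k n vnorm_tail_le[OF L.M.minus_closed[OF aL \<sigma>L[of n]], of k]
        by (intro add_strict_mono) (auto simp: abs_less_iff)
      finally show ?thesis by simp
    qed
    then show "\<exists>N. \<forall>k\<ge>N. norm (vnorm L (tail k a) - 0) < e"
      using vnorm_L_nonneg[OF tail_L[OF aL]] by (intro exI[of _ N]) auto
  qed
  then have aA: "a \<in> carrier A" using aL by (simp add: carrier_A)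
  then show "\<exists>x\<in>carrier A. (\<lambda>n. vnorm A (\<sigma> n \<ominus>\<^bsub>A\<^esub> x)) \<longlonglongrightarrow> 0"
    using lim \<sigma>A by (intro bexI[of _ a]) (simp_all add: A_minus)
qed

lemma banach_calgebra_A: "banach_calgebra A"
proof (rule banach_calgebra.intro[OF banach_cspace_A], unfold_locales)
  fix a b assume a: "a \<in> carrier A" and b: "b \<in> carrier A"
  show "a \<otimes>\<^bsub>A\<^esub> b \<in> carrier A" using A_comp[OF a A_L[OF b]] by simp
  show "vnorm A (a \<otimes>\<^bsub>A\<^esub> b) \<le> vnorm A a * vnorm A b" using vnorm_comp[OF A_L[OF a] A_L[OF b]] by simp
  fix c assume "c \<in> carrier A"
  then show "a \<otimes>\<^bsub>A\<^esub> b \<otimes>\<^bsub>A\<^esub> c = a \<otimes>\<^bsub>A\<^esub> (b \<otimes>\<^bsub>A\<^esub> c)"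
    using comp_assoc[OF A_L[OF a] A_L[OF b] A_L] by simp
next
  fix b assume b: "b \<in> carrier A"
  show "clinear_map A A (\<lambda>a. a \<otimes>\<^bsub>A\<^esub> b)"
    by (rule clinear_mapI) (simp_all add: A_comp A_L[OF b] A_L comp_add_left comp_smult_left del: operator_space_simps)
  show "clinear_map A A (\<lambda>a. b \<otimes>\<^bsub>A\<^esub> a)"
    by (rule clinear_mapI) (simp_all add: A_comp b A_L[OF b] A_L comp_add_right comp_smult_right del: operator_space_simps)
qed

lemma Z_left:
  assumes a: "a \<in> carrier L" and z: "z \<in> Zcarrier"
  shows "compose (carrier V) a z \<in> Zcarrier" "factor_norm (compose (carrier V) a z) \<le> vnorm L a * factor_norm z"
proof -
  have le: "cmod (trunc_trace k (\<lambda>x. w (compose (carrier V) a z x))) \<le> vnorm L a * factor_norm z" if w': "w \<in> factored" for k w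
  proof -
    obtain S c1 c2 c3 where S: "S = P \<or> S = - P" and c: "bounded_by 1 c1" "bounded_by 1 c2" "bounded_by 1 c3" and w: "w = (\<lambda>x. c1 (cut S (c2 (cut (- S) (c3 x)))))"
      using w' by (auto simp: factored_def)
    have "trunc_trace k (\<lambda>x. w (compose (carrier V) a z x)) = trunc_trace k (\<lambda>x. c1 (cut S (c2 (cut (- S) (c3 (a (z x)))))))"
      by (rule trunc_trace_cong) (simp add: w)
    then show ?thesis
      using factor_norm_scaled[OF z S c(1,2) bounded_by_comp[OF c(3) bounded_by_L[OF a]], of k] by simp
  qed
  show "compose (carrier V) a z \<in> Zcarrier" "factor_norm (compose (carrier V) a z) \<le> vnorm L a * factor_norm z"
    by (rule Zcarrier_I[OF comp_L[OF a Zcarrier_L[OF z]] le]; assumption)+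
qed

text \<open>
  On this side the truncation stands between the operators, and \<open>trunc_trace_commute\<close> moves
  \<open>a\<close> to the other end, where it is absorbed by the outer contraction.
\<close>

lemma Z_right:
  assumes a: "a \<in> carrier L" and z: "z \<in> Zcarrier"
  shows "compose (carrier V) z a \<in> Zcarrier" "factor_norm (compose (carrier V) z a) \<le> vnorm L a * factor_norm z"
proof -
  have le: "cmod (trunc_trace k (\<lambda>x. w (compose (carrier V) z a x))) \<le> vnorm L a * factor_norm z" if w': "w \<in> factored" for k w
  proof -
    obtain S c1 c2 c3 where S: "S = P \<or> S = - P" and c: "bounded_by 1 c1" "bounded_by 1 c2" "bounded_by 1 c3" and w: "w = (\<lambda>x. c1 (cut S (c2 (cut (- S) (c3 x)))))"
      using w' by (auto simp: factored_def)
    have bw: "bounded_by (1 * vnorm L z) (\<lambda>x. w (z x))"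
      using bounded_by_comp[OF factored_bounded_by[OF w'] bounded_by_L[OF Zcarrier_L[OF z]]] .
    have "(\<lambda>l. trunc_trace l (\<lambda>x. a (cut (I k) (w (z x))))) \<longlonglongrightarrow> trunc_trace k (\<lambda>x. w (z (a x)))"
      by (rule trunc_trace_commute[OF bounded_by_L[OF a] bw])
    then have "(\<lambda>l. cmod (trunc_trace l (\<lambda>x. a (cut (I k) (w (z x)))))) \<longlonglongrightarrow> cmod (trunc_trace k (\<lambda>x. w (z (a x))))"
      by (rule tendsto_norm)
    moreover have "cmod (trunc_trace l (\<lambda>x. a (cut (I k) (w (z x))))) \<le> vnorm L a * factor_norm z" for l
      using factor_norm_scaled[OF z S bounded_by_comp[OF bounded_by_L[OF a] bounded_by_comp[OF bounded_by_cut c(1)]] c(2,3), of l "I k"] unfolding w by simp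
    ultimately have "cmod (trunc_trace k (\<lambda>x. w (z (a x)))) \<le> vnorm L a * factor_norm z"
      by (intro LIMSEQ_le_const2) auto
    also have "trunc_trace k (\<lambda>x. w (z (a x))) = trunc_trace k (\<lambda>x. w (compose (carrier V) z a x))"
      by (rule trunc_trace_cong) simp
    finally show ?thesis .
  qed
  show "compose (carrier V) z a \<in> Zcarrier" "factor_norm (compose (carrier V) z a) \<le> vnorm L a * factor_norm z"
    by (rule Zcarrier_I[OF comp_L[OF Zcarrier_L[OF z] a] le]; assumption)+
qed

abbreviation "lmod \<equiv> \<lambda>a z. compose (carrier V) a z"
abbreviation "rmod \<equiv> \<lambda>z a. compose (carrier V) z a"

lemma banach_bimodule_Z: "banach_bimodule A Z lmod rmod"
proof (rule banach_bimodule.intro[OF banach_calgebra_A banach_cspace_Z], unfold_locales)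
  fix z assume "z \<in> carrier Z"
  then have z: "z \<in> Zcarrier" by simp
  show "clinear_map A Z (\<lambda>a. lmod a z)"
    by (rule clinear_mapI) (use z in \<open>simp_all add: Z_left A_L Zcarrier_L comp_add_left comp_smult_left del: operator_space_simps\<close>)
  show "clinear_map A Z (\<lambda>a. rmod z a)"
    by (rule clinear_mapI) (use z in \<open>simp_all add: Z_right A_L Zcarrier_L comp_add_right comp_smult_right del: operator_space_simps\<close>)
next
  fix a assume a: "a \<in> carrier A"
  show "clinear_map Z Z (\<lambda>z. lmod a z)"
    by (rule clinear_mapI) (use a in \<open>simp_all add: Z_left A_L Zcarrier_L comp_add_right comp_smult_right del: operator_space_simps\<close>)
  show "clinear_map Z Z (\<lambda>z. rmod z a)"
    by (rule clinear_mapI) (use a in \<open>simp_all add: Z_right A_L Zcarrier_L comp_add_left comp_smult_left del: operator_space_simps\<close>)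
next
  fix a b z assume "a \<in> carrier A" "b \<in> carrier A" "z \<in> carrier Z"
  then have "a \<in> carrier L" "b \<in> carrier L" "z \<in> carrier L" by (auto simp: A_L Zcarrier_L)
  then show "lmod (a \<otimes>\<^bsub>A\<^esub> b) z = lmod a (lmod b z)" "rmod z (a \<otimes>\<^bsub>A\<^esub> b) = rmod (rmod z a) b"
    "rmod (lmod a z) b = lmod a (rmod z b)"
    by (simp_all add: comp_assoc)
next
  show "\<exists>K. \<forall>a\<in>carrier A. \<forall>z\<in>carrier Z. vnorm Z (lmod a z) \<le> K * vnorm A a * vnorm Z z"
  proof (intro exI[of _ 1] ballI)
    fix a z assume "a \<in> carrier A" "z \<in> carrier Z"
    then have a: "a \<in> carrier L" and z: "z \<in> Zcarrier" by (auto simp: A_L)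
    show "vnorm Z (lmod a z) \<le> 1 * vnorm A a * vnorm Z z"
      using vnorm_comp[OF a Zcarrier_L[OF z]] Z_left(2)[OF a z] by (simp add: distrib_left)
  qed
  show "\<exists>K. \<forall>a\<in>carrier A. \<forall>z\<in>carrier Z. vnorm Z (rmod z a) \<le> K * vnorm A a * vnorm Z z"
  proof (intro exI[of _ 1] ballI)
    fix a z assume "a \<in> carrier A" "z \<in> carrier Z"
    then have a: "a \<in> carrier L" and z: "z \<in> Zcarrier" by (auto simp: A_L)
    show "vnorm Z (rmod z a) \<le> 1 * vnorm A a * vnorm Z z"
      using vnorm_comp[OF Zcarrier_L[OF z] a] Z_right(2)[OF a z] by (simp add: distrib_left mult.commute)
  qed
qed

end

section \<open>The derivation\<close>

context split_basis
begin

text \<open>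
  This is \<open>a P - P a\<close> for the projection \<open>P\<close> onto the first summand, see
  \<open>commutator_eq\<close>; the form chosen here shows the factorization through both summands.
\<close>

definition commutator :: "('a \<Rightarrow> 'a) \<Rightarrow> 'a \<Rightarrow> 'a" where
  "commutator a x = cut (- P) (a (cut P x)) \<ominus> cut P (a (cut (- P) x))"

lemma commutator_in [simp]: "a \<in> carrier L \<Longrightarrow> x \<in> carrier V \<Longrightarrow> commutator a x \<in> carrier V"
  by (simp add: commutator_def)

lemma coord_commutator: "a \<in> carrier L \<Longrightarrow> x \<in> carrier V \<Longrightarrow>
   coord i (commutator a x) = (if i \<in> P then - coord i (a (cut (- P) x)) else coord i (a (cut P x)))"
  by (simp add: commutator_def coord_minus coord_cut)

lemma commutator_eq:
  assumes a: "a \<in> carrier L" and x: "x \<in> carrier V"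
  shows "commutator a x = a (cut P x) \<ominus> cut P (a x)"
proof (rule coord_eqI)
  fix i
  have "a (cut P x \<oplus> cut (- P) x) = a (cut P x) \<oplus> a (cut (- P) x)" using a x by (intro L_add) auto
  then have "coord i (a x) = coord i (a (cut P x)) + coord i (a (cut (- P) x))"
    using a x by (simp add: cut_decomp coord_add)
  then show "coord i (commutator a x) = coord i (a (cut P x) \<ominus> cut P (a x))"
    using a x by (simp add: coord_commutator coord_minus coord_cut)
qed (use a x in auto)

lemma bounded_by_commutator: "a \<in> carrier L \<Longrightarrow> bounded_by (2 * vnorm L a) (commutator a)"
proof (rule bounded_byI)
  assume a: "a \<in> carrier L"
  fix x assume x: "x \<in> carrier V"
  have le: "vnorm V (cut S (a (cut T x))) \<le> vnorm L a * vnorm V x" for S T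
    using bounded_byD(5)[OF bounded_by_comp[OF bounded_by_cut bounded_by_comp[OF bounded_by_L[OF a] bounded_by_cut]] x] by simp
  show "vnorm V (commutator a x) \<le> 2 * vnorm L a * vnorm V x"
    using vnorm_minus_le[of "cut (- P) (a (cut P x))" "cut P (a (cut (- P) x))"] a x le[of "- P" P] le[of P "- P"]
    by (simp add: commutator_def)
next
  fix x y assume "a \<in> carrier L" "x \<in> carrier V" "y \<in> carrier V"
  then show "commutator a (x \<oplus> y) = commutator a x \<oplus> commutator a y"
    by (intro coord_eqI) (auto simp: coord_commutator coord_add cut_add L_add)
next
  fix c x assume "a \<in> carrier L" "x \<in> carrier V"
  then show "commutator a (c \<odot> x) = c \<odot> commutator a x"
    by (intro coord_eqI) (auto simp: coord_commutator coord_smult cut_smult L_smult)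
qed (auto simp: vnorm_L_nonneg)

text \<open>
  Both terms of the commutator factor through both summands, with trivial outer factors.
\<close>

lemma trunc_trace_commutator_bound:
  assumes c: "bounded_by M c" and a: "a \<in> carrier L" and z: "z \<in> Zcarrier"
  shows "cmod (trunc_trace k (\<lambda>x. c (commutator a (z x)))) \<le> 2 * M * vnorm L a * factor_norm z"
proof -
  note zL = Zcarrier_L[OF z]
  have "trunc_trace k (\<lambda>x. c (commutator a (z x))) = trunc_trace k (\<lambda>x. c (cut (- P) (a (cut P (z x)))) \<ominus> c (cut P (a (cut (- P) (z x)))))"
    using a zL by (intro trunc_trace_cong) (simp add: commutator_def bounded_by_minus[OF c])
  also have "\<dots> = trunc_trace k (\<lambda>x. c (cut (- P) (a (cut P (z x))))) - trunc_trace k (\<lambda>x. c (cut P (a (cut (- P) (z x)))))"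
    using a zL by (intro trunc_trace_minus) (auto simp: bounded_byD[OF c])
  also have "cmod \<dots> \<le> cmod (trunc_trace k (\<lambda>x. c (cut (- P) (a (cut P (z x)))))) + cmod (trunc_trace k (\<lambda>x. c (cut P (a (cut (- P) (z x))))))"
    by (rule norm_triangle_ineq4)
  also have "\<dots> \<le> M * vnorm L a * factor_norm z + M * vnorm L a * factor_norm z"
    using factor_norm_scaled[OF z _ c bounded_by_L[OF a] bounded_by_id, of "- P" k] factor_norm_scaled[OF z _ c bounded_by_L[OF a] bounded_by_id, of P k]
    by (intro add_mono) simp_all
  finally show ?thesis by simp
qed

lemma tail_app: "x \<in> carrier V \<Longrightarrow> tail l a x = cut (- I l) (a x)"
  by (simp add: tail_def)

lemma commutator_tail: "a \<in> carrier L \<Longrightarrow> x \<in> carrier V \<Longrightarrow> commutator (tail l a) x = cut (- I l) (commutator a x)"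
  by (rule coord_eqI) (simp_all add: coord_commutator coord_cut tail_app)

lemma commutator_split: "a \<in> carrier L \<Longrightarrow> x \<in> carrier V \<Longrightarrow> commutator a x \<ominus> cut (I l) (commutator a x) = commutator (tail l a) x"
  using cut_compl[of "commutator a x" "I l"] by (simp add: commutator_tail)

lemma trunc_trace_commutator_diff:
  assumes a: "a \<in> carrier L" and z: "z \<in> carrier L" and k: "k \<ge> l"
  shows "trunc_trace k (\<lambda>x. commutator a (z x)) - trunc_trace l (\<lambda>x. commutator a (z x)) = trunc_trace k (\<lambda>x. commutator (tail l a) (z x))"
proof -
  have "trunc_trace k (\<lambda>x. commutator (tail l a) (z x)) = trunc_trace k (\<lambda>x. commutator a (z x) \<ominus> cut (I l) (commutator a (z x)))"
    using a z by (intro trunc_trace_cong) (simp add: commutator_split)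
  also have "\<dots> = trunc_trace k (\<lambda>x. commutator a (z x)) - trunc_trace k (\<lambda>x. cut (I l) (commutator a (z x)))"
    using a z by (intro trunc_trace_minus) auto
  also have "trunc_trace k (\<lambda>x. cut (I l) (commutator a (z x))) = trunc_trace l (\<lambda>x. commutator a (z x))"
    by (rule trunc_trace_cut[OF bounded_by_comp[OF bounded_by_commutator[OF a] bounded_by_L[OF z]] k])
  finally show ?thesis by simp
qed

text \<open>
  The functional \<open>z \<mapsto> trace ((a P - P a) z)\<close>.
\<close>

definition D :: "('a \<Rightarrow> 'a) \<Rightarrow> ('a \<Rightarrow> 'a) \<Rightarrow> complex" where
  "D a = (\<lambda>z\<in>Zcarrier. lim (\<lambda>k. trunc_trace k (\<lambda>x. commutator a (z x))))"

text \<open>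
  The difference of two truncated traces is a truncated trace of the commutator with a tail of
  \<open>a\<close>, and the tails of an approximable operator tend to zero in norm.
\<close>

lemma D_tendsto:
  assumes a: "a \<in> carrier A" and z: "z \<in> Zcarrier"
  shows "(\<lambda>k. trunc_trace k (\<lambda>x. commutator a (z x))) \<longlonglongrightarrow> D a z"
proof -
  let ?t = "\<lambda>k. trunc_trace k (\<lambda>x. commutator a (z x))"
  note aL = A_L[OF a] and zL = Zcarrier_L[OF z]
  have d: "cmod (?t k - ?t l) \<le> 2 * vnorm L (tail l a) * factor_norm z" if "k \<ge> l" for k l
    using trunc_trace_commutator_bound[OF bounded_by_id tail_L[OF aL] z, of k l] trunc_trace_commutator_diff[OF aL zL that] by simp
  have "(\<lambda>l. 2 * vnorm L (tail l a) * factor_norm z) \<longlonglongrightarrow> 2 * 0 * factor_norm z"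
    by (intro tendsto_intros A_tail a)
  then have lim0: "(\<lambda>l. 2 * vnorm L (tail l a) * factor_norm z) \<longlonglongrightarrow> 0" by simp
  have "Cauchy ?t"
  proof (rule CauchyI')
    fix e :: real assume e: "e > 0"
    obtain N where N: "\<forall>l\<ge>N. norm (2 * vnorm L (tail l a) * factor_norm z - 0) < e"
      using LIMSEQ_D[OF lim0 e] by (rule exE)
    have "norm (?t m - ?t n) < e" if "m \<ge> N" "n > m" for m n
    proof -
      have "norm (?t m - ?t n) = norm (?t n - ?t m)" by (rule norm_minus_commute)
      also have "\<dots> \<le> 2 * vnorm L (tail m a) * factor_norm z" using that by (intro d) simp
      also have "\<dots> < e" using N[rule_format, OF that(1)] by simp
      finally show ?thesis .
    qed
    then show "\<exists>M. \<forall>m\<ge>M. \<forall>n>m. dist (?t m) (?t n) < e" unfolding dist_norm by blast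
  qed
  then have "?t \<longlonglongrightarrow> lim ?t" by (intro convergent_LIMSEQ_iff[THEN iffD1] Cauchy_convergent)
  moreover have "D a z = lim ?t" using z by (simp add: D_def)
  ultimately show ?thesis by simp
qed

lemma D_eqI: "a \<in> carrier A \<Longrightarrow> z \<in> Zcarrier \<Longrightarrow> (\<lambda>k. trunc_trace k (\<lambda>x. commutator a (z x))) \<longlonglongrightarrow> s \<Longrightarrow> D a z = s"
  using D_tendsto LIMSEQ_unique by blast

lemma D_bound:
  assumes "a \<in> carrier A" "z \<in> Zcarrier"
  shows "cmod (D a z) \<le> 2 * vnorm L a * factor_norm z"
proof (rule LIMSEQ_le_const2[OF tendsto_norm[OF D_tendsto[OF assms]]], intro exI allI impI)
  show "norm (trunc_trace k (\<lambda>x. commutator a (z x))) \<le> 2 * vnorm L a * factor_norm z" for k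
    using trunc_trace_commutator_bound[OF bounded_by_id A_L[OF assms(1)] assms(2), of k] by simp
qed

lemma D_add_right:
  assumes a: "a \<in> carrier A" and z: "z1 \<in> Zcarrier" "z2 \<in> Zcarrier"
  shows "D a (z1 \<oplus>\<^bsub>L\<^esub> z2) = D a z1 + D a z2"
proof (rule D_eqI[OF a Zcarrier_add[OF z]])
  show "(\<lambda>k. trunc_trace k (\<lambda>x. commutator a ((z1 \<oplus>\<^bsub>L\<^esub> z2) x))) \<longlonglongrightarrow> D a z1 + D a z2"
    unfolding trunc_trace_w_add[OF bounded_by_commutator[OF A_L[OF a]] Zcarrier_L[OF z(1)] Zcarrier_L[OF z(2)]]
    by (intro tendsto_add D_tendsto a z)
qed

lemma D_smult_right:
  assumes a: "a \<in> carrier A" and z: "z \<in> Zcarrier"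
  shows "D a (c \<odot>\<^bsub>L\<^esub> z) = c * D a z"
proof (rule D_eqI[OF a Zcarrier_smult[OF z]])
  show "(\<lambda>k. trunc_trace k (\<lambda>x. commutator a ((c \<odot>\<^bsub>L\<^esub> z) x))) \<longlonglongrightarrow> c * D a z"
    unfolding trunc_trace_w_smult[OF bounded_by_commutator[OF A_L[OF a]] Zcarrier_L[OF z]]
    by (intro tendsto_mult tendsto_const D_tendsto a z)
qed

lemma D_add_left:
  assumes a: "a \<in> carrier A" "b \<in> carrier A" and z: "z \<in> Zcarrier"
  shows "D (a \<oplus>\<^bsub>L\<^esub> b) z = D a z + D b z"
proof (rule D_eqI[OF A_add[OF a] z])
  note ab = A_L[OF a(1)] A_L[OF a(2)]
  have cma: "commutator (a \<oplus>\<^bsub>L\<^esub> b) x = commutator a x \<oplus> commutator b x" if "x \<in> carrier V" for x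
    using that ab L_add_closed[OF ab] by (intro coord_eqI) (auto simp: coord_commutator coord_add simp del: operator_space_simps, auto simp: coord_add)
  have "trunc_trace k (\<lambda>x. commutator (a \<oplus>\<^bsub>L\<^esub> b) (z x)) = trunc_trace k (\<lambda>x. commutator a (z x)) + trunc_trace k (\<lambda>x. commutator b (z x))" for k
  proof -
    have "trunc_trace k (\<lambda>x. commutator (a \<oplus>\<^bsub>L\<^esub> b) (z x)) = trunc_trace k (\<lambda>x. commutator a (z x) \<oplus> commutator b (z x))"
      using Zcarrier_L[OF z] by (intro trunc_trace_cong cma) simp
    also have "\<dots> = trunc_trace k (\<lambda>x. commutator a (z x)) + trunc_trace k (\<lambda>x. commutator b (z x))"
      using Zcarrier_L[OF z] ab by (intro trunc_trace_add) auto
    finally show ?thesis .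
  qed
  then show "(\<lambda>k. trunc_trace k (\<lambda>x. commutator (a \<oplus>\<^bsub>L\<^esub> b) (z x))) \<longlonglongrightarrow> D a z + D b z"
    using tendsto_add[OF D_tendsto[OF a(1) z] D_tendsto[OF a(2) z]] by (simp del: operator_space_simps)
qed

lemma D_smult_left:
  assumes a: "a \<in> carrier A" and z: "z \<in> Zcarrier"
  shows "D (c \<odot>\<^bsub>L\<^esub> a) z = c * D a z"
proof (rule D_eqI[OF A_smult[OF a] z])
  note aL = A_L[OF a]
  have cma: "commutator (c \<odot>\<^bsub>L\<^esub> a) x = c \<odot> commutator a x" if "x \<in> carrier V" for x
    using that aL L_smult_closed[OF aL] by (intro coord_eqI) (auto simp: coord_commutator coord_smult simp del: operator_space_simps, auto simp: coord_smult)
  have "trunc_trace k (\<lambda>x. commutator (c \<odot>\<^bsub>L\<^esub> a) (z x)) = c * trunc_trace k (\<lambda>x. commutator a (z x))" for k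
  proof -
    have "trunc_trace k (\<lambda>x. commutator (c \<odot>\<^bsub>L\<^esub> a) (z x)) = trunc_trace k (\<lambda>x. c \<odot> commutator a (z x))"
      using Zcarrier_L[OF z] by (intro trunc_trace_cong cma) simp
    also have "\<dots> = c * trunc_trace k (\<lambda>x. commutator a (z x))"
      using Zcarrier_L[OF z] aL by (intro trunc_trace_smult) auto
    finally show ?thesis .
  qed
  then show "(\<lambda>k. trunc_trace k (\<lambda>x. commutator (c \<odot>\<^bsub>L\<^esub> a) (z x))) \<longlonglongrightarrow> c * D a z"
    using tendsto_mult[OF tendsto_const D_tendsto[OF a z], of c] by (simp del: operator_space_simps)
qed

text \<open>
  From \<open>(a b) P - P (a b) = a (b P - P b) + (a P - P a) b\<close>. What remains to be shown is that
  the trace of \<open>a (b P - P b) z\<close> is that of \<open>(b P - P b) z a\<close>. This holds in the limit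
  if the commutator is cut off at \<open>I l\<close>, by \<open>trunc_trace_commute\<close>, and the error is
  controlled by the tail of \<open>b\<close>.
\<close>

lemma D_mult:
  assumes a: "a \<in> carrier A" and b: "b \<in> carrier A" and z: "z \<in> Zcarrier"
  shows "D (compose (carrier V) a b) z = D b (rmod z a) + D a (lmod b z)"
proof -
  note aL = A_L[OF a] and bL = A_L[OF b] and zL = Zcarrier_L[OF z]
  note ab = A_comp[OF a bL] and bz = Z_left(1)[OF bL z] and za = Z_right(1)[OF aL z]
  define X where "X = D (compose (carrier V) a b) z - D a (lmod b z)"
  let ?T = "\<lambda>k. trunc_trace k (\<lambda>x. a (commutator b (z x)))"
  have cmab: "commutator (compose (carrier V) a b) x = a (commutator b x) \<oplus> commutator a (b x)" if "x \<in> carrier V" for x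
    using that aL bL A_L[OF ab]
    by (intro coord_eqI) (auto simp: commutator_eq coord_add coord_minus bounded_by_minus[OF bounded_by_L[OF aL]])
  have "?T k = trunc_trace k (\<lambda>x. commutator (compose (carrier V) a b) (z x)) - trunc_trace k (\<lambda>x. commutator a (lmod b z x))" for k
  proof -
    have "trunc_trace k (\<lambda>x. commutator (compose (carrier V) a b) (z x)) = trunc_trace k (\<lambda>x. a (commutator b (z x)) \<oplus> commutator a (b (z x)))"
      using zL by (intro trunc_trace_cong cmab) simp
    also have "\<dots> = ?T k + trunc_trace k (\<lambda>x. commutator a (b (z x)))"
      using zL aL bL by (intro trunc_trace_add) auto
    also have "trunc_trace k (\<lambda>x. commutator a (b (z x))) = trunc_trace k (\<lambda>x. commutator a (lmod b z x))"
      by (rule trunc_trace_cong) simp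
    finally show ?thesis by simp
  qed
  then have T: "?T \<longlonglongrightarrow> X"
    using tendsto_diff[OF D_tendsto[OF ab z] D_tendsto[OF a bz]] by (simp add: X_def)
  have close: "cmod (X - trunc_trace l (\<lambda>x. commutator b (rmod z a x))) \<le> 2 * vnorm L a * vnorm L (tail l b) * factor_norm z" for l
  proof -
    have "(\<lambda>k. trunc_trace k (\<lambda>x. a (cut (I l) (commutator b (z x))))) \<longlonglongrightarrow> trunc_trace l (\<lambda>x. commutator b (z (a x)))"
      by (rule trunc_trace_commute[OF bounded_by_L[OF aL] bounded_by_comp[OF bounded_by_commutator[OF bL] bounded_by_L[OF zL]]])
    moreover have "trunc_trace l (\<lambda>x. commutator b (z (a x))) = trunc_trace l (\<lambda>x. commutator b (rmod z a x))" by (rule trunc_trace_cong) simp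
    ultimately have "(\<lambda>k. cmod (?T k - trunc_trace k (\<lambda>x. a (cut (I l) (commutator b (z x)))))) \<longlonglongrightarrow> cmod (X - trunc_trace l (\<lambda>x. commutator b (rmod z a x)))"
      by (intro tendsto_norm tendsto_diff T) simp
    moreover have "cmod (?T k - trunc_trace k (\<lambda>x. a (cut (I l) (commutator b (z x))))) \<le> 2 * vnorm L a * vnorm L (tail l b) * factor_norm z" for k
    proof -
      have "?T k - trunc_trace k (\<lambda>x. a (cut (I l) (commutator b (z x)))) = trunc_trace k (\<lambda>x. a (commutator b (z x)) \<ominus> a (cut (I l) (commutator b (z x))))"
        using aL bL zL by (intro trunc_trace_minus[symmetric]) auto
      also have "\<dots> = trunc_trace k (\<lambda>x. a (commutator (tail l b) (z x)))"
        using aL bL zL by (intro trunc_trace_cong) (simp add: commutator_split flip: bounded_by_minus[OF bounded_by_L[OF aL]])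
      finally show ?thesis using trunc_trace_commutator_bound[OF bounded_by_L[OF aL] tail_L[OF bL] z, of k l] by simp
    qed
    ultimately show ?thesis by (intro LIMSEQ_le_const2) auto
  qed
  have "(\<lambda>l. 2 * vnorm L a * vnorm L (tail l b) * factor_norm z) \<longlonglongrightarrow> 2 * vnorm L a * 0 * factor_norm z"
    by (intro tendsto_intros A_tail b)
  then have "(\<lambda>l. 2 * vnorm L a * vnorm L (tail l b) * factor_norm z) \<longlonglongrightarrow> 0" by simp
  with close have "(\<lambda>l. X - trunc_trace l (\<lambda>x. commutator b (rmod z a x))) \<longlonglongrightarrow> 0"
    by (rule Lim_null_comparison[OF always_eventually[OF allI]])
  moreover have "(\<lambda>l. X - trunc_trace l (\<lambda>x. commutator b (rmod z a x))) \<longlonglongrightarrow> X - D b (rmod z a)"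
    by (intro tendsto_diff tendsto_const D_tendsto b za)
  ultimately have "X - D b (rmod z a) = 0" using LIMSEQ_unique by blast
  then show ?thesis by (simp add: X_def diff_eq_eq)
qed

sublocale ZD: normed_pair Z complex_line
  by (intro normed_pair.intro normed_cspace_Z normed_cspace_complex_line)

lemma D_dual: "a \<in> carrier A \<Longrightarrow> D a \<in> carrier (dual_space Z)"
proof (rule ZD.L_I)
  assume a: "a \<in> carrier A"
  show "D a \<in> extensional (carrier Z)" by (simp add: D_def)
  show "clinear_map Z complex_line (D a)"
    by (rule clinear_mapI) (simp_all add: D_add_right[OF a] D_smult_right[OF a] del: operator_space_simps)
  fix z assume z: "z \<in> carrier Z"
  have "cmod (D a z) \<le> 2 * vnorm L a * factor_norm z" using D_bound[OF a] z by simp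
  also have "\<dots> \<le> 2 * vnorm L a * vnorm Z z"
    using z vnorm_L_nonneg[OF A_L[OF a]] vnorm_L_nonneg[OF Zcarrier_L] by (intro mult_left_mono) auto
  finally show "vnorm complex_line (D a z) \<le> 2 * vnorm L a * vnorm Z z" by simp
qed

lemma derivation_D: "derivation A (dual_space Z) (dual_lact Z rmod) (dual_ract Z lmod) D"
  unfolding derivation_def
proof (intro conjI ballI)
  show "clinear_map A (dual_space Z) D"
  proof (rule clinear_mapI)
    fix a b assume "a \<in> carrier A" "b \<in> carrier A"
    then show "D (a \<oplus>\<^bsub>A\<^esub> b) = D a \<oplus>\<^bsub>dual_space Z\<^esub> D b"
      using D_dual[of a] D_dual[of b]
      by (intro ZD.L_ext D_dual ZD.L_add_closed) (auto simp: A_add D_add_left simp del: operator_space_simps(2), simp add: D_add_left)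
  next
    fix c a assume "a \<in> carrier A"
    then show "D (c \<odot>\<^bsub>A\<^esub> a) = c \<odot>\<^bsub>dual_space Z\<^esub> D a"
      by (intro ZD.L_ext D_dual ZD.L_smult_closed) (auto simp: A_smult D_smult_left simp del: operator_space_simps(3), simp add: D_smult_left)
  qed (rule D_dual)
  fix a b assume a: "a \<in> carrier A" and b: "b \<in> carrier A"
  show "D (a \<otimes>\<^bsub>A\<^esub> b) = dual_lact Z rmod a (D b) \<oplus>\<^bsub>dual_space Z\<^esub> dual_ract Z lmod (D a) b"
  proof (rule extensionalityI[of _ Zcarrier])
    show "D (a \<otimes>\<^bsub>A\<^esub> b) z = (dual_lact Z rmod a (D b) \<oplus>\<^bsub>dual_space Z\<^esub> dual_ract Z lmod (D a) b) z" if "z \<in> Zcarrier" for z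
      using that D_mult[OF a b that] by (simp add: dual_lact_def dual_ract_def)
  qed (auto simp: D_def)
qed

lemma continuous_D: "continuous_map (norm_topology A) (norm_topology (dual_space Z)) D"
proof -
  interpret AD: normed_pair A "dual_space Z" by (intro normed_pair.intro normed_cspace_A ZD.normed_cspace_L)
  show ?thesis
  proof (rule AD.continuous_map_of_bounded[where K = 2])
    fix a b assume a: "a \<in> carrier A" and b: "b \<in> carrier A"
    have ab: "a \<ominus>\<^bsub>L\<^esub> b \<in> carrier A" using A.M.minus_closed[OF a b] by (simp add: A_minus[OF a b])
    have "vnorm (dual_space Z) (D a \<ominus>\<^bsub>dual_space Z\<^esub> D b) \<le> 2 * vnorm L (a \<ominus>\<^bsub>L\<^esub> b)"
    proof (rule ZD.vnorm_L_le)
      show "0 \<le> 2 * vnorm L (a \<ominus>\<^bsub>L\<^esub> b)" using vnorm_L_nonneg[OF A_L[OF ab]] by simp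
      fix z assume "z \<in> carrier Z"
      then have z: "z \<in> Zcarrier" by simp
      have "D (a \<ominus>\<^bsub>L\<^esub> b) z = D a z - D b z"
        unfolding L.a_minus_eq[OF A_L[OF a] A_L[OF b]] D_add_left[OF a A_smult[OF b] z] D_smult_left[OF b z] by simp
      moreover have "(D a \<ominus>\<^bsub>dual_space Z\<^esub> D b) z = D a z - D b z"
        using ZD.L_minus[OF D_dual[OF a] D_dual[OF b], of z] z by simp
      ultimately have "vnorm complex_line ((D a \<ominus>\<^bsub>dual_space Z\<^esub> D b) z) = cmod (D (a \<ominus>\<^bsub>L\<^esub> b) z)" by simp
      also have "\<dots> \<le> 2 * vnorm L (a \<ominus>\<^bsub>L\<^esub> b) * factor_norm z" by (rule D_bound[OF ab z])
      also have "\<dots> \<le> 2 * vnorm L (a \<ominus>\<^bsub>L\<^esub> b) * vnorm Z z"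
        using vnorm_L_nonneg[OF A_L[OF ab]] vnorm_L_nonneg[OF Zcarrier_L[OF z]] by (intro mult_left_mono) auto
      finally show "vnorm complex_line ((D a \<ominus>\<^bsub>dual_space Z\<^esub> D b) z) \<le> 2 * vnorm L (a \<ominus>\<^bsub>L\<^esub> b) * vnorm Z z" .
    qed
    then show "vnorm (dual_space Z) (D a \<ominus>\<^bsub>dual_space Z\<^esub> D b) \<le> 2 * vnorm A (a \<ominus>\<^bsub>A\<^esub> b)"
      by (simp add: A_minus[OF a b])
  qed (auto simp: D_dual)
qed

end

section \<open>A criterion for non-amenability\<close>

context split_basis
begin

definition matrix_unit :: "'i \<Rightarrow> 'i \<Rightarrow> 'a \<Rightarrow> 'a" where
  "matrix_unit i j = (\<lambda>x\<in>carrier V. coord i x \<odot> bas j)"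

lemma matrix_unit_app [simp]: "x \<in> carrier V \<Longrightarrow> matrix_unit i j x = coord i x \<odot> bas j"
  by (simp add: matrix_unit_def)

lemma matrix_unit_bounded_by: "bounded_by 1 (\<lambda>x. coord i x \<odot> bas j)"
proof (rule bounded_byI)
  fix x assume x: "x \<in> carrier V"
  have "cmod (coord i x) * vnorm V (bas j) \<le> vnorm V x * 1"
    using x coord_le[OF x] vnorm_bas by (intro mult_mono) auto
  then show "vnorm V (coord i x \<odot> bas j) \<le> 1 * vnorm V x" by (simp add: vnorm_smult)
qed (auto simp: coord_add coord_smult smult_distr_l smult_times)

lemma matrix_unit_L: "matrix_unit i j \<in> carrier L"
  unfolding matrix_unit_def by (rule L_of_bounded_by[OF matrix_unit_bounded_by])

lemma matrix_unit_A: "matrix_unit i j \<in> carrier A"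
  unfolding carrier_A
proof
  obtain k0 where "j \<in> I k0" using I_cover by blast
  then have j: "j \<in> I k" if "k \<ge> k0" for k using I_mono[OF that] by auto
  have "vnorm L (tail k (matrix_unit i j)) = 0" if "k \<ge> k0" for k
  proof -
    have "vnorm V (tail k (matrix_unit i j) x) \<le> 0 * vnorm V x" if x: "x \<in> carrier V" for x
    proof -
      have "tail k (matrix_unit i j) x = \<zero>"
        using x j[OF \<open>k \<ge> k0\<close>] by (intro coord_eqI) (auto simp: tail_app coord_cut coord_smult coord_bas)
      then show ?thesis by simp
    qed
    then have "vnorm L (tail k (matrix_unit i j)) \<le> 0" by (intro vnorm_L_le) auto
    then show ?thesis using vnorm_L_nonneg[OF tail_L[OF matrix_unit_L]] by (intro order_antisym)
  qed
  then have "\<forall>\<^sub>F k in sequentially. vnorm L (tail k (matrix_unit i j)) = 0"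
    using eventually_sequentially by blast
  then show "(\<lambda>k. vnorm L (tail k (matrix_unit i j))) \<longlonglongrightarrow> 0" by (rule tendsto_eventually)
qed (rule matrix_unit_L)

lemma trunc_trace_matrix_unit: "bounded_by M w \<Longrightarrow> trunc_trace k (\<lambda>x. w (matrix_unit i j x)) = (if i \<in> I k then coord i (w (bas j)) else 0)"
proof -
  assume w: "bounded_by M w"
  have "trunc_trace k (\<lambda>x. w (matrix_unit i j x)) = (\<Sum>r\<in>I k. if r = i then coord r (w (bas j)) else 0)"
    unfolding trunc_trace_def by (intro sum.cong) (auto simp: coord_bas bounded_byD[OF w] coord_smult)
  then show ?thesis using finite_I[of k] by simp
qed

lemma matrix_unit_Zcarrier: "matrix_unit i j \<in> Zcarrier"
proof (rule Zcarrier_I[OF matrix_unit_L])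
  fix k w assume w: "w \<in> factored"
  note bw = factored_bounded_by[OF w]
  have "cmod (coord i (w (bas j))) \<le> vnorm V (w (bas j))" by (intro coord_le) (simp add: bounded_byD[OF bw])
  also have "\<dots> \<le> 1 * vnorm V (bas j)" by (rule bounded_byD(5)[OF bw]) simp
  also have "\<dots> \<le> 1" using vnorm_bas by simp
  finally show "cmod (trunc_trace k (\<lambda>x. w (matrix_unit i j x))) \<le> 1" by (simp add: trunc_trace_matrix_unit[OF bw])
qed

definition cutop :: "'i set \<Rightarrow> 'a \<Rightarrow> 'a" where
  "cutop J = (\<lambda>x\<in>carrier V. cut J x)"

lemma cutop_app [simp]: "x \<in> carrier V \<Longrightarrow> cutop J x = cut J x"
  by (simp add: cutop_def)

lemma cutop_L: "cutop J \<in> carrier L" and vnorm_cutop: "vnorm L (cutop J) \<le> 1"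
  unfolding cutop_def using L_of_bounded_by[OF bounded_by_cut] vnorm_L_of_bounded_by[OF bounded_by_cut] by auto

lemma cutop_empty: "cutop {} = \<zero>\<^bsub>L\<^esub>"
proof (rule L_ext[OF cutop_L L_zero_closed])
  fix x assume "x \<in> carrier V"
  then show "cutop {} x = \<zero>\<^bsub>L\<^esub> x" by (intro coord_eqI) (auto simp: coord_cut)
qed

lemma cutop_insert: "j \<notin> J \<Longrightarrow> cutop (insert j J) = matrix_unit j j \<oplus>\<^bsub>L\<^esub> cutop J"
proof (rule L_ext[OF cutop_L L_add_closed[OF matrix_unit_L cutop_L]])
  fix x assume "j \<notin> J" "x \<in> carrier V"
  then show "cutop (insert j J) x = (matrix_unit j j \<oplus>\<^bsub>L\<^esub> cutop J) x"
    by (intro coord_eqI) (auto simp: coord_cut coord_add coord_smult coord_bas)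
qed

lemma cutop_functional:
  assumes m: "m \<in> carrier (dual_space Z)" and "finite J"
  shows "cutop J \<in> Zcarrier \<and> m (cutop J) = (\<Sum>j\<in>J. m (matrix_unit j j))"
  using \<open>finite J\<close>
proof (induction J rule: finite_induct)
  case empty
  show ?case using ZD.clinear_zero[OF ZD.L_clinear[OF m]] Zcarrier_zero by (simp add: cutop_empty del: operator_space_simps)
next
  case (insert j J)
  then have J: "cutop J \<in> Zcarrier" and mJ: "m (cutop J) = (\<Sum>j\<in>J. m (matrix_unit j j))" by auto
  have "m (matrix_unit j j \<oplus>\<^bsub>L\<^esub> cutop J) = m (matrix_unit j j) + m (cutop J)"
    using ZD.L_add[OF m, of "matrix_unit j j" "cutop J"] J matrix_unit_Zcarrier by (simp del: operator_space_simps)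
  then show ?case
    using insert(1,2) mJ Zcarrier_add[OF matrix_unit_Zcarrier J] by (simp add: cutop_insert del: operator_space_simps)
qed

lemma factor_norm_cutop_le:
  assumes J: "finite J" and le: "\<And>w k. w \<in> factored \<Longrightarrow> cmod (\<Sum>i\<in>I k \<inter> J. coord i (w (bas i))) \<le> K"
  shows "factor_norm (cutop J) \<le> K"
proof (rule Zcarrier_I(2)[OF cutop_L])
  fix k w assume w: "w \<in> factored"
  note bw = factored_bounded_by[OF w]
  have cb: "cut J (bas i) = (if i \<in> J then bas i else \<zero>)" for i
    by (rule coord_eqI) (auto simp: coord_cut coord_bas)
  have "trunc_trace k (\<lambda>x. w (cutop J x)) = (\<Sum>i\<in>I k. if i \<in> J then coord i (w (bas i)) else 0)"
    unfolding trunc_trace_def by (intro sum.cong) (auto simp: cb bounded_by_zero[OF bw])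
  also have "\<dots> = (\<Sum>i\<in>I k \<inter> J. coord i (w (bas i)))"
    using finite_I[of k] by (simp add: sum.inter_restrict)
  finally show "cmod (trunc_trace k (\<lambda>x. w (cutop J x))) \<le> K" using le[OF w, of k] by simp
qed

text \<open>
  For indices in different summands, the commutator of a matrix unit with the projection is that matrix
  unit again, and its product with the transposed matrix unit has trace 1.
\<close>

lemma D_matrix_unit: "i \<in> P \<Longrightarrow> j \<notin> P \<Longrightarrow> D (matrix_unit i j) (matrix_unit j i) = 1"
proof (rule D_eqI[OF matrix_unit_A matrix_unit_Zcarrier])
  assume ij: "i \<in> P" "j \<notin> P"
  obtain k0 where "j \<in> I k0" using I_cover by blast
  then have j: "j \<in> I k" if "k \<ge> k0" for k using I_mono[OF that] by auto
  have "commutator (matrix_unit i j) (bas i) = bas j"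
    using ij by (intro coord_eqI commutator_in matrix_unit_L) (auto simp: coord_commutator[OF matrix_unit_L] coord_cut coord_smult coord_bas)
  then have eq: "trunc_trace k (\<lambda>x. commutator (matrix_unit i j) (matrix_unit j i x)) = (if j \<in> I k then 1 else 0)" for k
    by (simp add: trunc_trace_matrix_unit[OF bounded_by_commutator[OF matrix_unit_L]] coord_bas del: matrix_unit_app)
  have "\<forall>\<^sub>F k in sequentially. trunc_trace k (\<lambda>x. commutator (matrix_unit i j) (matrix_unit j i x)) = 1"
    unfolding eventually_sequentially eq using j by auto
  then show "(\<lambda>k. trunc_trace k (\<lambda>x. commutator (matrix_unit i j) (matrix_unit j i x))) \<longlonglongrightarrow> 1" by (rule tendsto_eventually)
qed

lemma comp_matrix_unit: "compose (carrier V) (matrix_unit j i) (matrix_unit i j) = matrix_unit i i"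
  by (rule L_ext[OF comp_L[OF matrix_unit_L matrix_unit_L] matrix_unit_L]) (simp add: coord_smult coord_bas)

text \<open>
  The hypothesis says that the projections onto \<open>J\<close> and \<open>K\<close> have norms in \<open>Z\<close> that
  are small compared with their ranks. If \<open>m\<close> implements \<open>D\<close>, then the values of
  \<open>m\<close> at these two projections differ by the rank, which is too much.
\<close>

theorem not_amenable:
  assumes hyp: "\<And>e. e > 0 \<Longrightarrow> \<exists>J K. finite J \<and> finite K \<and> J \<subseteq> P \<and> K \<subseteq> - P \<and> card J = card K \<and> 1 \<le> e * real (card J) \<and>
     (\<forall>w\<in>factored. \<forall>k. cmod (\<Sum>i\<in>I k \<inter> J. coord i (w (bas i))) \<le> e * real (card J) \<and>
        cmod (\<Sum>i\<in>I k \<inter> K. coord i (w (bas i))) \<le> e * real (card J))"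
  shows "\<not> amenable A"
proof
  assume "amenable A"
  then have "inner_derivation A (dual_space Z) (dual_lact Z rmod) (dual_ract Z lmod) D"
    using banach_bimodule_Z derivation_D continuous_D unfolding amenable_def by blast
  then obtain m where m: "m \<in> carrier (dual_space Z)"
    and inner: "\<And>a. a \<in> carrier A \<Longrightarrow> D a = dual_lact Z rmod a m \<ominus>\<^bsub>dual_space Z\<^esub> dual_ract Z lmod m a"
    unfolding inner_derivation_def by blast
  have mlin: "m (x \<oplus>\<^bsub>L\<^esub> y) = m x + m y" "m (c \<odot>\<^bsub>L\<^esub> x) = c * m x" if "x \<in> Zcarrier" "y \<in> Zcarrier" for x y c
    using ZD.L_add[OF m, of x y] ZD.L_smult[OF m, of x c] that by (simp_all del: operator_space_simps)
  define M where "M = vnorm (dual_space Z) m"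
  have M0: "M \<ge> 0" unfolding M_def by (rule ZD.vnorm_L_nonneg[OF m])
  have mbound: "cmod (m z) \<le> M * (vnorm L z + factor_norm z)" if "z \<in> Zcarrier" for z
    using ZD.L_bound[OF m, of z] that by (simp add: M_def)
  have diff: "m (matrix_unit i i) - m (matrix_unit j j) = 1" if ij: "i \<in> P" "j \<notin> P" for i j
  proof -
    let ?a = "matrix_unit i j" and ?z = "matrix_unit j i"
    have l: "dual_lact Z rmod ?a m \<in> carrier (dual_space Z)"
    proof (rule ZD.L_I[where K = "M * vnorm L ?a"])
      fix z assume "z \<in> carrier Z"
      then have z: "z \<in> Zcarrier" by simp
      have "cmod (m (rmod z ?a)) \<le> M * (vnorm L (rmod z ?a) + factor_norm (rmod z ?a))"
        by (rule mbound[OF Z_right(1)[OF matrix_unit_L z]])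
      also have "\<dots> \<le> M * (vnorm L z * vnorm L ?a + vnorm L ?a * factor_norm z)"
        using M0 by (intro mult_left_mono add_mono vnorm_comp Z_right matrix_unit_L z Zcarrier_L[OF z])
      finally show "vnorm complex_line (dual_lact Z rmod ?a m z) \<le> M * vnorm L ?a * vnorm Z z"
        using z by (simp add: dual_lact_def algebra_simps)
    qed (use m in \<open>auto simp: dual_lact_def Zcarrier_add Zcarrier_smult comp_add_left comp_smult_left Zcarrier_L matrix_unit_L mlin Z_right(1)[OF matrix_unit_L] simp del: operator_space_simps intro!: clinear_mapI\<close>)
    have r: "dual_ract Z lmod m ?a \<in> carrier (dual_space Z)"
    proof (rule ZD.L_I[where K = "M * vnorm L ?a"])
      fix z assume "z \<in> carrier Z"
      then have z: "z \<in> Zcarrier" by simp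
      have "cmod (m (lmod ?a z)) \<le> M * (vnorm L (lmod ?a z) + factor_norm (lmod ?a z))"
        by (rule mbound[OF Z_left(1)[OF matrix_unit_L z]])
      also have "\<dots> \<le> M * (vnorm L ?a * vnorm L z + vnorm L ?a * factor_norm z)"
        using M0 by (intro mult_left_mono add_mono vnorm_comp Z_left matrix_unit_L z Zcarrier_L[OF z])
      finally show "vnorm complex_line (dual_ract Z lmod m ?a z) \<le> M * vnorm L ?a * vnorm Z z"
        using z by (simp add: dual_ract_def algebra_simps)
    qed (use m in \<open>auto simp: dual_ract_def Zcarrier_add Zcarrier_smult comp_add_right comp_smult_right Zcarrier_L matrix_unit_L mlin Z_left(1)[OF matrix_unit_L] simp del: operator_space_simps intro!: clinear_mapI\<close>)
    have "D ?a ?z = dual_lact Z rmod ?a m ?z - dual_ract Z lmod m ?a ?z"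
      using ZD.L_minus[OF l r, of ?z] matrix_unit_Zcarrier inner[OF matrix_unit_A] by simp
    also have "\<dots> = m (matrix_unit i i) - m (matrix_unit j j)"
      using matrix_unit_Zcarrier by (simp add: dual_lact_def dual_ract_def comp_matrix_unit)
    finally show ?thesis using D_matrix_unit[OF ij] by simp
  qed
  \<comment> \<open>small enough for \<open>4 M e \<le> 1/2\<close> below\<close>
  define e where "e = 1 / (8 * (M + 1))"
  have e: "e > 0" using M0 by (simp add: e_def)
  obtain J K where J: "finite J" "J \<subseteq> P" and K: "finite K" "K \<subseteq> - P" and card: "card J = card K" "1 \<le> e * real (card J)"
    and le: "\<And>w k. w \<in> factored \<Longrightarrow> cmod (\<Sum>i\<in>I k \<inter> J. coord i (w (bas i))) \<le> e * real (card J)"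
      "\<And>w k. w \<in> factored \<Longrightarrow> cmod (\<Sum>i\<in>I k \<inter> K. coord i (w (bas i))) \<le> e * real (card J)"
    using hyp[OF e] by blast
  define n where "n = real (card J)"
  have n: "1 \<le> e * n" "n \<ge> 0" using card by (auto simp: n_def)
  have small: "cmod (m (cutop T)) \<le> M * (2 * (e * n))"
    if T: "finite T" and zT: "factor_norm (cutop T) \<le> e * n" for T
  proof -
    have "cmod (m (cutop T)) \<le> M * (vnorm L (cutop T) + factor_norm (cutop T))"
      using cutop_functional[OF m T] by (intro mbound) simp
    also have "\<dots> \<le> M * (2 * (e * n))"
      using vnorm_cutop[of T] zT n M0 by (intro mult_left_mono) auto
    finally show ?thesis .
  qed
  obtain h where h: "bij_betw h J K" using finite_same_card_bij[OF J(1) K(1) card(1)] by blast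
  have "m (cutop J) - m (cutop K) = (\<Sum>j\<in>J. m (matrix_unit j j)) - (\<Sum>j\<in>K. m (matrix_unit j j))"
    using cutop_functional[OF m J(1)] cutop_functional[OF m K(1)] by simp
  also have "(\<Sum>j\<in>K. m (matrix_unit j j)) = (\<Sum>j\<in>J. m (matrix_unit (h j) (h j)))"
    using sum.reindex_bij_betw[OF h, of "\<lambda>j. m (matrix_unit j j)"] by simp
  also have "(\<Sum>j\<in>J. m (matrix_unit j j)) - (\<Sum>j\<in>J. m (matrix_unit (h j) (h j))) = (\<Sum>j\<in>J. m (matrix_unit j j) - m (matrix_unit (h j) (h j)))"
    by (rule sum_subtractf[symmetric])
  also have "\<dots> = (\<Sum>j\<in>J. 1)"
  proof (rule sum.cong[OF refl])
    fix j assume j: "j \<in> J"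
    then have "h j \<in> K" using h by (auto simp: bij_betw_def)
    then show "m (matrix_unit j j) - m (matrix_unit (h j) (h j)) = 1" using J K j by (intro diff) auto
  qed
  finally have "n = cmod (m (cutop J) - m (cutop K))" by (simp add: n_def)
  also have "\<dots> \<le> cmod (m (cutop J)) + cmod (m (cutop K))" by (rule norm_triangle_ineq4)
  also have "\<dots> \<le> M * (2 * (e * n)) + M * (2 * (e * n))"
    using factor_norm_cutop_le[OF J(1) le(1)] factor_norm_cutop_le[OF K(1) le(2)] unfolding n_def[symmetric]
    by (intro add_mono small J(1) K(1))
  also have "\<dots> = n * (4 * M * e)" by (simp only: mult_ac)
  also have "\<dots> \<le> n * (1/2)"
  proof (intro mult_left_mono n(2))
    show "4 * M * e \<le> 1/2" using M0 by (simp add: e_def divide_le_eq)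
  qed
  finally have "n \<le> 0" by simp
  then show False using n by simp
qed

end

section \<open>Sequence spaces and direct sums\<close>

lemma powr_convex_combination:
  fixes p u v s t :: real
  assumes p: "p \<ge> 1" and "u \<ge> 0" "v \<ge> 0" "s \<ge> 0" "t \<ge> 0" "s + t = 1"
  shows "(s * u + t * v) powr p \<le> s * u powr p + t * v powr p"
proof -
  have zero: "(s * w) powr p \<le> s * w powr p" if "0 \<le> s" "s \<le> 1" for s w :: real
  proof (cases "s = 0")
    case False
    have "s powr p \<le> s powr 1" using that p False by (intro powr_mono') auto
    then show ?thesis using that by (simp add: powr_mult mult_right_mono)
  qed simp
  show ?thesis
  proof (cases "u = 0 \<or> v = 0")
    case True
    then show ?thesis using assms zero[of s u] zero[of t v] by auto
  next
    case False
    have s: "s = 1 - t" using assms by simp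
    show ?thesis
      using convex_onD[OF powr_convex[OF p], of t u v] assms False unfolding s by simp
  qed
qed

text \<open>
  Convexity of \<open>t powr p\<close> applied to the convex combination of \<open>\<bar>x\<bar> / a\<close> and
  \<open>\<bar>y\<bar> / b\<close> with weights proportional to \<open>a\<close> and \<open>b\<close>.
\<close>

lemma Minkowski_finite:
  fixes x y :: "nat \<Rightarrow> complex"
  assumes p: "p \<ge> 1" and ab: "a > 0" "b > 0"
    and x: "(\<Sum>i<n. cmod (x i) powr p) \<le> a powr p" and y: "(\<Sum>i<n. cmod (y i) powr p) \<le> b powr p"
  shows "(\<Sum>i<n. cmod (x i + y i) powr p) \<le> (a + b) powr p"
proof -
  define s t where "s = a / (a + b)" and "t = b / (a + b)"
  have st: "s \<ge> 0" "t \<ge> 0" "s + t = 1" using ab by (auto simp: s_def t_def simp flip: add_divide_distrib)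
  have "cmod (x i + y i) powr p / (a + b) powr p \<le> s * (cmod (x i) powr p / a powr p) + t * (cmod (y i) powr p / b powr p)" for i
  proof -
    have "cmod (x i + y i) powr p / (a + b) powr p = (cmod (x i + y i) / (a + b)) powr p" by (rule powr_divide[symmetric])
    also have "\<dots> \<le> (s * (cmod (x i) / a) + t * (cmod (y i) / b)) powr p"
    proof (intro powr_mono2)
      have "s * (cmod (x i) / a) + t * (cmod (y i) / b) = (cmod (x i) + cmod (y i)) / (a + b)"
        using ab by (simp add: s_def t_def add_divide_distrib)
      then show "cmod (x i + y i) / (a + b) \<le> s * (cmod (x i) / a) + t * (cmod (y i) / b)"
        using ab norm_triangle_ineq[of "x i" "y i"] by (simp add: divide_right_mono)
    qed (use p ab in auto)
    also have "\<dots> \<le> s * (cmod (x i) / a) powr p + t * (cmod (y i) / b) powr p"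
      using ab st by (intro powr_convex_combination p) auto
    finally show ?thesis by (simp add: powr_divide)
  qed
  then have "(\<Sum>i<n. cmod (x i + y i) powr p / (a + b) powr p) \<le> (\<Sum>i<n. s * (cmod (x i) powr p / a powr p) + t * (cmod (y i) powr p / b powr p))"
    by (rule sum_mono)
  also have "\<dots> = s * ((\<Sum>i<n. cmod (x i) powr p) / a powr p) + t * ((\<Sum>i<n. cmod (y i) powr p) / b powr p)"
    by (simp add: sum.distrib sum_distrib_left sum_divide_distrib)
  also have "\<dots> \<le> s * 1 + t * 1"
    using x y ab st by (intro add_mono mult_left_mono) (auto simp: divide_le_eq)
  finally have "(\<Sum>i<n. cmod (x i + y i) powr p) / (a + b) powr p \<le> 1" using st by (simp add: sum_divide_distrib)
  then show ?thesis using ab by (simp add: divide_le_eq)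
qed

lemma ell_simps [simp]:
  "carrier (ell p) = {x. summable (\<lambda>n. cmod (x n) powr p)}" "zero (ell p) = (\<lambda>n. 0)"
  "add (ell p) = (\<lambda>x y n. x n + y n)" "Module.smult (ell p) = (\<lambda>c x n. c * x n)"
  by (simp_all add: ell_def)

lemma vnorm_ell: "vnorm (ell p) x = (\<Sum>n. cmod (x n) powr p) powr (1/p)"
  by (simp add: ell_def)

lemma vnorm_ell_nonneg: "0 \<le> vnorm (ell p) x"
  by (simp add: vnorm_ell)

text \<open>
  Together with \<open>ell_D\<close> this describes the norm by finite sums only.
\<close>

lemma ell_I:
  assumes p: "p > 0" and a: "a \<ge> 0" and le: "\<And>n. (\<Sum>i<n. cmod (x i) powr p) \<le> a powr p"
  shows "x \<in> carrier (ell p)" "vnorm (ell p) x \<le> a"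
proof -
  have s: "summable (\<lambda>n. cmod (x n) powr p)"
  proof (rule bounded_imp_summable[of _ "a powr p"])
    show "(\<Sum>k\<le>n. cmod (x k) powr p) \<le> a powr p" for n
      using le[of "Suc n"] by (simp only: lessThan_Suc_atMost)
  qed simp
  then show "x \<in> carrier (ell p)" by simp
  have "(\<Sum>n. cmod (x n) powr p) \<le> a powr p" by (rule suminf_le_const[OF s le])
  then have "vnorm (ell p) x \<le> (a powr p) powr (1/p)"
    unfolding vnorm_ell using p s by (intro powr_mono2 suminf_nonneg) auto
  then show "vnorm (ell p) x \<le> a" using p a by (simp add: powr_powr)
qed

lemma ell_D:
  assumes p: "p > 0" and x: "x \<in> carrier (ell p)"
  shows "(\<Sum>i<n. cmod (x i) powr p) \<le> vnorm (ell p) x powr p"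
proof -
  have "(\<Sum>i<n. cmod (x i) powr p) \<le> (\<Sum>n. cmod (x n) powr p)"
    using x by (intro sum_le_suminf) auto
  also have "\<dots> = vnorm (ell p) x powr p"
    using p x by (simp add: vnorm_ell powr_powr suminf_nonneg)
  finally show ?thesis .
qed

lemma ell_coord_le:
  assumes p: "p > 0" and x: "x \<in> carrier (ell p)"
  shows "cmod (x i) \<le> vnorm (ell p) x"
proof -
  have "cmod (x i) powr p \<le> (\<Sum>j<Suc i. cmod (x j) powr p)"
    by (intro member_le_sum[of i "{..<Suc i}" "\<lambda>j. cmod (x j) powr p"]) auto
  also have "\<dots> \<le> vnorm (ell p) x powr p" by (rule ell_D[OF p x])
  finally show ?thesis
    using powr_less_mono2[OF p vnorm_ell_nonneg[of p x], of "cmod (x i)"] by (meson not_le)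
qed

lemma ell_dominated:
  assumes p: "p > 0" and x: "x \<in> carrier (ell p)" and le: "\<And>i. cmod (y i) \<le> cmod (x i)"
  shows "y \<in> carrier (ell p)" "vnorm (ell p) y \<le> vnorm (ell p) x"
proof -
  have "(\<Sum>i<n. cmod (y i) powr p) \<le> vnorm (ell p) x powr p" for n
  proof -
    have "(\<Sum>i<n. cmod (y i) powr p) \<le> (\<Sum>i<n. cmod (x i) powr p)"
      using p le by (intro sum_mono powr_mono2) auto
    also have "\<dots> \<le> vnorm (ell p) x powr p" by (rule ell_D[OF p x])
    finally show ?thesis .
  qed
  from ell_I[OF p vnorm_ell_nonneg this] show "y \<in> carrier (ell p)" "vnorm (ell p) y \<le> vnorm (ell p) x" by auto
qed

lemma ell_add:
  assumes p: "p \<ge> 1" and x: "x \<in> carrier (ell p)" and y: "y \<in> carrier (ell p)"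
  shows "x \<oplus>\<^bsub>ell p\<^esub> y \<in> carrier (ell p)" "vnorm (ell p) (x \<oplus>\<^bsub>ell p\<^esub> y) \<le> vnorm (ell p) x + vnorm (ell p) y"
proof -
  have p0: "p > 0" using p by simp
  have e: "x \<oplus>\<^bsub>ell p\<^esub> y \<in> carrier (ell p) \<and> vnorm (ell p) (x \<oplus>\<^bsub>ell p\<^esub> y) \<le> vnorm (ell p) x + vnorm (ell p) y + e" if e: "e > 0" for e
  proof -
    define a b where "a = vnorm (ell p) x + e/2" and "b = vnorm (ell p) y + e/2"
    have ab: "a > 0" "b > 0" using e vnorm_ell_nonneg[of p x] vnorm_ell_nonneg[of p y] by (auto simp: a_def b_def)
    have "(\<Sum>i<n. cmod ((x \<oplus>\<^bsub>ell p\<^esub> y) i) powr p) \<le> (a + b) powr p" for n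
    proof -
      have "(\<Sum>i<n. cmod (x i) powr p) \<le> a powr p"
        by (rule order_trans[OF ell_D[OF p0 x] powr_mono2]) (use p e vnorm_ell_nonneg in \<open>auto simp: a_def\<close>)
      moreover have "(\<Sum>i<n. cmod (y i) powr p) \<le> b powr p"
        by (rule order_trans[OF ell_D[OF p0 y] powr_mono2]) (use p e vnorm_ell_nonneg in \<open>auto simp: b_def\<close>)
      ultimately show ?thesis using Minkowski_finite[OF p ab] by simp
    qed
    from ell_I[OF p0 _ this] ab show ?thesis by (simp add: a_def b_def)
  qed
  show "x \<oplus>\<^bsub>ell p\<^esub> y \<in> carrier (ell p)" using e[of 1] by simp
  show "vnorm (ell p) (x \<oplus>\<^bsub>ell p\<^esub> y) \<le> vnorm (ell p) x + vnorm (ell p) y"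
    by (rule field_le_epsilon) (use e in blast)
qed

lemma normed_cspace_ell:
  assumes p: "p \<ge> 1"
  shows "normed_cspace (ell p)"
proof (rule normed_cspaceI)
  fix x y assume "x \<in> carrier (ell p)" "y \<in> carrier (ell p)"
  then show "x \<oplus>\<^bsub>ell p\<^esub> y \<in> carrier (ell p)" "vnorm (ell p) (x \<oplus>\<^bsub>ell p\<^esub> y) \<le> vnorm (ell p) x + vnorm (ell p) y"
    using ell_add[OF p] by blast+
next
  fix x assume x: "x \<in> carrier (ell p)" and "vnorm (ell p) x = 0"
  then show "x = \<zero>\<^bsub>ell p\<^esub>" using ell_coord_le[OF _ x] p by (intro ext) simp
next
  fix c x assume x: "x \<in> carrier (ell p)"
  have "(\<lambda>n. cmod (c * x n) powr p) = (\<lambda>n. cmod c powr p * cmod (x n) powr p)"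
    by (simp add: norm_mult powr_mult)
  then show "c \<odot>\<^bsub>ell p\<^esub> x \<in> carrier (ell p)" "vnorm (ell p) (c \<odot>\<^bsub>ell p\<^esub> x) = cmod c * vnorm (ell p) x"
    using x p by (simp_all add: vnorm_ell summable_mult suminf_mult powr_mult powr_powr)
qed (auto simp: algebra_simps)

lemma ell_minus:
  assumes "p \<ge> 1" "x \<in> carrier (ell p)" "y \<in> carrier (ell p)"
  shows "x \<ominus>\<^bsub>ell p\<^esub> y = (\<lambda>n. x n - y n)"
  using normed_cspace.a_minus_eq[OF normed_cspace_ell[OF assms(1)] assms(2,3)] by (auto simp: fun_eq_iff)

lemma banach_cspace_ell:
  assumes p: "p \<ge> 1"
  shows "banach_cspace (ell p)"
proof -
  interpret E: normed_cspace "ell p" by (rule normed_cspace_ell[OF p])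
  have p0: "p > 0" using p by simp
  show ?thesis
  proof (rule E.banach_cspaceI)
    fix \<sigma> assume \<sigma>: "E.Cauchy_seq \<sigma>"
    then have \<sigma>E: "\<sigma> n \<in> carrier (ell p)" for n by (simp only: E.Cauchy_seq_def)
    have small: "\<exists>N. \<forall>m\<ge>N. \<forall>n\<ge>N. vnorm (ell p) (\<lambda>i. \<sigma> m i - \<sigma> n i) < e" if "e > 0" for e
      using \<sigma> that ell_minus[OF p \<sigma>E \<sigma>E] unfolding E.Cauchy_seq_def by simp
    have \<sigma>d: "(\<lambda>i. \<sigma> m i - \<sigma> n i) \<in> carrier (ell p)" for m n
      using E.M.minus_closed[OF \<sigma>E \<sigma>E, of m n] by (simp only: ell_minus[OF p \<sigma>E \<sigma>E])
    have "Cauchy (\<lambda>n. \<sigma> n i)" for i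
    proof (rule CauchyI)
      fix e :: real assume "e > 0"
      then obtain N where N: "\<forall>m\<ge>N. \<forall>n\<ge>N. vnorm (ell p) (\<lambda>i. \<sigma> m i - \<sigma> n i) < e" using small by blast
      have "norm (\<sigma> m i - \<sigma> n i) < e" if "m \<ge> N" "n \<ge> N" for m n
        using ell_coord_le[OF p0 \<sigma>d, of m i n] N[rule_format, OF that] by simp
      then show "\<exists>M. \<forall>m\<ge>M. \<forall>n\<ge>M. norm (\<sigma> m i - \<sigma> n i) < e" by blast
    qed
    then have "\<forall>i. \<exists>l. (\<lambda>n. \<sigma> n i) \<longlonglongrightarrow> l" using Cauchy_convergent_iff convergent_def by blast
    then obtain x where x: "\<And>i. (\<lambda>n. \<sigma> n i) \<longlonglongrightarrow> x i" by metis
    have close: "(\<lambda>i. \<sigma> m i - x i) \<in> carrier (ell p) \<and> vnorm (ell p) (\<lambda>i. \<sigma> m i - x i) \<le> e"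
      if e: "e > 0" and N: "\<forall>m\<ge>N. \<forall>n\<ge>N. vnorm (ell p) (\<lambda>i. \<sigma> m i - \<sigma> n i) < e" and m: "m \<ge> N" for e N m
    proof -
      have "(\<Sum>i<k. cmod (\<sigma> m i - x i) powr p) \<le> e powr p" for k
      proof (rule LIMSEQ_le_const2)
        show "(\<lambda>n. \<Sum>i<k. cmod (\<sigma> m i - \<sigma> n i) powr p) \<longlonglongrightarrow> (\<Sum>i<k. cmod (\<sigma> m i - x i) powr p)"
          using p0 by (intro tendsto_sum tendsto_powr' tendsto_norm tendsto_diff tendsto_const x) auto
        show "\<exists>M. \<forall>n\<ge>M. (\<Sum>i<k. cmod (\<sigma> m i - \<sigma> n i) powr p) \<le> e powr p"
        proof (intro exI allI impI)
          fix n assume "n \<ge> N"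
          then have "vnorm (ell p) (\<lambda>i. \<sigma> m i - \<sigma> n i) \<le> e" using N[rule_format, OF m] by fastforce
          then show "(\<Sum>i<k. cmod (\<sigma> m i - \<sigma> n i) powr p) \<le> e powr p"
            using p0 by (intro order_trans[OF ell_D[OF p0 \<sigma>d] powr_mono2]) (auto simp: vnorm_ell_nonneg)
        qed
      qed
      from ell_I[OF p0 _ this] e show ?thesis by simp
    qed
    have xE: "x \<in> carrier (ell p)"
    proof -
      obtain N where "\<forall>m\<ge>N. \<forall>n\<ge>N. vnorm (ell p) (\<lambda>i. \<sigma> m i - \<sigma> n i) < 1" using small[of 1] by auto
      from close[OF _ this, of N] have d: "(\<lambda>i. \<sigma> N i - x i) \<in> carrier (ell p)" by simp
      show ?thesis using E.M.minus_closed[OF \<sigma>E[of N] d] unfolding ell_minus[OF p \<sigma>E d] by simp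
    qed
    moreover have "(\<lambda>n. vnorm (ell p) (\<sigma> n \<ominus>\<^bsub>ell p\<^esub> x)) \<longlonglongrightarrow> 0"
    proof (rule LIMSEQ_I)
      fix e :: real assume e: "e > 0"
      obtain N where N: "\<forall>m\<ge>N. \<forall>n\<ge>N. vnorm (ell p) (\<lambda>i. \<sigma> m i - \<sigma> n i) < e/2" using small[of "e/2"] e by auto
      have "norm (vnorm (ell p) (\<sigma> n \<ominus>\<^bsub>ell p\<^esub> x) - 0) < e" if "n \<ge> N" for n
        unfolding ell_minus[OF p \<sigma>E xE] using close[OF _ N that] e vnorm_ell_nonneg[of p "\<lambda>i. \<sigma> n i - x i"] by simp
      then show "\<exists>N. \<forall>n\<ge>N. norm (vnorm (ell p) (\<sigma> n \<ominus>\<^bsub>ell p\<^esub> x) - 0) < e" by blast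
    qed
    ultimately show "\<exists>x\<in>carrier (ell p). (\<lambda>n. vnorm (ell p) (\<sigma> n \<ominus>\<^bsub>ell p\<^esub> x)) \<longlonglongrightarrow> 0" by blast
  qed
qed

lemma ell_tail:
  assumes p: "p > 0" and x: "x \<in> carrier (ell p)"
  shows "(\<lambda>k. vnorm (ell p) (\<lambda>n. if n < k then 0 else x n)) \<longlonglongrightarrow> 0"
proof -
  have s: "summable (\<lambda>n. cmod (x n) powr p)" using x by simp
  have "(\<Sum>n. cmod (if n < k then 0 else x n) powr p) = (\<Sum>n. cmod (x (n + k)) powr p)" for k
  proof -
    have s': "summable (\<lambda>n. cmod (if n < k then 0 else x n) powr p)"
      using ell_dominated(1)[OF p x, of "\<lambda>n. if n < k then 0 else x n"] by simp
    show ?thesis using suminf_split_initial_segment[OF s', of k] by simp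
  qed
  moreover have "(\<lambda>k. \<Sum>n. cmod (x (n + k)) powr p) \<longlonglongrightarrow> 0"
    by (rule suminf_exist_split2[OF s])
  ultimately have "(\<lambda>k. (\<Sum>n. cmod (if n < k then 0 else x n) powr p) powr (1/p)) \<longlonglongrightarrow> 0 powr (1/p)"
    using p s by (intro tendsto_powr') (auto intro!: always_eventually suminf_nonneg summable_ignore_initial_segment)
  then show ?thesis by (simp add: vnorm_ell)
qed

lemma direct_sum_simps [simp]:
  "carrier (direct_sum V W) = carrier V \<times> carrier W" "zero (direct_sum V W) = (\<zero>\<^bsub>V\<^esub>, \<zero>\<^bsub>W\<^esub>)"
  "add (direct_sum V W) = (\<lambda>x y. (fst x \<oplus>\<^bsub>V\<^esub> fst y, snd x \<oplus>\<^bsub>W\<^esub> snd y))"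
  "Module.smult (direct_sum V W) = (\<lambda>c x. (c \<odot>\<^bsub>V\<^esub> fst x, c \<odot>\<^bsub>W\<^esub> snd x))"
  "vnorm (direct_sum V W) = (\<lambda>x. vnorm V (fst x) + vnorm W (snd x))"
  by (auto simp: direct_sum_def fun_eq_iff)

lemma banach_cspace_direct_sum:
  assumes "banach_cspace V" "banach_cspace W"
  shows "banach_cspace (direct_sum V W)"
proof -
  interpret V: banach_cspace V by fact
  interpret W: banach_cspace W by fact
  have "normed_cspace (direct_sum V W)"
  proof (rule normed_cspaceI)
    fix x assume x: "x \<in> carrier (direct_sum V W)" and "vnorm (direct_sum V W) x = 0"
    then have "vnorm V (fst x) = 0" "vnorm W (snd x) = 0"
      by (auto simp: add_nonneg_eq_0_iff)
    then show "x = \<zero>\<^bsub>direct_sum V W\<^esub>" using x by (auto simp: V.vnorm_eq_0_iff W.vnorm_eq_0_iff)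
  next
    fix x y assume "x \<in> carrier (direct_sum V W)" "y \<in> carrier (direct_sum V W)"
    then show "vnorm (direct_sum V W) (x \<oplus>\<^bsub>direct_sum V W\<^esub> y) \<le> vnorm (direct_sum V W) x + vnorm (direct_sum V W) y"
      using V.vnorm_triangle[of "fst x" "fst y"] W.vnorm_triangle[of "snd x" "snd y"] by auto
  qed (auto simp: V.M.a_ac W.M.a_ac V.smult_distr_l W.smult_distr_l V.smult_distr_r W.smult_distr_r V.smult_times W.smult_times
        V.vnorm_smult W.vnorm_smult distrib_left)
  then interpret E: normed_cspace "direct_sum V W" .
  have minus: "x \<ominus>\<^bsub>direct_sum V W\<^esub> y = (fst x \<ominus>\<^bsub>V\<^esub> fst y, snd x \<ominus>\<^bsub>W\<^esub> snd y)"
    if "x \<in> carrier (direct_sum V W)" "y \<in> carrier (direct_sum V W)" for x y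
    using E.a_minus_eq[OF that] that by (auto simp: V.a_minus_eq W.a_minus_eq)
  show ?thesis
  proof (rule E.banach_cspaceI)
    fix \<sigma> assume \<sigma>: "E.Cauchy_seq \<sigma>"
    then have \<sigma>E: "\<sigma> n \<in> carrier (direct_sum V W)" for n by (simp only: E.Cauchy_seq_def)
    have \<sigma>VW: "fst (\<sigma> n) \<in> carrier V" "snd (\<sigma> n) \<in> carrier W" for n using \<sigma>E[of n] by auto
    have small: "\<exists>N. \<forall>m\<ge>N. \<forall>n\<ge>N. vnorm V (fst (\<sigma> m) \<ominus>\<^bsub>V\<^esub> fst (\<sigma> n)) < e \<and> vnorm W (snd (\<sigma> m) \<ominus>\<^bsub>W\<^esub> snd (\<sigma> n)) < e" if "e > 0" for e
    proof -
      obtain N where N: "\<forall>m\<ge>N. \<forall>n\<ge>N. vnorm (direct_sum V W) (\<sigma> m \<ominus>\<^bsub>direct_sum V W\<^esub> \<sigma> n) < e"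
        using \<sigma> \<open>e > 0\<close> unfolding E.Cauchy_seq_def by blast
      have "vnorm V (fst (\<sigma> m) \<ominus>\<^bsub>V\<^esub> fst (\<sigma> n)) < e \<and> vnorm W (snd (\<sigma> m) \<ominus>\<^bsub>W\<^esub> snd (\<sigma> n)) < e" if "m \<ge> N" "n \<ge> N" for m n
        using N[rule_format, OF that] V.vnorm_nonneg[OF V.M.minus_closed[OF \<sigma>VW(1) \<sigma>VW(1)], of m n]
          W.vnorm_nonneg[OF W.M.minus_closed[OF \<sigma>VW(2) \<sigma>VW(2)], of m n] by (simp add: minus[OF \<sigma>E \<sigma>E])
      then show ?thesis by blast
    qed
    have "V.Cauchy_seq (\<lambda>n. fst (\<sigma> n))" "W.Cauchy_seq (\<lambda>n. snd (\<sigma> n))"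
      unfolding V.Cauchy_seq_def W.Cauchy_seq_def using small \<sigma>VW by meson+
    then obtain v w where v: "v \<in> carrier V" "(\<lambda>n. vnorm V (fst (\<sigma> n) \<ominus>\<^bsub>V\<^esub> v)) \<longlonglongrightarrow> 0"
      and w: "w \<in> carrier W" "(\<lambda>n. vnorm W (snd (\<sigma> n) \<ominus>\<^bsub>W\<^esub> w)) \<longlonglongrightarrow> 0"
      using V.Cauchy_seq_converges W.Cauchy_seq_converges by meson
    have "(\<lambda>n. vnorm (direct_sum V W) (\<sigma> n \<ominus>\<^bsub>direct_sum V W\<^esub> (v, w))) \<longlonglongrightarrow> 0"
      using tendsto_add[OF v(2) w(2)] v(1) w(1) by (simp add: minus[OF \<sigma>E])
    then show "\<exists>x\<in>carrier (direct_sum V W). (\<lambda>n. vnorm (direct_sum V W) (\<sigma> n \<ominus>\<^bsub>direct_sum V W\<^esub> x)) \<longlonglongrightarrow> 0"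
      using v(1) w(1) by (intro bexI[of _ "(v, w)"]) auto
  qed
qed

section \<open>Diagonal sums of products of contractions\<close>

definition delta :: "nat \<Rightarrow> nat \<Rightarrow> complex" where
  "delta i = (\<lambda>k. if k = i then 1 else 0)"

lemma ell_finite_support:
  assumes p: "p > 0"
  shows "(\<lambda>k. if k < n then c k else 0) \<in> carrier (ell p)"
    "vnorm (ell p) (\<lambda>k. if k < n then c k else 0) = (\<Sum>i<n. cmod (c i) powr p) powr (1/p)"
proof -
  let ?x = "\<lambda>k. if k < n then c k else 0"
  have "summable (\<lambda>k. cmod (?x k) powr p)"
    by (rule summable_finite[of "{..<n}"]) simp_all
  then show "?x \<in> carrier (ell p)" by (simp only: ell_simps mem_Collect_eq)
  have "(\<Sum>k. cmod (?x k) powr p) = (\<Sum>k<n. cmod (?x k) powr p)"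
    by (rule suminf_finite[of "{..<n}"]) simp_all
  also have "\<dots> = (\<Sum>k<n. cmod (c k) powr p)" by (intro sum.cong) auto
  finally show "vnorm (ell p) ?x = (\<Sum>i<n. cmod (c i) powr p) powr (1/p)" by (simp add: vnorm_ell)
qed

lemma delta_ell [simp]:
  assumes "p > 0"
  shows "delta i \<in> carrier (ell p)" "vnorm (ell p) (delta i) = 1"
proof -
  have eq: "delta i = (\<lambda>k. if k < Suc i then delta i k else 0)" by (auto simp: delta_def)
  have "(\<Sum>k<Suc i. cmod (delta i k) powr p) = (\<Sum>k<Suc i. if k = i then 1 else 0)"
    by (intro sum.cong) (auto simp: delta_def)
  also have "\<dots> = 1" by simp
  finally have s: "(\<Sum>k<Suc i. cmod (delta i k) powr p) = 1" .
  show "delta i \<in> carrier (ell p)" by (subst eq) (rule ell_finite_support[OF assms])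
  show "vnorm (ell p) (delta i) = 1"
    by (subst eq, subst ell_finite_support(2)[OF assms]) (simp only: s powr_one_eq_one)
qed

lemma ell_basis_expansion:
  assumes T: "clinear_map (ell a) (ell b) T" and a: "a > 0"
  shows "T (\<lambda>k. if k < n then c k else 0) j = (\<Sum>i<n. c i * T (delta i) j)"
proof (induction n)
  case 0
  have "T (0 \<odot>\<^bsub>ell a\<^esub> delta 0) = 0 \<odot>\<^bsub>ell b\<^esub> T (delta 0)"
    by (rule clinear_mapD(3)[OF T delta_ell(1)[OF a]])
  then show ?case by simp
next
  case (Suc n)
  let ?x = "\<lambda>k. if k < n then c k else 0"
  have d: "c n \<odot>\<^bsub>ell a\<^esub> delta n \<in> carrier (ell a)"
    using ell_finite_support(1)[OF a, of "Suc n" "\<lambda>k. c n * delta n k"]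
    by (rule back_subst[of "\<lambda>x. x \<in> carrier (ell a)"]) (auto simp: delta_def fun_eq_iff)
  have "(\<lambda>k. if k < Suc n then c k else 0) = ?x \<oplus>\<^bsub>ell a\<^esub> (c n \<odot>\<^bsub>ell a\<^esub> delta n)"
    by (auto simp: delta_def fun_eq_iff less_Suc_eq)
  then have "T (\<lambda>k. if k < Suc n then c k else 0) = T (?x \<oplus>\<^bsub>ell a\<^esub> (c n \<odot>\<^bsub>ell a\<^esub> delta n))" by simp
  also have "\<dots> = T ?x \<oplus>\<^bsub>ell b\<^esub> T (c n \<odot>\<^bsub>ell a\<^esub> delta n)"
    by (rule clinear_mapD(2)[OF T ell_finite_support(1)[OF a] d])
  also have "T (c n \<odot>\<^bsub>ell a\<^esub> delta n) = c n \<odot>\<^bsub>ell b\<^esub> T (delta n)"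
    by (rule clinear_mapD(3)[OF T delta_ell(1)[OF a]])
  finally show ?case using Suc by simp
qed

definition ell_contraction :: "real \<Rightarrow> real \<Rightarrow> ((nat \<Rightarrow> complex) \<Rightarrow> (nat \<Rightarrow> complex)) \<Rightarrow> bool" where
  "ell_contraction a b T \<longleftrightarrow> clinear_map (ell a) (ell b) T \<and>
     (\<forall>x\<in>carrier (ell a). vnorm (ell b) (T x) \<le> vnorm (ell a) x)"

lemma ell_contractionD:
  assumes "ell_contraction a b T"
  shows "clinear_map (ell a) (ell b) T" "x \<in> carrier (ell a) \<Longrightarrow> vnorm (ell b) (T x) \<le> vnorm (ell a) x"
  using assms unfolding ell_contraction_def by blast+

lemma ell_contraction_contractive:
  assumes T: "ell_contraction a b T" and a: "a > 0" and b: "b > 0"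
  shows "contractive b a n N (\<lambda>i j. T (delta i) j)"
  unfolding contractive_def
proof (intro allI)
  fix c :: "nat \<Rightarrow> complex"
  note lin = ell_contractionD(1)[OF T]
  let ?x = "\<lambda>k. if k < n then c k else 0"
  note x = ell_finite_support[OF a, of n c]
  have e: "T ?x j = (\<Sum>i<n. c i * T (delta i) j)" for j
    using ell_basis_expansion[OF lin a, of n c j] .
  have "(\<Sum>j<N. cmod (\<Sum>i<n. c i * T (delta i) j) powr b) = (\<Sum>j<N. cmod (T ?x j) powr b)"
    unfolding e ..
  also have "\<dots> \<le> vnorm (ell b) (T ?x) powr b"
    by (rule ell_D[OF b clinear_mapD(1)[OF lin x(1)]])
  also have "\<dots> \<le> vnorm (ell a) ?x powr b"
    using ell_contractionD(2)[OF T x(1)] b by (intro powr_mono2 vnorm_ell_nonneg) simp_all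
  also have "\<dots> = (\<Sum>i<n. cmod (c i) powr a) powr (b/a)"
    unfolding x(2) by (simp add: powr_powr)
  finally show "(\<Sum>j<N. cmod (\<Sum>i<n. c i * T (delta i) j) powr b) \<le> (\<Sum>i<n. cmod (c i) powr a) powr (b/a)" .
qed

lemma ell_product_entry:
  assumes S: "ell_contraction b a S" and a: "a \<ge> 1" and b: "b \<ge> 1" and g: "g \<in> carrier (ell b)"
  shows "(\<lambda>N. \<Sum>j<N. g j * S (delta j) i) \<longlonglongrightarrow> S g i"
proof -
  note lin = ell_contractionD(1)[OF S]
  have a0: "a > 0" and b0: "b > 0" using a b by auto
  have "norm ((\<Sum>j<N. g j * S (delta j) i) - S g i) \<le> vnorm (ell b) (\<lambda>n. if n < N then 0 else g n)" for N
  proof -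
    let ?h = "\<lambda>n. if n < N then g n else 0" and ?t = "\<lambda>n. if n < N then 0 else g n"
    have h: "?h \<in> carrier (ell b)" by (rule ell_finite_support[OF b0])
    have t: "?t \<in> carrier (ell b)" by (rule ell_dominated(1)[OF b0 g]) auto
    have "S (?h \<oplus>\<^bsub>ell b\<^esub> ?t) = S ?h \<oplus>\<^bsub>ell a\<^esub> S ?t" by (rule clinear_mapD(2)[OF lin h t])
    moreover have "?h \<oplus>\<^bsub>ell b\<^esub> ?t = g" by auto
    ultimately have "S g i = S ?h i + S ?t i" by simp
    then have "norm ((\<Sum>j<N. g j * S (delta j) i) - S g i) = cmod (S ?t i)"
      by (simp add: ell_basis_expansion[OF lin b0])
    also have "\<dots> \<le> vnorm (ell a) (S ?t)" by (rule ell_coord_le[OF a0 clinear_mapD(1)[OF lin t]])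
    also have "\<dots> \<le> vnorm (ell b) ?t" by (rule ell_contractionD(2)[OF S t])
    finally show ?thesis .
  qed
  from Lim_null_comparison[OF always_eventually[OF allI[OF this]] ell_tail[OF b0 g]]
  show ?thesis by (rule LIM_zero_cancel)
qed

text \<open>
  The entries of \<open>T\<close> and the transposed entries of \<open>S\<close>, truncated at \<open>N\<close>, are
  contractive matrices for conjugate pairs of exponents, and the bound of \<open>trace_estimate\<close> is
  uniform in \<open>N\<close>. An exponent \<open>\<delta> \<le> 1\<close> makes the bound increasing in \<open>n\<close>.
\<close>

theorem ell_trace_estimate:
  assumes "1 < a" "1 < b" "a \<noteq> 2" "b \<noteq> 2" "a \<noteq> b"
  shows "\<exists>C \<delta>. 0 < \<delta> \<and> \<delta> \<le> 1 \<and> 0 \<le> C \<and> (\<forall>n S T. ell_contraction a b T \<longrightarrow> ell_contraction b a S \<longrightarrow>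
     cmod (\<Sum>i<n. S (T (delta i)) i) \<le> C * real n powr (1 - \<delta>))"
proof -
  have ab: "b \<noteq> a" using assms(5) by simp
  from trace_estimate[OF assms(2,1,3,4) ab] obtain C \<delta> where C\<delta>: "0 < \<delta> \<and> 0 \<le> C \<and> (\<forall>n N x y. contractive b a n N x \<longrightarrow> contractive (b/(b-1)) (a/(a-1)) n N y \<longrightarrow>
     (\<Sum>j<N. \<Sum>i<n. cmod (x i j) * cmod (y i j)) \<le> C * real n powr (1 - \<delta>))"
    by (elim exE)
  then have C: "0 < \<delta>" "0 \<le> C" by (simp_all only:)
  note est = conjunct2[OF conjunct2[OF C\<delta>], rule_format]
  have main: "cmod (\<Sum>i<n. S (T (delta i)) i) \<le> C * real n powr (1 - \<delta>)"
    if T: "ell_contraction a b T" and S: "ell_contraction b a S" for n S T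
  proof -
    have "T (delta i) \<in> carrier (ell b)" for i
      using assms(1) by (intro clinear_mapD(1)[OF ell_contractionD(1)[OF T]] delta_ell) simp
    then have "(\<lambda>N. \<Sum>i<n. \<Sum>j<N. T (delta i) j * S (delta j) i) \<longlonglongrightarrow> (\<Sum>i<n. S (T (delta i)) i)"
      using assms by (intro tendsto_sum ell_product_entry[OF S]) auto
    then have lim: "(\<lambda>N. cmod (\<Sum>i<n. \<Sum>j<N. T (delta i) j * S (delta j) i)) \<longlonglongrightarrow> cmod (\<Sum>i<n. S (T (delta i)) i)"
      by (rule tendsto_norm)
    have "cmod (\<Sum>i<n. \<Sum>j<N. T (delta i) j * S (delta j) i) \<le> C * real n powr (1 - \<delta>)" for N
    proof -
      have "cmod (\<Sum>i<n. \<Sum>j<N. T (delta i) j * S (delta j) i) \<le> (\<Sum>i<n. \<Sum>j<N. cmod (T (delta i) j) * cmod (S (delta j) i))"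
        unfolding norm_mult[symmetric] by (intro sum_norm_le norm_sum)
      also have "\<dots> = (\<Sum>j<N. \<Sum>i<n. cmod (T (delta i) j) * cmod (S (delta j) i))" by (rule sum.swap)
      also have "\<dots> \<le> C * real n powr (1 - \<delta>)"
      proof (rule est)
        show "contractive b a n N (\<lambda>i j. T (delta i) j)"
          using assms by (intro ell_contraction_contractive T) auto
        have "contractive a b N n (\<lambda>j i. S (delta j) i)"
          using assms by (intro ell_contraction_contractive S) auto
        then show "contractive (b/(b-1)) (a/(a-1)) n N (\<lambda>i j. S (delta j) i)"
          by (rule contractive_transpose[OF assms(1,2)])
      qed
      finally show ?thesis .
    qed
    then show ?thesis by (intro LIMSEQ_le_const2[OF lim]) auto
  qed
  show ?thesis
  proof (rule exI[of _ C], rule exI[of _ "min \<delta> 1"], intro conjI allI impI)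
    fix n S T assume "ell_contraction a b T" "ell_contraction b a S"
    then have "cmod (\<Sum>i<n. S (T (delta i)) i) \<le> C * real n powr (1 - \<delta>)" by (rule main)
    also have "\<dots> \<le> C * real n powr (1 - min \<delta> 1)"
    proof (cases "n = 0")
      case False
      then show ?thesis using C by (intro mult_left_mono powr_mono) auto
    qed simp
    finally show "cmod (\<Sum>i<n. S (T (delta i)) i) \<le> C * real n powr (1 - min \<delta> 1)" .
  qed (use C in auto)
qed

section \<open>The direct sum of two sequence spaces\<close>

definition sum_coord :: "nat + nat \<Rightarrow> (nat \<Rightarrow> complex) \<times> (nat \<Rightarrow> complex) \<Rightarrow> complex" where
  "sum_coord i v = case_sum (fst v) (snd v) i"

definition sum_bas :: "nat + nat \<Rightarrow> (nat \<Rightarrow> complex) \<times> (nat \<Rightarrow> complex)" where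
  "sum_bas i = case_sum (\<lambda>n. (delta n, \<lambda>_. 0)) (\<lambda>n. (\<lambda>_. 0, delta n)) i"

definition sum_cut :: "(nat + nat) set \<Rightarrow> (nat \<Rightarrow> complex) \<times> (nat \<Rightarrow> complex) \<Rightarrow> (nat \<Rightarrow> complex) \<times> (nat \<Rightarrow> complex)" where
  "sum_cut S v = (\<lambda>n. if Inl n \<in> S then fst v n else 0, \<lambda>n. if Inr n \<in> S then snd v n else 0)"

lemma zero_ell [simp]: "p > 0 \<Longrightarrow> vnorm (ell p) (\<lambda>n. 0) = 0"
  by (simp add: vnorm_ell)

lemma split_basis_ell_sum:
  assumes p: "1 < p" and q: "1 < q"
  shows "split_basis (direct_sum (ell p) (ell q)) sum_coord sum_bas sum_cut (\<lambda>k. {..<k} <+> {..<k})"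
proof -
  let ?V = "direct_sum (ell p) (ell q)"
  interpret V: banach_cspace ?V
    using p q by (intro banach_cspace_direct_sum banach_cspace_ell) auto
  have p0: "p > 0" and q0: "q > 0" using p q by auto
  have cut1: "(\<lambda>n. if Inl n \<in> S then x n else 0) \<in> carrier (ell p)"
    "vnorm (ell p) (\<lambda>n. if Inl n \<in> S then x n else 0) \<le> vnorm (ell p) x" if "x \<in> carrier (ell p)" for x and S :: "(nat + nat) set"
    using ell_dominated[OF p0 that, of "\<lambda>n. if Inl n \<in> S then x n else 0"] by auto
  have cut2: "(\<lambda>n. if Inr n \<in> S then x n else 0) \<in> carrier (ell q)"
    "vnorm (ell q) (\<lambda>n. if Inr n \<in> S then x n else 0) \<le> vnorm (ell q) x" if "x \<in> carrier (ell q)" for x and S :: "(nat + nat) set"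
    using ell_dominated[OF q0 that, of "\<lambda>n. if Inr n \<in> S then x n else 0"] by auto
  show ?thesis
    unfolding split_basis_def
  proof unfold_locales
    fix x y assume "x \<in> carrier ?V" "y \<in> carrier ?V" and eq: "\<And>i. sum_coord i x = sum_coord i y"
    show "x = y"
      using eq[of "Inl _"] eq[of "Inr _"] by (auto simp: sum_coord_def prod_eq_iff fun_eq_iff)
  next
    fix x i assume x: "x \<in> carrier ?V"
    then show "cmod (sum_coord i x) \<le> vnorm ?V x"
      using ell_coord_le[OF p0, of "fst x"] ell_coord_le[OF q0, of "snd x"] vnorm_ell_nonneg[of p "fst x"] vnorm_ell_nonneg[of q "snd x"]
      by (cases i) (auto simp: sum_coord_def simp del: ell_simps intro: add_increasing add_increasing2)
  next
    fix i show "sum_bas i \<in> carrier ?V"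
      using delta_ell[OF p0] delta_ell[OF q0] by (cases i) (auto simp: sum_bas_def)
    show "vnorm ?V (sum_bas i) \<le> 1"
      using p0 q0 by (cases i) (simp_all add: sum_bas_def)
  next
    fix x S assume x: "x \<in> carrier ?V"
    then have fs: "fst x \<in> carrier (ell p)" "snd x \<in> carrier (ell q)" by auto
    show "sum_cut S x \<in> carrier ?V"
      using cut1(1)[OF fs(1)] cut2(1)[OF fs(2)] by (simp add: sum_cut_def del: ell_simps)
    show "vnorm ?V (sum_cut S x) \<le> vnorm ?V x"
      using cut1(2)[OF fs(1), of S] cut2(2)[OF fs(2), of S] by (simp add: sum_cut_def)
  next
    fix i :: "nat + nat"
    show "\<exists>k. i \<in> {..<k} <+> {..<k}"
      by (cases i) (auto intro: exI[of _ "Suc _"])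
  next
    fix x assume "x \<in> carrier ?V"
    then have fs: "fst x \<in> carrier (ell p)" "snd x \<in> carrier (ell q)" by auto
    have "(\<lambda>k. vnorm ?V (sum_cut (- ({..<k} <+> {..<k})) x)) =
        (\<lambda>k. vnorm (ell p) (\<lambda>n. if n < k then 0 else fst x n) + vnorm (ell q) (\<lambda>n. if n < k then 0 else snd x n))"
      by (simp add: sum_cut_def if_distrib cong: if_cong)
         (auto intro!: ext arg_cong2[of _ _ _ _ "(+)"] arg_cong[of _ _ "vnorm _"])
    then show "(\<lambda>k. vnorm ?V (sum_cut (- ({..<k} <+> {..<k})) x)) \<longlonglongrightarrow> 0"
      using tendsto_add[OF ell_tail[OF p0 fs(1)] ell_tail[OF q0 fs(2)]] by simp
  qed (auto simp: sum_coord_def sum_bas_def sum_cut_def delta_def split: sum.splits)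
qed

text \<open>
  An operator that passes through both summands can be factored through whichever of them is
  needed, by merging the other passage into an outer factor.
\<close>

lemma (in split_basis) factored_through:
  assumes "w \<in> factored" and T: "T = P \<or> T = - P"
  shows "\<exists>u v. bounded_by 1 u \<and> bounded_by 1 v \<and> w = (\<lambda>x. u (cut T (v x)))"
proof -
  obtain S c1 c2 c3 where S: "S = P \<or> S = - P" and c: "bounded_by 1 c1" "bounded_by 1 c2" "bounded_by 1 c3"
    and w: "w = (\<lambda>x. c1 (cut S (c2 (cut (- S) (c3 x)))))"
    using assms(1) by (auto simp: factored_def)
  show ?thesis
  proof (cases "T = S")
    case True
    have "bounded_by 1 (\<lambda>x. c2 (cut (- S) (c3 x)))"
      using bounded_by_comp[OF c(2) bounded_by_comp[OF bounded_by_cut c(3)]] by simp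
    then show ?thesis using c w True by blast
  next
    case False
    then have T: "T = - S" using S T by auto
    have "bounded_by 1 (\<lambda>x. c1 (cut S (c2 x)))"
      using bounded_by_comp[OF c(1) bounded_by_comp[OF bounded_by_cut c(2)]] by simp
    then show ?thesis using c w T by blast
  qed
qed

theorem theorem6p9:
  fixes p q :: real
  assumes "1 < p" and "1 < q" and "p \<noteq> q" and "p \<noteq> 2" and "q \<noteq> 2"
  shows "\<not> amenable (approximable_algebra (direct_sum (ell p) (ell q)))"
proof -
  let ?V = "direct_sum (ell p) (ell q)"
  interpret split_basis ?V sum_coord sum_bas sum_cut "\<lambda>k. {..<k} <+> {..<k}" "range Inl"
    by (rule split_basis_ell_sum[OF assms(1,2)])
  have p0: "p > 0" and q0: "q > 0" using assms by auto
  have emb1: "(x, \<lambda>_. 0) \<in> carrier ?V" "vnorm ?V (x, \<lambda>_. 0) = vnorm (ell p) x" if "x \<in> carrier (ell p)" for x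
    using that q0 by auto
  have emb2: "(\<lambda>_. 0, y) \<in> carrier ?V" "vnorm ?V (\<lambda>_. 0, y) = vnorm (ell q) y" if "y \<in> carrier (ell q)" for y
    using that p0 by auto
  have in1: "ell_contraction p q (\<lambda>x. snd (u (x, \<lambda>_. 0)))" if u: "bounded_by 1 u" for u
    unfolding ell_contraction_def
  proof (intro conjI clinear_mapI ballI)
    fix x assume x: "x \<in> carrier (ell p)"
    show "snd (u (x, \<lambda>_. 0)) \<in> carrier (ell q)"
      using bounded_byD(2)[OF u emb1(1)[OF x]] by (simp add: mem_Times_iff)
    show "vnorm (ell q) (snd (u (x, \<lambda>_. 0))) \<le> vnorm (ell p) x"
      using bounded_byD(5)[OF u emb1(1)[OF x]] emb1(2)[OF x] vnorm_ell_nonneg[of p "fst (u (x, \<lambda>_. 0))"] by simp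
    show "snd (u (c \<odot>\<^bsub>ell p\<^esub> x, \<lambda>_. 0)) = c \<odot>\<^bsub>ell q\<^esub> snd (u (x, \<lambda>_. 0))" for c
      using bounded_byD(4)[OF u emb1(1)[OF x], of c] by simp
    fix y assume y: "y \<in> carrier (ell p)"
    show "snd (u (x \<oplus>\<^bsub>ell p\<^esub> y, \<lambda>_. 0)) = snd (u (x, \<lambda>_. 0)) \<oplus>\<^bsub>ell q\<^esub> snd (u (y, \<lambda>_. 0))"
      using bounded_byD(3)[OF u emb1(1)[OF x] emb1(1)[OF y]] by simp
  qed
  have in2: "ell_contraction q p (\<lambda>y. fst (u (\<lambda>_. 0, y)))" if u: "bounded_by 1 u" for u
    unfolding ell_contraction_def
  proof (intro conjI clinear_mapI ballI)
    fix x assume x: "x \<in> carrier (ell q)"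
    show "fst (u (\<lambda>_. 0, x)) \<in> carrier (ell p)"
      using bounded_byD(2)[OF u emb2(1)[OF x]] by (simp add: mem_Times_iff)
    show "vnorm (ell p) (fst (u (\<lambda>_. 0, x))) \<le> vnorm (ell q) x"
      using bounded_byD(5)[OF u emb2(1)[OF x]] emb2(2)[OF x] vnorm_ell_nonneg[of q "snd (u (\<lambda>_. 0, x))"] by simp
    show "fst (u (\<lambda>_. 0, c \<odot>\<^bsub>ell q\<^esub> x)) = c \<odot>\<^bsub>ell p\<^esub> fst (u (\<lambda>_. 0, x))" for c
      using bounded_byD(4)[OF u emb2(1)[OF x], of c] by simp
    fix y assume y: "y \<in> carrier (ell q)"
    show "fst (u (\<lambda>_. 0, x \<oplus>\<^bsub>ell q\<^esub> y)) = fst (u (\<lambda>_. 0, x)) \<oplus>\<^bsub>ell p\<^esub> fst (u (\<lambda>_. 0, y))"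
      using bounded_byD(3)[OF u emb2(1)[OF x] emb2(1)[OF y]] by simp
  qed
  from ell_trace_estimate[OF assms(1,2,4,5,3)] obtain C1 d1 where Cd1: "0 < d1 \<and> d1 \<le> 1 \<and> 0 \<le> C1 \<and>
     (\<forall>n S T. ell_contraction p q T \<longrightarrow> ell_contraction q p S \<longrightarrow> cmod (\<Sum>i<n. S (T (delta i)) i) \<le> C1 * real n powr (1 - d1))"
    by (elim exE)
  then have d1: "0 < d1" "d1 \<le> 1" "0 \<le> C1" by simp_all
  note est1 = conjunct2[OF conjunct2[OF conjunct2[OF Cd1]], rule_format]
  from ell_trace_estimate[OF assms(2,1,5,4) assms(3)[symmetric]] obtain C2 d2 where Cd2: "0 < d2 \<and> d2 \<le> 1 \<and> 0 \<le> C2 \<and>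
     (\<forall>n S T. ell_contraction q p T \<longrightarrow> ell_contraction p q S \<longrightarrow> cmod (\<Sum>i<n. S (T (delta i)) i) \<le> C2 * real n powr (1 - d2))"
    by (elim exE)
  then have d2: "0 < d2" "d2 \<le> 1" "0 \<le> C2" by simp_all
  note est2 = conjunct2[OF conjunct2[OF conjunct2[OF Cd2]], rule_format]
  \<comment> \<open>the first summand, with the passage through the second one in the middle\<close>
  have diag1: "cmod (\<Sum>i\<in>({..<k} <+> {..<k}) \<inter> Inl ` {..<n}. sum_coord i (w (sum_bas i))) \<le> C1 * real n powr (1 - d1)"
    if w: "w \<in> factored" for k n w
  proof -
    obtain u v where u: "bounded_by 1 u" and v: "bounded_by 1 v" and w: "w = (\<lambda>x. u (sum_cut (- range Inl) (v x)))"
      using factored_through[OF w, of "- range Inl"] by blast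
    let ?T = "\<lambda>x. snd (v (x, \<lambda>_. 0))" and ?S = "\<lambda>y. fst (u (\<lambda>_. 0, y))"
    have cut: "sum_cut (- range Inl) z = (\<lambda>_. 0, snd z)" for z
      by (auto simp: sum_cut_def fun_eq_iff)
    have entry: "sum_coord (Inl i) (w (sum_bas (Inl i))) = ?S (?T (delta i)) i" for i
      unfolding w cut by (simp add: sum_coord_def sum_bas_def)
    have J: "({..<k} <+> {..<k}) \<inter> Inl ` {..<n} = (Inl ` {..<min k n} :: (nat + nat) set)" by auto
    have "(\<Sum>i\<in>({..<k} <+> {..<k}) \<inter> Inl ` {..<n}. sum_coord i (w (sum_bas i))) = (\<Sum>i<min k n. ?S (?T (delta i)) i)"
      unfolding J by (subst sum.reindex) (simp_all add: entry)
    also have "cmod \<dots> \<le> C1 * real (min k n) powr (1 - d1)" by (rule est1[OF in1[OF v] in2[OF u]])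
    also have "\<dots> \<le> C1 * real n powr (1 - d1)" using d1 by (intro mult_left_mono powr_mono2) auto
    finally show ?thesis .
  qed
  \<comment> \<open>the second summand, with the passage through the first one in the middle\<close>
  have diag2: "cmod (\<Sum>i\<in>({..<k} <+> {..<k}) \<inter> Inr ` {..<n}. sum_coord i (w (sum_bas i))) \<le> C2 * real n powr (1 - d2)"
    if w: "w \<in> factored" for k n w
  proof -
    obtain u v where u: "bounded_by 1 u" and v: "bounded_by 1 v" and w: "w = (\<lambda>x. u (sum_cut (range Inl) (v x)))"
      using factored_through[OF w, of "range Inl"] by blast
    let ?T = "\<lambda>y. fst (v (\<lambda>_. 0, y))" and ?S = "\<lambda>x. snd (u (x, \<lambda>_. 0))"
    have cut: "sum_cut (range Inl) z = (fst z, \<lambda>_. 0)" for z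
      by (auto simp: sum_cut_def fun_eq_iff)
    have entry: "sum_coord (Inr i) (w (sum_bas (Inr i))) = ?S (?T (delta i)) i" for i
      unfolding w cut by (simp add: sum_coord_def sum_bas_def)
    have J: "({..<k} <+> {..<k}) \<inter> Inr ` {..<n} = (Inr ` {..<min k n} :: (nat + nat) set)" by auto
    have "(\<Sum>i\<in>({..<k} <+> {..<k}) \<inter> Inr ` {..<n}. sum_coord i (w (sum_bas i))) = (\<Sum>i<min k n. ?S (?T (delta i)) i)"
      unfolding J by (subst sum.reindex) (simp_all add: entry)
    also have "cmod \<dots> \<le> C2 * real (min k n) powr (1 - d2)" by (rule est2[OF in2[OF v] in1[OF u]])
    also have "\<dots> \<le> C2 * real n powr (1 - d2)" using d2 by (intro mult_left_mono powr_mono2) auto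
    finally show ?thesis .
  qed
  have decay: "\<forall>\<^sub>F n in sequentially. C * real n powr (1 - d) \<le> e * real n" if "d > 0" "e > 0" for C d e :: real
  proof -
    have "(\<lambda>n. C * real n powr (- d)) \<longlonglongrightarrow> C * 0"
      using that by (intro tendsto_mult tendsto_const tendsto_neg_powr filterlim_real_sequentially) auto
    then have "\<forall>\<^sub>F n in sequentially. C * real n powr (- d) < e"
      using that by (intro order_tendstoD(2)) auto
    then show ?thesis
    proof (rule eventually_mono)
      fix n :: nat assume "C * real n powr (- d) < e"
      then have "C * real n powr (- d) * real n \<le> e * real n" by (intro mult_right_mono) auto
      moreover have "real n powr (- d) * real n = real n powr (1 - d)"
        by (cases "n = 0") (simp_all add: powr_diff powr_minus field_simps)
      ultimately show "C * real n powr (1 - d) \<le> e * real n" by (simp add: mult.assoc)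
    qed
  qed
  show ?thesis
  proof (rule not_amenable)
    fix e :: real assume e: "e > 0"
    have "\<forall>\<^sub>F n in sequentially. 1 / e \<le> real n"
      by (rule filterlim_at_top[THEN iffD1, rule_format, OF filterlim_real_sequentially])
    then have "\<forall>\<^sub>F n in sequentially. 1 / e \<le> real n \<and> C1 * real n powr (1 - d1) \<le> e * real n \<and> C2 * real n powr (1 - d2) \<le> e * real n"
      using decay[OF d1(1) e, of C1] decay[OF d2(1) e, of C2] by eventually_elim auto
    then obtain n where n: "1 / e \<le> real n" "C1 * real n powr (1 - d1) \<le> e * real n" "C2 * real n powr (1 - d2) \<le> e * real n"
      using eventually_happens[of _ sequentially] sequentially_bot by blast
    have card: "card (Inl ` {..<n} :: (nat + nat) set) = n" "card (Inr ` {..<n} :: (nat + nat) set) = n"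
      by (simp_all add: card_image)
    show "\<exists>J K. finite J \<and> finite K \<and> J \<subseteq> range Inl \<and> K \<subseteq> - range Inl \<and> card J = card K \<and> 1 \<le> e * real (card J) \<and>
     (\<forall>w\<in>factored. \<forall>k. cmod (\<Sum>i\<in>({..<k} <+> {..<k}) \<inter> J. sum_coord i (w (sum_bas i))) \<le> e * real (card J) \<and>
        cmod (\<Sum>i\<in>({..<k} <+> {..<k}) \<inter> K. sum_coord i (w (sum_bas i))) \<le> e * real (card J))"
    proof (rule exI[of _ "Inl ` {..<n}"], rule exI[of _ "Inr ` {..<n}"], unfold card, intro conjI ballI allI)
      show "1 \<le> e * real n" using n(1) e by (simp add: field_simps)
    qed (use n(2,3) order_trans[OF diag1] order_trans[OF diag2] in auto)
  qed
qed

end
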